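(* Assume $\mathfrak u<\mathfrak d$. For an unbounded metric space $X$ of bounded geometry the following conditions are equivalent: (1) $X$ is coarsely equivalent to the Cantor macro-cube $2^{<\mathbb N}$; (2) the corona $\check X$ of $X$ is homeomorphic to the corona of $2^{<\mathbb N}$; (3) $\dim \check X=0$ and $\mathrm{m}\chi(\check X)=\mathfrak d$.
   Context: For a metric space $(X,d)$, $B_\varepsilon(x)=\{y\in X:d(x,y)\le\varepsilon\}$ and, for $A\subset X$, $B_\varepsilon(A)=\bigcup_{a\in A}B_\varepsilon(a)$. Corona: let $X$ be an unbounded metric space. Let $\beta X_d$ be the Stone-Čech compactification of $X$ endowed with the discrete topology, i.e. the space of all ultrafilters on the set $X$ with the topology generated by the sets $\bar A=\{p:A\in p\}$, $A\subset X$. Let $X^\sharp\subset\beta X_d$ be the closed subspace of all ultrafilters containing every set $X\setminus B$ with $B\subset X$ bounded. Two ultrafilters $p,q\in X^\sharp$ are parallel if for some real $\varepsilon>0$ we have $\{B_\varepsilon(P):P\in p\}\subset q$ and $\{B_\varepsilon(Q):Q\in q\}\subset p$. The corona $\check X$ is the quotient space $X^\sharp/_\sim$, where $\sim$ is the smallest closed equivalence relation on $X^\sharp$ (closed as a subset of $X^\sharp\times X^\sharp$) containing the parallel relation. Cantor macro-cube: $2^{<\mathbb N}=\{(x_i)_{i=1}^\infty\in\{0,1\}^{\mathbb N}:\exists n\in\mathbb N\ \forall m\ge n\ x_m=0\}$ endowed with the ultrametric $d((x_n),(y_n))=\max_{n\in\mathbb N}2^n|x_n-y_n|$. Coarse equivalence: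 a function $f:X\to Y$ between metric spaces $(X,d_X)$, $(Y,d_Y)$ is coarse if for any $\delta<\infty$ there is $\varepsilon<\infty$ such that $d_X(x,x')\le\delta$ implies $d_Y(f(x),f(x'))\le\varepsilon$ for all $x,x'\in X$. Metric spaces $X,Y$ are coarsely equivalent if there are coarse functions $f:X\to Y$ and $g:Y\to X$ with $\max\{\sup_{y\in Y}d_Y(f\circ g(y),y),\ \sup_{x\in X}d_X(g\circ f(x),x)\}<\infty$. Bounded geometry: $X$ has bounded geometry if there is $\varepsilon<\infty$ such that for every $\delta<\infty$ there is $N\in\mathbb N$ such that each $\delta$-ball in $X$ can be covered by at most $N$ balls of radius $\varepsilon$. $\dim$ denotes topological (covering) dimension. For a topological space $T$ and $t\in T$, the character $\chi(t,T)$ is the smallest cardinality of a neighborhood base at $t$; the minimal character is $\mathrm{m}\chi(T)=\min_{t\in T}\chi(t,T)$. The cardinal $\mathfrak u$ is $\mathrm{m}\chi(\omega^* )$, where $\omega^*=\beta\omega\setminus\omega$ is the Stone-Čech remainder of the countable discrete space $\omega$; $\mathfrak d$ is the cofinality of $\omega^\omega$ ordered by $f\le g$ iff $f(n)\le g(n)$ for all $n$. *)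

theory Defs
  imports "HOL-Analysis.Analysis"
begin

unbundle cardinal_syntax
no_notation elt_set_eq (infix \<open>=o\<close> 50)

section \<open>Coarse notions for metric spaces\<close>

definition unbounded_metric :: "'a metric \<Rightarrow> bool" where
  "unbounded_metric X \<longleftrightarrow> \<not> Metric_space.mbounded (mspace X) (mdist X) (mspace X)"

definition set_nbhd :: "'a metric \<Rightarrow> real \<Rightarrow> 'a set \<Rightarrow> 'a set" where
  "set_nbhd X \<epsilon> A = (\<Union>a\<in>A. mcball_of X a \<epsilon>)"

definition coarse_map :: "'a metric \<Rightarrow> 'b metric \<Rightarrow> ('a \<Rightarrow> 'b) \<Rightarrow> bool" where
  "coarse_map X Y f \<longleftrightarrow>
     f \<in> mspace X \<rightarrow> mspace Y \<and>
     (\<forall>\<delta>::real. \<exists>\<epsilon>::real. \<forall>x\<in>mspace X. \<forall>x'\<in>mspace X.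
        mdist X x x' \<le> \<delta> \<longrightarrow> mdist Y (f x) (f x') \<le> \<epsilon>)"

definition coarsely_equivalent :: "'a metric \<Rightarrow> 'b metric \<Rightarrow> bool" where
  "coarsely_equivalent X Y \<longleftrightarrow>
     (\<exists>f g. coarse_map X Y f \<and> coarse_map Y X g \<and>
        (\<exists>C::real. (\<forall>y\<in>mspace Y. mdist Y (f (g y)) y \<le> C) \<and>
                   (\<forall>x\<in>mspace X. mdist X (g (f x)) x \<le> C)))"

definition bounded_geometry :: "'a metric \<Rightarrow> bool" where
  "bounded_geometry X \<longleftrightarrow>
     (\<exists>\<epsilon>::real. \<forall>\<delta>::real. \<exists>N::nat. \<forall>x\<in>mspace X.
        \<exists>C\<subseteq>mspace X. finite C \<and> card C \<le> N \<and>
          mcball_of X x \<delta> \<subseteq> (\<Union>c\<in>C. mcball_of X c \<epsilon>))"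

section \<open>The Cantor macro-cube\<close>

text \<open>
  Coordinates are numbered from \<open>0\<close> here and from \<open>1\<close> in the usual notation: \<open>x n\<close> stands for
  \<open>x\<^sub>n\<^sub>+\<^sub>1\<close>, hence the weight \<open>2 ^ (n + 1)\<close>. The value \<open>0\<close> off the carrier only serves to meet the
  totality requirements of \<^locale>\<open>Metric_space\<close>.
\<close>

definition macro_cube_carrier :: "(nat \<Rightarrow> nat) set" where
  "macro_cube_carrier = {x. (\<forall>n. x n \<in> {0, 1}) \<and> (\<exists>n. \<forall>m\<ge>n. x m = 0)}"

definition macro_cube_dist :: "(nat \<Rightarrow> nat) \<Rightarrow> (nat \<Rightarrow> nat) \<Rightarrow> real" where
  "macro_cube_dist x y =
     (if x \<in> macro_cube_carrier \<and> y \<in> macro_cube_carrier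
      then Max (range (\<lambda>n. 2 ^ (n + 1) * \<bar>real (x n) - real (y n)\<bar>)) else 0)"

definition cantor_macro_cube :: "(nat \<Rightarrow> nat) metric" where
  "cantor_macro_cube = metric (macro_cube_carrier, macro_cube_dist)"

lemma finite_macro_cube_weights:
  assumes "x \<in> macro_cube_carrier" "y \<in> macro_cube_carrier"
  shows "finite (range (\<lambda>n. 2 ^ (n + 1) * \<bar>real (x n) - real (y n)\<bar>))"
proof -
  let ?w = "\<lambda>n. 2 ^ (n + 1) * \<bar>real (x n) - real (y n)\<bar>"
  obtain k l where "\<forall>m\<ge>k. x m = 0" "\<forall>m\<ge>l. y m = 0"
    using assms by (auto simp: macro_cube_carrier_def)
  then have zero: "?w n = 0" if "n \<ge> max k l" for n using that by simp
  have "?w n \<in> insert 0 (?w ` {..<max k l})" for n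
  proof (cases "n < max k l")
    case False
    then show ?thesis using zero[of n] by (simp only: not_less insertI1)
  qed blast
  then have "range ?w \<subseteq> insert 0 (?w ` {..<max k l})" by blast
  then show ?thesis by (rule finite_subset) simp
qed

lemma macro_cube_dist_le_iff:
  assumes "x \<in> macro_cube_carrier" "y \<in> macro_cube_carrier"
  shows "macro_cube_dist x y \<le> c \<longleftrightarrow> (\<forall>n. 2 ^ (n + 1) * \<bar>real (x n) - real (y n)\<bar> \<le> c)"
  using assms finite_macro_cube_weights[OF assms] by (simp add: macro_cube_dist_def)

lemma Metric_space_macro_cube: "Metric_space macro_cube_carrier macro_cube_dist"
proof
  fix x y z
  have ge: "2 ^ (n + 1) * \<bar>real (x n) - real (y n)\<bar> \<le> macro_cube_dist x y"
    if "x \<in> macro_cube_carrier" "y \<in> macro_cube_carrier" for x y n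
    using macro_cube_dist_le_iff[OF that] by blast
  show nonneg: "0 \<le> macro_cube_dist x y" for x y
  proof (cases "x \<in> macro_cube_carrier \<and> y \<in> macro_cube_carrier")
    case True
    have "0 \<le> 2 ^ (0 + 1) * \<bar>real (x 0) - real (y 0)\<bar>" by simp
    also have "\<dots> \<le> macro_cube_dist x y" using True ge by blast
    finally show ?thesis .
  qed (auto simp: macro_cube_dist_def)
  show "macro_cube_dist x y = macro_cube_dist y x"
    by (simp add: macro_cube_dist_def abs_minus_commute conj_commute)
  show "macro_cube_dist x y = 0 \<longleftrightarrow> x = y"
    if xy: "x \<in> macro_cube_carrier" "y \<in> macro_cube_carrier"
  proof -
    have "macro_cube_dist x y = 0 \<longleftrightarrow> macro_cube_dist x y \<le> 0"
      using nonneg[of x y] by linarith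
    also have "\<dots> \<longleftrightarrow> (\<forall>n. x n = y n)"
      unfolding macro_cube_dist_le_iff[OF xy] by (simp add: mult_le_0_iff) (simp add: not_le[THEN iffD2])
    finally show ?thesis by auto
  qed
  show "macro_cube_dist x z \<le> macro_cube_dist x y + macro_cube_dist y z"
    if xyz: "x \<in> macro_cube_carrier" "y \<in> macro_cube_carrier" "z \<in> macro_cube_carrier"
    unfolding macro_cube_dist_le_iff[OF xyz(1,3)]
  proof
    fix n
    have "2 ^ (n + 1) * \<bar>real (x n) - real (z n)\<bar>
      \<le> 2 ^ (n + 1) * (\<bar>real (x n) - real (y n)\<bar> + \<bar>real (y n) - real (z n)\<bar>)"
      by (intro mult_left_mono) auto
    also have "\<dots> \<le> macro_cube_dist x y + macro_cube_dist y z"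
      unfolding distrib_left using xyz by (intro add_mono ge)
    finally show "2 ^ (n + 1) * \<bar>real (x n) - real (z n)\<bar>
      \<le> macro_cube_dist x y + macro_cube_dist y z" .
  qed
qed

lemma mspace_cantor_macro_cube [simp]: "mspace cantor_macro_cube = macro_cube_carrier"
  and mdist_cantor_macro_cube [simp]: "mdist cantor_macro_cube = macro_cube_dist"
  by (simp_all add: cantor_macro_cube_def Metric_space.mspace_metric
      Metric_space.mdist_metric Metric_space_macro_cube)

section \<open>Ultrafilters and the Stone-Cech compactification of a discrete space\<close>

definition ultrafilter_on :: "'a set \<Rightarrow> 'a set set \<Rightarrow> bool" where
  "ultrafilter_on S p \<longleftrightarrow>
     p \<subseteq> Pow S \<and> S \<in> p \<and> {} \<notin> p \<and>
     (\<forall>A\<in>p. \<forall>B\<in>p. A \<inter> B \<in> p) \<and>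
     (\<forall>A\<in>p. \<forall>B. A \<subseteq> B \<and> B \<subseteq> S \<longrightarrow> B \<in> p) \<and>
     (\<forall>A. A \<subseteq> S \<longrightarrow> A \<in> p \<or> S - A \<in> p)"

definition beta_discrete :: "'a set \<Rightarrow> 'a set set topology" where
  "beta_discrete S = topology_generated_by {{p. ultrafilter_on S p \<and> A \<in> p} |A. A \<subseteq> S}"

lemma topspace_beta_discrete: "topspace (beta_discrete S) = {p. ultrafilter_on S p}"
  by (auto simp: beta_discrete_def topology_generated_by_topspace ultrafilter_on_def)

definition omega_star :: "nat set set topology" where
  "omega_star =
     subtopology (beta_discrete UNIV) (topspace (beta_discrete UNIV) - range (\<lambda>n. {A. n \<in> A}))"

section \<open>The corona\<close>

definition sharp :: "'a metric \<Rightarrow> 'a set set topology" where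
  "sharp X = subtopology (beta_discrete (mspace X))
     {p. \<forall>B. Metric_space.mbounded (mspace X) (mdist X) B \<longrightarrow> mspace X - B \<in> p}"

definition parallel :: "'a metric \<Rightarrow> ('a set set \<times> 'a set set) set" where
  "parallel X = {(p, q). p \<in> topspace (sharp X) \<and> q \<in> topspace (sharp X) \<and>
     (\<exists>\<epsilon>>0. set_nbhd X \<epsilon> ` p \<subseteq> q \<and> set_nbhd X \<epsilon> ` q \<subseteq> p)}"

definition closed_equiv_hull :: "'a topology \<Rightarrow> ('a \<times> 'a) set \<Rightarrow> ('a \<times> 'a) set" where
  "closed_equiv_hull T r =
     \<Inter>{R. equiv (topspace T) R \<and> closedin (prod_topology T T) R \<and> r \<subseteq> R}"

lemma closed_equiv_hull:
  assumes "r \<subseteq> topspace T \<times> topspace T"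
  shows "equiv (topspace T) (closed_equiv_hull T r)"
    and "closedin (prod_topology T T) (closed_equiv_hull T r)"
    and "r \<subseteq> closed_equiv_hull T r"
proof -
  let ?\<R> = "{R. equiv (topspace T) R \<and> closedin (prod_topology T T) R \<and> r \<subseteq> R}"
  have total: "topspace T \<times> topspace T \<in> ?\<R>"
    using assms closedin_topspace[of "prod_topology T T"]
    by (auto simp: equiv_def refl_on_def sym_def trans_def)
  then show "closedin (prod_topology T T) (closed_equiv_hull T r)"
    unfolding closed_equiv_hull_def by (intro closedin_Inter) auto
  show "r \<subseteq> closed_equiv_hull T r"
    unfolding closed_equiv_hull_def by blast
  show "equiv (topspace T) (closed_equiv_hull T r)"
  proof (rule equivI)
    show "closed_equiv_hull T r \<subseteq> topspace T \<times> topspace T"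
      unfolding closed_equiv_hull_def using total by blast
    show "refl_on (topspace T) (closed_equiv_hull T r)"
      unfolding closed_equiv_hull_def by (auto simp: equiv_def refl_on_def)
    show "sym (closed_equiv_hull T r)"
      unfolding closed_equiv_hull_def by (auto simp: equiv_def intro!: symI dest: symD)
    show "trans (closed_equiv_hull T r)"
      unfolding closed_equiv_hull_def by (auto simp: equiv_def intro!: transI dest: transD)
  qed
qed

definition quotient_topology :: "'a topology \<Rightarrow> ('a \<times> 'a) set \<Rightarrow> 'a set topology" where
  "quotient_topology T R = topology (\<lambda>U. U \<subseteq> topspace T // R \<and> openin T (\<Union>U))"

text \<open>The predicate above is a topology, and it makes the projection a quotient map.\<close>

lemma openin_quotient_topology:
  assumes "equiv (topspace T) R"
  shows "openin (quotient_topology T R) U \<longleftrightarrow> U \<subseteq> topspace T // R \<and> openin T (\<Union>U)"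
proof -
  have inter: "\<Union>(U \<inter> V) = \<Union>U \<inter> \<Union>V"
    if "U \<subseteq> topspace T // R" "V \<subseteq> topspace T // R" for U V
    using quotient_disj[OF assms] that by fast
  have "openin T (\<Union>(\<Union>\<K>))" if "\<forall>K\<in>\<K>. openin T (\<Union>K)" for \<K>
  proof -
    have "\<Union>(\<Union>\<K>) = \<Union>(Union ` \<K>)" by blast
    then show ?thesis using that by (metis imageE openin_Union)
  qed
  then have "istopology (\<lambda>U. U \<subseteq> topspace T // R \<and> openin T (\<Union>U))"
    unfolding istopology_def using inter by (auto simp del: Union_iff)
  then show ?thesis
    by (simp add: quotient_topology_def topology_inverse')
qed

lemma topspace_quotient_topology:
  assumes "equiv (topspace T) R"
  shows "topspace (quotient_topology T R) = topspace T // R"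
proof
  have "openin (quotient_topology T R) (topspace T // R)"
    by (simp add: openin_quotient_topology assms Union_quotient)
  then show "topspace T // R \<subseteq> topspace (quotient_topology T R)"
    by (rule openin_subset)
  show "topspace (quotient_topology T R) \<subseteq> topspace T // R"
    using openin_quotient_topology[OF assms] by blast
qed

lemma quotient_map_quotient_topology:
  assumes "equiv (topspace T) R"
  shows "quotient_map T (quotient_topology T R) (\<lambda>x. R `` {x})"
  unfolding quotient_map_def
proof (intro conjI allI impI)
  show "(\<lambda>x. R `` {x}) ` topspace T = topspace (quotient_topology T R)"
    by (auto simp: topspace_quotient_topology assms quotient_def)
  fix U assume "U \<subseteq> topspace (quotient_topology T R)"
  then have U: "U \<subseteq> topspace T // R" by (simp add: topspace_quotient_topology assms)
  have "{x \<in> topspace T. R `` {x} \<in> U} = \<Union>U"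
  proof (intro set_eqI iffI)
    fix x assume "x \<in> {x \<in> topspace T. R `` {x} \<in> U}"
    then show "x \<in> \<Union>U" using equiv_class_self[OF assms] by blast
  next
    fix x assume "x \<in> \<Union>U"
    then obtain C where C: "C \<in> U" "x \<in> C" by blast
    then obtain y where y: "y \<in> topspace T" "C = R `` {y}" using U by (blast elim: quotientE)
    then have "(y, x) \<in> R" using C by simp
    then have "x \<in> topspace T" "R `` {x} = C"
      using y equiv_class_eq[OF assms, of y x] equivE[OF assms] by (auto dest: equiv_type[OF assms, THEN subsetD])
    then show "x \<in> {x \<in> topspace T. R `` {x} \<in> U}" using C by simp
  qed
  then show "openin T {x \<in> topspace T. R `` {x} \<in> U} \<longleftrightarrow> openin (quotient_topology T R) U"
    using U by (simp add: openin_quotient_topology assms)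
qed

definition corona :: "'a metric \<Rightarrow> 'a set set set topology" where
  "corona X = quotient_topology (sharp X) (closed_equiv_hull (sharp X) (parallel X))"

section \<open>Covering dimension\<close>

text \<open>
  Finite open covers are indexed by themselves, and covers of order at most \<open>n + 1\<close> are those with
  at most \<open>n + 1\<close> members through each point. The dimension is \<open>- 1\<close> exactly for the empty space
  and \<open>\<infinity>\<close> if no \<open>n\<close> works.
\<close>

definition finite_open_cover :: "'a topology \<Rightarrow> 'a set set \<Rightarrow> bool" where
  "finite_open_cover T \<U> \<longleftrightarrow> finite \<U> \<and> (\<forall>U\<in>\<U>. openin T U) \<and> \<Union>\<U> = topspace T"

definition covering_dim_le :: "'a topology \<Rightarrow> int \<Rightarrow> bool" where
  "covering_dim_le T n \<longleftrightarrow>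
     (\<forall>\<U>. finite_open_cover T \<U> \<longrightarrow>
        (\<exists>\<V>. finite_open_cover T \<V> \<and> (\<forall>V\<in>\<V>. \<exists>U\<in>\<U>. V \<subseteq> U) \<and>
             (\<forall>x\<in>topspace T. int (card {V\<in>\<V>. x \<in> V}) \<le> n + 1)))"

definition covering_dim :: "'a topology \<Rightarrow> ereal" where
  "covering_dim T = (INF n \<in> {n::int. - 1 \<le> n \<and> covering_dim_le T n}. ereal (real_of_int n))"

section \<open>Cardinal characteristics\<close>

text \<open>
  A least element of a set of cardinals, with respect to comparison of cardinalities. It is
  determined up to \<^term>\<open>(=o)\<close> when the set is nonempty.
\<close>

definition min_cardinal :: "'a rel set \<Rightarrow> 'a rel" where
  "min_cardinal K = (SOME r. r \<in> K \<and> (\<forall>r'\<in>K. r \<le>o r'))"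

lemma min_cardinal:
  assumes "K \<noteq> {}" "\<forall>r\<in>K. Card_order r"
  shows "min_cardinal K \<in> K" "\<forall>r\<in>K. min_cardinal K \<le>o r"
proof -
  have "\<exists>r. r \<in> K \<and> (\<forall>r'\<in>K. r \<le>o r')"
    using exists_minim_Card_order[OF assms] by blast
  from someI_ex[OF this] show "min_cardinal K \<in> K" "\<forall>r\<in>K. min_cardinal K \<le>o r"
    unfolding min_cardinal_def by auto
qed

definition nbhd_base :: "'a topology \<Rightarrow> 'a \<Rightarrow> 'a set set \<Rightarrow> bool" where
  "nbhd_base T t \<B> \<longleftrightarrow>
     (\<forall>N\<in>\<B>. N \<subseteq> topspace T \<and> (\<exists>U. openin T U \<and> t \<in> U \<and> U \<subseteq> N)) \<and>
     (\<forall>W. openin T W \<and> t \<in> W \<longrightarrow> (\<exists>N\<in>\<B>. N \<subseteq> W))"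

definition character :: "'a topology \<Rightarrow> 'a \<Rightarrow> 'a set rel" where
  "character T t = min_cardinal (card_of ` {\<B>. nbhd_base T t \<B>})"

definition min_character :: "'a topology \<Rightarrow> 'a set rel" where
  "min_character T = min_cardinal (character T ` topspace T)"

definition ultrafilter_number :: "nat set set set rel" where
  "ultrafilter_number = min_character omega_star"

definition dominating_number :: "(nat \<Rightarrow> nat) rel" where
  "dominating_number =
     min_cardinal (card_of ` {D :: (nat \<Rightarrow> nat) set. \<forall>f. \<exists>g\<in>D. \<forall>n. f n \<le> g n})"

end

theory Submission
  imports Defs
begin

text \<open>
  Two ultrafilters at infinity represent the same point of the corona iff they contain no
  asymptotically disjoint sets \<open>P\<close>, \<open>Q\<close>, that is, sets whose \<open>r\<close>-neighbourhoods have bounded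
  intersection for all \<open>r\<close>. This relation is transitive because asymptotically disjoint sets can be
  separated as in a normal space.

  Coarse equivalences push ultrafilters forward, which gives (1) to (2). If the corona has dimension
  zero, asymptotically disjoint sets are separated by asymptotically clopen ones, and this bounds the
  \<open>r\<close>-chains of \<open>X\<close> for every \<open>r\<close>. If \<open>X\<close> had asymptotically isolated balls, an ultrafilter of
  character \<open>\<uu>\<close> on a sequence of such balls would give a point of the corona of character at most
  \<open>\<uu> < \<dd>\<close>. For the macro-cube a neighbourhood base of any point of the corona yields a dominating
  family of the same size, and some point has a base of size \<open>\<dd>\<close>.

  It remains to see that a space of bounded geometry with bounded \<open>r\<close>-chains and without
  asymptotically isolated balls is coarsely equivalent to the macro-cube. Its chain components at
  quickly growing scales form a tree of partitions. From the top down, the dyadic intervals of the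
  binary tree are distributed over the components in proportion to their sizes, up to relative
  errors with finite sum. The resulting matchings of larger and larger components converge along a
  free ultrafilter.
\<close>

section \<open>Ultrafilters\<close>

text \<open>The strict inequality between the two cardinals excludes isolated balls. Its weak form
  keeps the point chosen on the macro-cube, whose neighbourhoods combine an ultrafilter base with a
  dominating family, within \<open>dominating_number\<close>. The obstacle in the matching is that
  component sizes are arbitrary integers, so components of one level cannot be identified with
  binary nodes of one height. Instead of a bijection, a map from the leaves onto a net of the space
  is built. In the finite matchings every point receives between 64 and 256 leaves, and a component
  of level \<open>j\<close> is spread over several nodes of height \<open>\<alpha> j\<close>, though
  below a single node of height \<open>\<alpha> (Suc j)\<close>. Losing one level in this direction
  is harmless for coarse maps. The tree of components also grows upwards without a root, so there is
  no top to start from. Each finite matching starts at a large component, and all of them send the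
  leaf 0 to one fixed point; this confines the image of every other leaf to a finite set, so that a
  limit exists.\<close>

lemma ultrafilter_onD:
  assumes "ultrafilter_on S p"
  shows "A \<in> p \<Longrightarrow> A \<subseteq> S" and "S \<in> p" and "{} \<notin> p"
    and "A \<in> p \<Longrightarrow> B \<in> p \<Longrightarrow> A \<inter> B \<in> p"
    and "A \<in> p \<Longrightarrow> A \<subseteq> B \<Longrightarrow> B \<subseteq> S \<Longrightarrow> B \<in> p"
  using assms by (auto simp: ultrafilter_on_def)

lemma ultrafilter_on_compl:
  assumes "ultrafilter_on S p" "A \<subseteq> S"
  shows "S - A \<in> p \<longleftrightarrow> A \<notin> p"
proof
  show "S - A \<in> p \<Longrightarrow> A \<notin> p"
    using ultrafilter_onD(3,4)[OF assms(1)] by (metis Diff_disjoint)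
  show "A \<notin> p \<Longrightarrow> S - A \<in> p"
    using assms unfolding ultrafilter_on_def by blast
qed

lemma ultrafilter_on_UN:
  assumes p: "ultrafilter_on S p" and "finite I" "\<And>i. i \<in> I \<Longrightarrow> A i \<subseteq> S" "(\<Union>i\<in>I. A i) \<in> p"
  shows "\<exists>i\<in>I. A i \<in> p"
  using assms(2-)
proof (induction I rule: finite_induct)
  case empty
  then show ?case using ultrafilter_onD(3)[OF p] by simp
next
  case (insert i I)
  show ?case
  proof (cases "A i \<in> p")
    case False
    then have "S - A i \<in> p" using insert.prems ultrafilter_on_compl[OF p] by blast
    then have "(S - A i) \<inter> (\<Union>j\<in>insert i I. A j) \<in> p" using insert.prems ultrafilter_onD(4)[OF p] by blast
    moreover have "(S - A i) \<inter> (\<Union>j\<in>insert i I. A j) \<subseteq> (\<Union>j\<in>I. A j)" by blast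
    ultimately have "(\<Union>j\<in>I. A j) \<in> p" using ultrafilter_onD(5)[OF p] insert.prems(1) by (metis UN_least insertCI)
    then show ?thesis using insert by blast
  qed blast
qed

lemma ultrafilter_on_Un:
  assumes p: "ultrafilter_on S p" and AB: "A \<union> B \<in> p"
  shows "A \<in> p \<or> B \<in> p"
proof -
  have "(\<Union>C\<in>{A, B}. C) \<in> p" "A \<union> B \<subseteq> S" using AB ultrafilter_onD(1)[OF p] by auto
  then show ?thesis using ultrafilter_on_UN[OF p, of "{A, B}" "\<lambda>C. C"] by blast
qed

lemma ultrafilter_on_INT:
  assumes p: "ultrafilter_on S p" and "finite G" "G \<subseteq> p"
  shows "S \<inter> \<Inter>G \<in> p"
  using assms(2-)
proof (induction G rule: finite_induct)
  case (insert A G)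
  have "A \<inter> (S \<inter> \<Inter>G) \<in> p" using insert ultrafilter_onD(4)[OF p] by blast
  moreover have "A \<inter> (S \<inter> \<Inter>G) = S \<inter> \<Inter>(insert A G)" by blast
  ultimately show ?case by simp
qed (simp add: ultrafilter_onD(2)[OF p])

text \<open>A maximal family with the finite intersection property decides every set: if neither
  \<open>A\<close> nor its complement belonged to it, each would be missed by some finite
  intersection, and the union of these two finite subfamilies would have empty intersection.\<close>

lemma ultrafilter_on_extend:
  assumes F: "F \<subseteq> Pow S" and fip: "\<And>G. finite G \<Longrightarrow> G \<subseteq> F \<Longrightarrow> S \<inter> \<Inter>G \<noteq> {}"
  shows "\<exists>p. ultrafilter_on S p \<and> F \<subseteq> p"
proof -
  define \<A> where "\<A> = {H. F \<subseteq> H \<and> H \<subseteq> Pow S \<and> (\<forall>G. finite G \<and> G \<subseteq> H \<longrightarrow> S \<inter> \<Inter>G \<noteq> {})}"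
  have "F \<in> \<A>" using assms by (simp add: \<A>_def)
  moreover have "\<Union>\<C> \<in> \<A>" if ch: "\<C> \<noteq> {}" "subset.chain \<A> \<C>" for \<C>
  proof -
    have sub: "\<C> \<subseteq> \<A>"
      using ch(2) by (auto simp: subset_chain_def)
    have "S \<inter> \<Inter>G \<noteq> {}" if G: "finite G" "G \<subseteq> \<Union>\<C>" for G
    proof -
      obtain H where "H \<in> \<C>" "G \<subseteq> H"
        using finite_subset_Union_chain[OF G ch] by blast
      moreover from this have "H \<in> \<A>" using sub by blast
      ultimately show ?thesis using G(1) unfolding \<A>_def by blast
    qed
    moreover have "\<forall>H\<in>\<C>. F \<subseteq> H \<and> H \<subseteq> Pow S" using sub by (auto simp: \<A>_def)
    then have "F \<subseteq> \<Union>\<C>" "\<Union>\<C> \<subseteq> Pow S" using ch(1) by (auto 4 3)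
    ultimately show ?thesis unfolding \<A>_def by blast
  qed
  ultimately obtain p where p: "p \<in> \<A>" and max: "\<And>H. H \<in> \<A> \<Longrightarrow> p \<subseteq> H \<Longrightarrow> H = p"
    using subset_Zorn_nonempty[of \<A>] by blast
  have sub: "F \<subseteq> p" "p \<subseteq> Pow S" and pf: "\<And>G. finite G \<Longrightarrow> G \<subseteq> p \<Longrightarrow> S \<inter> \<Inter>G \<noteq> {}"
    using p by (simp_all add: \<A>_def)
  have ext: "\<exists>G. finite G \<and> G \<subseteq> p \<and> S \<inter> \<Inter>G \<inter> A = {}" if A: "A \<subseteq> S" "A \<notin> p" for A
  proof (rule ccontr)
    assume no: "\<not> ?thesis"
    have "S \<inter> \<Inter>G \<noteq> {}" if G: "finite G" "G \<subseteq> insert A p" for G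
    proof -
      have "finite (G - {A})" "G - {A} \<subseteq> p" using G by auto
      then have "S \<inter> \<Inter>(G - {A}) \<inter> A \<noteq> {}" using no by blast
      then show ?thesis by blast
    qed
    moreover have "F \<subseteq> insert A p" "insert A p \<subseteq> Pow S" using sub A by auto
    ultimately have "insert A p \<in> \<A>" unfolding \<A>_def by blast
    then show False using max A(2) by blast
  qed
  have ultra: "A \<in> p \<or> S - A \<in> p" if A: "A \<subseteq> S" for A
  proof (rule ccontr)
    assume "\<not> ?thesis"
    then have "A \<notin> p" "S - A \<notin> p" by auto
    obtain G where G: "finite G" "G \<subseteq> p" "S \<inter> \<Inter>G \<inter> A = {}"
      using ext[OF A \<open>A \<notin> p\<close>] by auto
    obtain H where H: "finite H" "H \<subseteq> p" "S \<inter> \<Inter>H \<inter> (S - A) = {}"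
      using ext[OF _ \<open>S - A \<notin> p\<close>] by auto
    have "S \<inter> \<Inter>(G \<union> H) = {}" using G(3) H(3) unfolding Inter_Un_distrib by blast
    then show False using pf[of "G \<union> H"] G(1,2) H(1,2) by simp
  qed
  have e: "{} \<notin> p" using pf[of "{{}}"] by auto
  have "A \<inter> B \<in> p" if "A \<in> p" "B \<in> p" for A B
  proof (rule ccontr)
    assume "A \<inter> B \<notin> p"
    then have "S - A \<inter> B \<in> p" using ultra[of "A \<inter> B"] that sub by blast
    then show False using pf[of "{A, B, S - A \<inter> B}"] that by auto
  qed
  moreover have "B \<in> p" if "A \<in> p" "A \<subseteq> B" "B \<subseteq> S" for A B
  proof (rule ccontr)
    assume "B \<notin> p"
    then have "S - B \<in> p" using ultra that by blast
    then show False using pf[of "{A, S - B}"] that by auto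
  qed
  moreover have "S \<in> p" using ultra[of S] e by auto
  ultimately have "ultrafilter_on S p" unfolding ultrafilter_on_def using sub(2) e ultra by simp
  then show ?thesis using sub by blast
qed

section \<open>Image ultrafilters and the topology of the space of ultrafilters\<close>

definition ultrafilter_push :: "'a set \<Rightarrow> 'b set \<Rightarrow> ('a \<Rightarrow> 'b) \<Rightarrow> 'a set set \<Rightarrow> 'b set set" where
  "ultrafilter_push S T f p = {B. B \<subseteq> T \<and> {x\<in>S. f x \<in> B} \<in> p}"

lemma ultrafilter_on_push:
  assumes p: "ultrafilter_on S p" and f: "f \<in> S \<rightarrow> T"
  shows "ultrafilter_on T (ultrafilter_push S T f p)"
proof -
  note u = ultrafilter_onD[OF p]
  have f: "f x \<in> T" if "x \<in> S" for x using f that by auto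
  have T: "{x \<in> S. f x \<in> T} = S" using f by auto
  have eqi: "{x \<in> S. f x \<in> A \<inter> B} = {x \<in> S. f x \<in> A} \<inter> {x \<in> S. f x \<in> B}" for A B by auto
  have int: "{x \<in> S. f x \<in> A \<inter> B} \<in> p" if "{x \<in> S. f x \<in> A} \<in> p" "{x \<in> S. f x \<in> B} \<in> p" for A B
    unfolding eqi by (rule u(4)[OF that])
  have mono: "{x \<in> S. f x \<in> B} \<in> p" if "{x \<in> S. f x \<in> A} \<in> p" "A \<subseteq> B" for A B
    by (rule u(5)[OF that(1)]) (use that(2) in auto)
  have "{x \<in> S. f x \<in> T - A} = S - {x \<in> S. f x \<in> A}" for A using f by blast
  then have com: "{x \<in> S. f x \<in> A} \<in> p \<or> {x \<in> S. f x \<in> T - A} \<in> p" for A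
    using ultrafilter_on_compl[OF p, of "{x \<in> S. f x \<in> A}"] by (metis (no_types, lifting) mem_Collect_eq subsetI)
  show ?thesis
    unfolding ultrafilter_on_def
  proof (intro conjI ballI allI impI)
    show "ultrafilter_push S T f p \<subseteq> Pow T" "T \<in> ultrafilter_push S T f p" "{} \<notin> ultrafilter_push S T f p"
      using u(2,3) T by (auto simp: ultrafilter_push_def)
    show "A \<inter> B \<in> ultrafilter_push S T f p" if "A \<in> ultrafilter_push S T f p" "B \<in> ultrafilter_push S T f p" for A B
      using that int by (auto simp: ultrafilter_push_def)
    show "B \<in> ultrafilter_push S T f p" if "A \<in> ultrafilter_push S T f p" "A \<subseteq> B \<and> B \<subseteq> T" for A B
      using that mono unfolding ultrafilter_push_def by blast
    show "A \<in> ultrafilter_push S T f p \<or> T - A \<in> ultrafilter_push S T f p" if "A \<subseteq> T" for A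
      using that com unfolding ultrafilter_push_def by blast
  qed
qed

text \<open>The generating sets are closed under finite intersections, because
  \<open>A \<inter> B\<close> lies in an ultrafilter iff both sets do. So they form a base and
  openness can be tested at each point.\<close>

lemma openin_beta_discrete:
  "openin (beta_discrete S) U \<longleftrightarrow>
     U \<subseteq> {p. ultrafilter_on S p} \<and> (\<forall>p\<in>U. \<exists>A\<in>p. \<forall>q. ultrafilter_on S q \<and> A \<in> q \<longrightarrow> q \<in> U)"
    (is "?L \<longleftrightarrow> ?R")
proof
  let ?B = "\<lambda>A. {p. ultrafilter_on S p \<and> A \<in> p}"
  assume ?L
  then have "U \<subseteq> {p. ultrafilter_on S p}" using openin_subset topspace_beta_discrete by metis
  moreover have "generate_topology_on {?B A |A. A \<subseteq> S} U"
    using \<open>?L\<close> unfolding beta_discrete_def openin_topology_generated_by_iff .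
  then have "\<forall>p\<in>U. ultrafilter_on S p \<longrightarrow> (\<exists>A\<in>p. ?B A \<subseteq> U)"
  proof induction
    case (Int V W)
    show ?case
    proof (intro ballI impI)
      fix p assume p: "p \<in> V \<inter> W" "ultrafilter_on S p"
      then obtain A B where AB: "A \<in> p" "?B A \<subseteq> V" "B \<in> p" "?B B \<subseteq> W" using Int.IH by blast
      have "?B (A \<inter> B) \<subseteq> V \<inter> W"
      proof
        fix q assume q: "q \<in> ?B (A \<inter> B)"
        have "A \<subseteq> S" "B \<subseteq> S" using AB p ultrafilter_onD(1) by metis+
        then have "A \<in> q" "B \<in> q"
          using q ultrafilter_onD(5)[of S q "A \<inter> B"] by blast+
        then show "q \<in> V \<inter> W" using q AB by blast
      qed
      moreover have "A \<inter> B \<in> p" using ultrafilter_onD(4)[OF p(2)] AB by blast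
      ultimately show "\<exists>A\<in>p. ?B A \<subseteq> V \<inter> W" by blast
    qed
  next
    case (UN K)
    then show ?case by (meson Union_iff Union_upper order_trans)
  qed blast+
  ultimately show ?R by blast
next
  let ?B = "\<lambda>A. {p. ultrafilter_on S p \<and> A \<in> p}"
  assume R: ?R
  have "openin (beta_discrete S) (?B A)" if "A \<subseteq> S" for A
    unfolding beta_discrete_def by (rule topology_generated_by_Basis) (use that in blast)
  then have "openin (beta_discrete S) (\<Union>{?B A |A. A \<subseteq> S \<and> ?B A \<subseteq> U})"
    by (intro openin_Union) auto
  moreover have "\<Union>{?B A |A. A \<subseteq> S \<and> ?B A \<subseteq> U} = U"
  proof (intro equalityI subsetI)
    fix p assume "p \<in> U"
    then obtain A where "A \<in> p" "?B A \<subseteq> U" "ultrafilter_on S p" using R by blast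
    moreover have "A \<subseteq> S" using ultrafilter_onD(1) calculation by metis
    ultimately show "p \<in> \<Union>{?B A |A. A \<subseteq> S \<and> ?B A \<subseteq> U}" by blast
  qed blast
  ultimately show ?L by simp
qed

section \<open>Asymptotic disjointness and the corona\<close>

locale unbounded_space =
  fixes X :: "'a metric" and a :: 'a
  assumes base: "a \<in> mspace X"
    and unbounded: "\<exists>x\<in>mspace X. r < mdist X a x"
begin

abbreviation "M \<equiv> mspace X"
abbreviation "d \<equiv> mdist X"

sublocale Metric_space M d
  by (rule Metric_space_mspace_mdist)

text \<open>Equivalent to bounded intersections of all \<open>r\<close>-neighbourhoods. Bounding the
  point of \<open>P\<close> alone suffices, since the point of \<open>Q\<close> is at distance at
  most \<open>r\<close> from it; this is also how symmetry is recovered.\<close>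

definition asymp_disjoint :: "'a set \<Rightarrow> 'a set \<Rightarrow> bool" where
  "asymp_disjoint P Q \<longleftrightarrow> (\<forall>r. \<exists>R. \<forall>x\<in>P. \<forall>y\<in>Q. d x y \<le> r \<longrightarrow> d a x \<le> R)"

definition asymp_clopen :: "'a set \<Rightarrow> bool" where
  "asymp_clopen A \<longleftrightarrow> A \<subseteq> M \<and> asymp_disjoint A (M - A)"

definition ultra_at_infinity :: "'a set set \<Rightarrow> bool" where
  "ultra_at_infinity p \<longleftrightarrow> ultrafilter_on M p \<and> (\<forall>R. {x\<in>M. R < d a x} \<in> p)"

abbreviation "corona_rel \<equiv> closed_equiv_hull (sharp X) (parallel X)"

lemma mbounded_iff: "mbounded B \<longleftrightarrow> B \<subseteq> M \<and> (\<exists>R. \<forall>x\<in>B. d a x \<le> R)"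
proof
  assume B: "mbounded B"
  then obtain x r where xr: "B \<subseteq> mcball x r" by (auto simp: mbounded_def)
  have "d a y \<le> d a x + r" if "y \<in> B" for y
  proof -
    have "x \<in> M" "y \<in> M" "d x y \<le> r" using xr that by (auto simp: in_mcball)
    then show ?thesis using triangle[OF base, of x y] by linarith
  qed
  then show "B \<subseteq> M \<and> (\<exists>R. \<forall>x\<in>B. d a x \<le> R)" using mbounded_subset_mspace[OF B] by blast
next
  assume "B \<subseteq> M \<and> (\<exists>R. \<forall>x\<in>B. d a x \<le> R)"
  then obtain R where "B \<subseteq> mcball a R" using base by (auto simp: subset_iff in_mcball)
  then show "mbounded B" by (auto simp: mbounded_def)
qed

lemma ultra_at_infinityD:
  assumes "ultra_at_infinity p"
  shows "ultrafilter_on M p" and "{x\<in>M. R < d a x} \<in> p"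
  using assms by (auto simp: ultra_at_infinity_def)

lemma topspace_sharp: "topspace (sharp X) = {p. ultra_at_infinity p}"
proof -
  have "(\<forall>B. mbounded B \<longrightarrow> M - B \<in> p) \<longleftrightarrow> (\<forall>R. {x\<in>M. R < d a x} \<in> p)"
    if p: "ultrafilter_on M p" for p
  proof (intro iffI allI impI)
    fix R assume H: "\<forall>B. mbounded B \<longrightarrow> M - B \<in> p"
    have "mbounded {x\<in>M. d a x \<le> R}" unfolding mbounded_iff by blast
    then have "M - {x\<in>M. d a x \<le> R} \<in> p" using H by blast
    moreover have "M - {x\<in>M. d a x \<le> R} = {x\<in>M. R < d a x}" by auto
    ultimately show "{x\<in>M. R < d a x} \<in> p" by simp
  next
    fix B assume H: "\<forall>R. {x\<in>M. R < d a x} \<in> p" and "mbounded B"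
    then obtain R where R: "\<And>x. x \<in> B \<Longrightarrow> d a x \<le> R" unfolding mbounded_iff by blast
    have "{x\<in>M. R < d a x} \<subseteq> M - B" using R by force
    then show "M - B \<in> p" using H ultrafilter_onD(5)[OF p] by (metis Diff_subset)
  qed
  then show ?thesis
    unfolding sharp_def topspace_subtopology topspace_beta_discrete ultra_at_infinity_def by blast
qed

lemma openin_sharp:
  "openin (sharp X) U \<longleftrightarrow> U \<subseteq> {p. ultra_at_infinity p} \<and>
     (\<forall>p\<in>U. \<exists>A\<in>p. \<forall>q. ultra_at_infinity q \<and> A \<in> q \<longrightarrow> q \<in> U)" (is "?L \<longleftrightarrow> ?R")
proof -
  let ?S = "{p. \<forall>B. mbounded B \<longrightarrow> M - B \<in> p}"
  have uf: "ultra_at_infinity q \<longleftrightarrow> ultrafilter_on M q \<and> q \<in> ?S" for q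
    using topspace_sharp unfolding sharp_def topspace_subtopology topspace_beta_discrete by blast
  show ?thesis
  proof
    assume ?L
    then obtain V where V: "openin (beta_discrete M) V" "U = V \<inter> ?S"
      unfolding sharp_def openin_subtopology by blast
    show ?R
    proof (intro conjI ballI)
      show "U \<subseteq> {p. ultra_at_infinity p}" using openin_subset[OF \<open>?L\<close>] topspace_sharp by simp
      fix p assume "p \<in> U"
      then have "p \<in> V" using V(2) by simp
      then obtain A where "A \<in> p" "\<forall>q. ultrafilter_on M q \<and> A \<in> q \<longrightarrow> q \<in> V"
        using V(1)[unfolded openin_beta_discrete] by blast
      then show "\<exists>A\<in>p. \<forall>q. ultra_at_infinity q \<and> A \<in> q \<longrightarrow> q \<in> U" using uf V(2) by auto
    qed
  next
    assume R: ?R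
    \<comment> \<open>The largest open set of ultrafilters on \<open>M\<close> whose members at
      infinity all lie in \<open>U\<close>.\<close>
    define V where "V = {q. ultrafilter_on M q \<and> (\<exists>A\<in>q. \<forall>q'. ultra_at_infinity q' \<and> A \<in> q' \<longrightarrow> q' \<in> U)}"
    have "openin (beta_discrete M) V"
      unfolding openin_beta_discrete by (auto simp: V_def)
    moreover have "U = V \<inter> ?S"
    proof (intro equalityI subsetI)
      fix p assume "p \<in> U"
      then show "p \<in> V \<inter> ?S" using R uf by (auto simp: V_def)
    next
      fix p assume "p \<in> V \<inter> ?S"
      then show "p \<in> U" using uf[of p] by (auto simp: V_def)
    qed
    ultimately show ?L unfolding sharp_def openin_subtopology by blast
  qed
qed

lemma openin_sharp_basic: "openin (sharp X) {q. ultra_at_infinity q \<and> A \<in> q}"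
  unfolding openin_sharp by blast

lemma ultra_at_infinity_bounded:
  assumes "ultra_at_infinity p" "\<And>x. x \<in> A \<Longrightarrow> d a x \<le> R"
  shows "A \<notin> p"
proof
  note p = ultra_at_infinityD[OF assms(1)]
  assume "A \<in> p"
  then have "A \<inter> {x\<in>M. R < d a x} \<in> p" using ultrafilter_onD(4)[OF p(1)] p(2) by blast
  moreover have "A \<inter> {x\<in>M. R < d a x} = {}" using assms(2) by force
  ultimately show False using ultrafilter_onD(3)[OF p(1)] by simp
qed

text \<open>Unbounded, and not just nonempty, finite intersections make \<open>F\<close> compatible
  with the complements of balls; finitely many such complements contain a further one.\<close>

lemma ultra_at_infinity_extend:
  assumes F: "F \<subseteq> Pow M" and fip: "\<And>G R. finite G \<Longrightarrow> G \<subseteq> F \<Longrightarrow> \<exists>x\<in>M \<inter> \<Inter>G. R < d a x"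
  shows "\<exists>p. ultra_at_infinity p \<and> F \<subseteq> p"
proof -
  let ?H = "\<lambda>R. {x\<in>M. R < d a x}"
  have "\<exists>p. ultrafilter_on M p \<and> F \<union> range ?H \<subseteq> p"
  proof (rule ultrafilter_on_extend)
    show "F \<union> range ?H \<subseteq> Pow M" using F by auto
    fix G assume G: "finite G" "G \<subseteq> F \<union> range ?H"
    obtain T where T: "finite T" "G - F = ?H ` T"
      using finite_subset_image[of "G - F" ?H UNIV] G by blast
    obtain R where R: "\<forall>r\<in>T. r \<le> R" using T(1) by (meson finite_set_of_finite_funs bdd_above_finite bdd_above_def)
    obtain x where x: "x \<in> M \<inter> \<Inter>(G \<inter> F)" "R < d a x" using fip[of "G \<inter> F" R] G by blast
    have "x \<in> A" if "A \<in> G" for A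
    proof (cases "A \<in> F")
      case False
      then have "A \<in> ?H ` T" using that T(2) by blast
      then obtain r where "r \<in> T" "A = ?H r" by blast
      then show ?thesis using x R by force
    qed (use x that in blast)
    then show "M \<inter> \<Inter>G \<noteq> {}" using x(1) by blast
  qed
  then show ?thesis unfolding ultra_at_infinity_def image_subset_iff Un_subset_iff by blast
qed

lemma ultra_at_infinity_exists:
  assumes "A \<subseteq> M" "\<And>R. \<exists>x\<in>A. R < d a x"
  shows "\<exists>p. ultra_at_infinity p \<and> A \<in> p"
proof -
  have "\<exists>p. ultra_at_infinity p \<and> {A} \<subseteq> p"
  proof (rule ultra_at_infinity_extend)
    fix G R assume "finite G" "G \<subseteq> {A}"
    then have "A \<subseteq> M \<inter> \<Inter>G" using assms(1) by blast
    then show "\<exists>x\<in>M \<inter> \<Inter>G. R < d a x" using assms(2)[of R] by blast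
  qed (use assms(1) in simp)
  then show ?thesis by simp
qed

text \<open>This is compactness of the space of ultrafilters at infinity, for a filter base \<G>: if
  no member of \<G> forced membership in \<open>U\<close>, then \<G> together with the complements
  of all forcing sets would extend to an ultrafilter at infinity. It would lie in \<open>U\<close>,
  yet contain no set witnessing this.\<close>

lemma compactness:
  assumes U: "openin (sharp X) U"
    and G: "\<G> \<noteq> {}" "\<G> \<subseteq> Pow M" "\<And>A B. A \<in> \<G> \<Longrightarrow> B \<in> \<G> \<Longrightarrow> \<exists>C\<in>\<G>. C \<subseteq> A \<inter> B"
    and cover: "\<And>q. ultra_at_infinity q \<Longrightarrow> \<G> \<subseteq> q \<Longrightarrow> q \<in> U"
  shows "\<exists>A\<in>\<G>. \<forall>q. ultra_at_infinity q \<and> A \<in> q \<longrightarrow> q \<in> U"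
proof (rule ccontr)
  assume no: "\<not> ?thesis"
  have finint: "\<exists>C\<in>\<G>. C \<subseteq> \<Inter>F" if "finite F" "F \<subseteq> \<G>" for F
    using that
  proof (induction F rule: finite_induct)
    case empty
    then show ?case using G(1) by auto
  next
    case (insert A F)
    then obtain C where C: "C \<in> \<G>" "C \<subseteq> \<Inter>F" by auto
    obtain C' where "C' \<in> \<G>" "C' \<subseteq> A \<inter> C" using G(3)[of A C] insert.prems C(1) by auto
    then show ?case using C(2) by (intro bexI[of _ C']) auto
  qed
  \<comment> \<open>An ultrafilter containing \<open>N\<close> avoids every basic open set inside
    \<open>U\<close>, hence \<open>U\<close> itself.\<close>
  define N where "N = {M - A |A. A \<subseteq> M \<and> (\<forall>q. ultra_at_infinity q \<and> A \<in> q \<longrightarrow> q \<in> U)}"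
  have "\<exists>q. ultra_at_infinity q \<and> \<G> \<union> N \<subseteq> q"
  proof (rule ultra_at_infinity_extend)
    show "\<G> \<union> N \<subseteq> Pow M" using G(2) by (auto simp: N_def)
    fix F R assume F: "finite F" "F \<subseteq> \<G> \<union> N"
    obtain C where C: "C \<in> \<G>" "C \<subseteq> \<Inter>(F \<inter> \<G>)" using finint[of "F \<inter> \<G>"] F(1) by auto
    obtain q where q: "ultra_at_infinity q" "C \<in> q" "q \<notin> U" using no C(1) by blast
    note u = ultra_at_infinityD[OF q(1)]
    have "F \<subseteq> q"
    proof
      fix A assume A: "A \<in> F"
      show "A \<in> q"
      proof (cases "A \<in> \<G>")
        case True
        then have "C \<subseteq> A" "A \<subseteq> M" using C A G(2) by auto
        then show ?thesis using ultrafilter_onD(5)[OF u(1) q(2)] by simp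
      next
        case False
        then have "A \<in> N" using A F by blast
        then obtain B where B: "A = M - B" "B \<subseteq> M" "\<forall>q. ultra_at_infinity q \<and> B \<in> q \<longrightarrow> q \<in> U"
          by (auto simp: N_def)
        then have "B \<notin> q" using q(1,3) by auto
        then show ?thesis using ultrafilter_on_compl[OF u(1) B(2)] B(1) by simp
      qed
    qed
    then have int: "M \<inter> \<Inter>F \<in> q" using ultrafilter_on_INT[OF u(1) F(1)] by simp
    show "\<exists>x\<in>M \<inter> \<Inter>F. R < d a x"
    proof (rule ccontr)
      assume "\<not> ?thesis"
      then have "d a x \<le> R" if "x \<in> M \<inter> \<Inter>F" for x using that by (meson not_le)
      then show False using ultra_at_infinity_bounded[OF q(1)] int by blast
    qed
  qed
  then obtain q where q: "ultra_at_infinity q" "\<G> \<subseteq> q" "N \<subseteq> q" by blast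
  then have "q \<in> U" using cover by blast
  then obtain A where A: "A \<in> q" "\<forall>q. ultra_at_infinity q \<and> A \<in> q \<longrightarrow> q \<in> U"
    using U unfolding openin_sharp by blast
  note u = ultra_at_infinityD(1)[OF q(1)]
  have "A \<subseteq> M" using ultrafilter_onD(1)[OF u A(1)] .
  then have "M - A \<in> q" using q(3) A(2) unfolding N_def by blast
  then show False using ultrafilter_on_compl[OF u \<open>A \<subseteq> M\<close>] A(1) by simp
qed

section \<open>Calculus of asymptotically disjoint sets\<close>

lemma asymp_disjoint_sym:
  assumes "asymp_disjoint P Q" "P \<subseteq> M" "Q \<subseteq> M"
  shows "asymp_disjoint Q P"
  unfolding asymp_disjoint_def
proof
  fix r
  obtain R where R: "\<And>x y. x \<in> P \<Longrightarrow> y \<in> Q \<Longrightarrow> d x y \<le> r \<Longrightarrow> d a x \<le> R"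
    using assms(1) unfolding asymp_disjoint_def by meson
  have "d a y \<le> R + r" if "y \<in> Q" "x \<in> P" "d y x \<le> r" for x y
  proof -
    have "d a x \<le> R" using R[of x y] that by (simp add: commute)
    then show ?thesis using triangle[OF base, of x y] that assms(2,3) by (force simp: commute)
  qed
  then show "\<exists>R. \<forall>x\<in>Q. \<forall>y\<in>P. d x y \<le> r \<longrightarrow> d a x \<le> R" by blast
qed

lemma asymp_disjoint_subset:
  assumes "asymp_disjoint P Q" "P' \<subseteq> P" "Q' \<subseteq> Q"
  shows "asymp_disjoint P' Q'"
  unfolding asymp_disjoint_def
proof
  fix r
  obtain R where "\<And>x y. x \<in> P \<Longrightarrow> y \<in> Q \<Longrightarrow> d x y \<le> r \<Longrightarrow> d a x \<le> R"
    using assms(1) unfolding asymp_disjoint_def by meson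
  then show "\<exists>R. \<forall>x\<in>P'. \<forall>y\<in>Q'. d x y \<le> r \<longrightarrow> d a x \<le> R" using assms(2,3) by (meson subsetD)
qed

lemma asymp_disjoint_Un:
  assumes "asymp_disjoint P Q" "asymp_disjoint P Q'"
  shows "asymp_disjoint P (Q \<union> Q')"
  unfolding asymp_disjoint_def
proof
  fix r
  obtain R where R: "\<And>x y. x \<in> P \<Longrightarrow> y \<in> Q \<Longrightarrow> d x y \<le> r \<Longrightarrow> d a x \<le> R"
    using assms(1) unfolding asymp_disjoint_def by meson
  obtain R' where R': "\<And>x y. x \<in> P \<Longrightarrow> y \<in> Q' \<Longrightarrow> d x y \<le> r \<Longrightarrow> d a x \<le> R'"
    using assms(2) unfolding asymp_disjoint_def by meson
  have "d a x \<le> max R R'" if "x \<in> P" "y \<in> Q \<union> Q'" "d x y \<le> r" for x y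
    using R[of x y] R'[of x y] that by (auto simp: le_max_iff_disj)
  then show "\<exists>R. \<forall>x\<in>P. \<forall>y\<in>Q \<union> Q'. d x y \<le> r \<longrightarrow> d a x \<le> R" by blast
qed

lemma asymp_disjoint_inter_bounded:
  assumes "asymp_disjoint P Q" "P \<subseteq> M"
  shows "\<exists>R. \<forall>x\<in>P \<inter> Q. d a x \<le> R"
proof -
  obtain R where R: "\<And>x y. x \<in> P \<Longrightarrow> y \<in> Q \<Longrightarrow> d x y \<le> 0 \<Longrightarrow> d a x \<le> R"
    using assms(1) unfolding asymp_disjoint_def by meson
  have "d x x \<le> 0" if "x \<in> P" for x using that assms(2) zero[of x x] by (simp add: subsetD)
  then show ?thesis using R by blast
qed

lemma not_asymp_disjoint_same:
  assumes "ultra_at_infinity p" "P \<in> p" "Q \<in> p"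
  shows "\<not> asymp_disjoint P Q"
proof
  note u = ultra_at_infinityD(1)[OF assms(1)]
  assume "asymp_disjoint P Q"
  then obtain R where "\<forall>x\<in>P \<inter> Q. d a x \<le> R"
    using asymp_disjoint_inter_bounded ultrafilter_onD(1)[OF u assms(2)] by blast
  then have "P \<inter> Q \<notin> p" using ultra_at_infinity_bounded[OF assms(1), of "P \<inter> Q" R] by blast
  then show False using ultrafilter_onD(4)[OF u assms(2,3)] by simp
qed

text \<open>Normality: \<open>C\<close> is the set of points at least as close to \<open>P\<close> as to \<open>Q\<close>.\<close>

lemma asymp_disjoint_separate:
  assumes PQ: "asymp_disjoint P Q" and sub: "P \<subseteq> M" "Q \<subseteq> M"
  shows "\<exists>C\<subseteq>M. asymp_disjoint P (M - C) \<and> asymp_disjoint C Q"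
proof -
  \<comment> \<open>The quantifier over strict bounds \<open>r\<close> compares the distances to
    \<open>P\<close> and \<open>Q\<close> without infima, so that empty sets need no separate
    treatment.\<close>
  define C where "C = {x\<in>M. \<forall>r. \<forall>z\<in>Q. d x z < r \<longrightarrow> (\<exists>y\<in>P. d x y < r)}"
  \<comment> \<open>A point within \<open>r\<close> of both sets yields a pair from \<open>P\<close>
    and \<open>Q\<close> at distance at most \<open>2 * r\<close>, and it stays within
    \<open>r\<close> of that pair.\<close>
  have near: "\<exists>R. \<forall>x\<in>M. \<forall>y\<in>P. \<forall>z\<in>Q. d x y \<le> r \<and> d x z \<le> r \<longrightarrow> d a x \<le> R" for r
  proof -
    obtain R where R: "\<And>y z. y \<in> P \<Longrightarrow> z \<in> Q \<Longrightarrow> d y z \<le> 2 * r \<Longrightarrow> d a y \<le> R"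
      using PQ unfolding asymp_disjoint_def by meson
    have "d a x \<le> R + r" if "x \<in> M" "y \<in> P" "z \<in> Q" "d x y \<le> r" "d x z \<le> r" for x y z
    proof -
      have "y \<in> M" "z \<in> M" using that sub by auto
      then have "d y z \<le> d y x + d x z" "d a x \<le> d a y + d y x" "d y x = d x y"
        using triangle[of y x z] triangle[OF base, of y x] that(1) commute[of y x] by auto
      then show ?thesis using R[OF that(2,3)] that(4,5) by linarith
    qed
    then show ?thesis by blast
  qed
  have "asymp_disjoint P (M - C)"
    unfolding asymp_disjoint_def
  proof
    fix r
    obtain R where R: "\<And>x y z. x \<in> M \<Longrightarrow> y \<in> P \<Longrightarrow> z \<in> Q \<Longrightarrow> d x y \<le> r \<and> d x z \<le> r \<Longrightarrow> d a x \<le> R"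
      using near[of r] by meson
    have "d a x \<le> R + r" if x: "x \<in> P" "y \<in> M - C" "d x y \<le> r" for x y
    proof -
      have xy: "x \<in> M" "y \<in> M" "d y x \<le> r" using x sub by (auto simp: commute)
      obtain r' z where z: "z \<in> Q" "d y z < r'" "\<forall>y'\<in>P. \<not> d y y' < r'"
        using x(2) unfolding C_def by blast
      then have "d y z \<le> r" using x(1) xy(3) by force
      then have "d a y \<le> R" using R[OF xy(2) x(1) z(1)] xy by simp
      then show ?thesis using triangle[OF base xy(2,1)] xy(3) by linarith
    qed
    then show "\<exists>R. \<forall>x\<in>P. \<forall>y\<in>M - C. d x y \<le> r \<longrightarrow> d a x \<le> R" by blast
  qed
  moreover have "asymp_disjoint C Q"
    unfolding asymp_disjoint_def
  proof
    fix r
    obtain R where R: "\<And>x y z. x \<in> M \<Longrightarrow> y \<in> P \<Longrightarrow> z \<in> Q \<Longrightarrow> d x y \<le> r + 1 \<and> d x z \<le> r + 1 \<Longrightarrow> d a x \<le> R"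
      using near[of "r + 1"] by meson
    have "d a x \<le> R" if x: "x \<in> C" "z \<in> Q" "d x z \<le> r" for x z
    proof -
      have "d x z < r + 1" using x by simp
      then obtain y where "y \<in> P" "d x y < r + 1" using x unfolding C_def by blast
      then show ?thesis using R[of x y z] x unfolding C_def by simp
    qed
    then show "\<exists>R. \<forall>x\<in>C. \<forall>y\<in>Q. d x y \<le> r \<longrightarrow> d a x \<le> R" by blast
  qed
  moreover have "C \<subseteq> M" by (auto simp: C_def)
  ultimately show ?thesis by (intro exI[of _ C] conjI)
qed

section \<open>Parallel ultrafilters and the points of the corona\<close>

lemma ultra_at_infinity_push:
  assumes p: "ultra_at_infinity p" and f: "f \<in> M \<rightarrow> M"
    and proper: "\<And>R. \<exists>R'. \<forall>x\<in>A. R' < d a x \<longrightarrow> R < d a (f x)" and A: "A \<in> p"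
  shows "ultra_at_infinity (ultrafilter_push M M f p)"
  unfolding ultra_at_infinity_def
proof (intro conjI allI)
  note u = ultra_at_infinityD[OF p]
  show "ultrafilter_on M (ultrafilter_push M M f p)" using ultrafilter_on_push[OF u(1) f] .
  fix R
  obtain R' where R': "\<And>x. x \<in> A \<Longrightarrow> R' < d a x \<Longrightarrow> R < d a (f x)" using proper[of R] by blast
  have "A \<inter> {x\<in>M. R' < d a x} \<in> p" using ultrafilter_onD(4)[OF u(1) A u(2)] .
  moreover have "A \<inter> {x\<in>M. R' < d a x} \<subseteq> {x\<in>M. f x \<in> {x\<in>M. R < d a x}}" using R' f by auto
  ultimately have "{x\<in>M. f x \<in> {x\<in>M. R < d a x}} \<in> p"
    using ultrafilter_onD(5)[OF u(1)] by (metis (no_types, lifting) mem_Collect_eq subsetI)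
  then show "{x\<in>M. R < d a x} \<in> ultrafilter_push M M f p" by (simp add: ultrafilter_push_def)
qed

lemma in_set_nbhd: "x \<in> set_nbhd X r A \<longleftrightarrow> x \<in> M \<and> (\<exists>y\<in>A. y \<in> M \<and> d y x \<le> r)"
  by (auto simp: set_nbhd_def mcball_of_def in_mcball)

lemma parallelI:
  assumes p: "ultra_at_infinity p" "ultra_at_infinity q" and r: "r > 0"
    and near: "\<And>A. A \<in> p \<Longrightarrow> set_nbhd X r A \<in> q" "\<And>A. A \<in> q \<Longrightarrow> set_nbhd X r A \<in> p"
  shows "(p, q) \<in> parallel X"
  using assms by (auto simp: parallel_def topspace_sharp)

text \<open>An ultrafilter lives on each of its members, so the displacement by \<open>f\<close> has
  to be controlled on a single member \<open>A\<close> only.\<close>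

lemma push_parallel:
  assumes p: "ultra_at_infinity p" and f: "f \<in> M \<rightarrow> M"
    and near: "\<And>x. x \<in> A \<Longrightarrow> d x (f x) \<le> r" and A: "A \<in> p"
  shows "(p, ultrafilter_push M M f p) \<in> parallel X"
proof (rule parallelI)
  note u = ultra_at_infinityD[OF p]
  have fM: "f x \<in> M" if "x \<in> M" for x using f that by auto
  have AM: "A \<subseteq> M" using ultrafilter_onD(1)[OF u(1) A] .
  show "ultra_at_infinity (ultrafilter_push M M f p)"
  proof (rule ultra_at_infinity_push[OF p f _ A])
    fix R
    have "R < d a (f x)" if "x \<in> A" "R + r < d a x" for x
    proof -
      have "x \<in> M" using AM that by auto
      then have "d a x \<le> d a (f x) + d x (f x)" using triangle[OF base fM, of x x] by (simp add: commute)
      then show ?thesis using near[OF that(1)] that(2) by linarith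
    qed
    then show "\<exists>R'. \<forall>x\<in>A. R' < d a x \<longrightarrow> R < d a (f x)" by blast
  qed
  \<comment> \<open>Parallelism asks for a positive radius, whereas \<open>r\<close> may be zero or,
    a priori, negative.\<close>
  show "max r 1 > 0" by simp
  show "set_nbhd X (max r 1) B \<in> ultrafilter_push M M f p" if B: "B \<in> p" for B
  proof -
    have "A \<inter> B \<in> p" using ultrafilter_onD(4)[OF u(1) A B] .
    moreover have "A \<inter> B \<subseteq> {x\<in>M. f x \<in> set_nbhd X (max r 1) B}"
    proof
      fix x assume x: "x \<in> A \<inter> B"
      then have "x \<in> M" "d x (f x) \<le> max r 1" using AM near[of x] by auto
      then show "x \<in> {x\<in>M. f x \<in> set_nbhd X (max r 1) B}" using x fM by (auto simp: in_set_nbhd)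
    qed
    ultimately have "{x\<in>M. f x \<in> set_nbhd X (max r 1) B} \<in> p"
      using ultrafilter_onD(5)[OF u(1)] by (metis (no_types, lifting) mem_Collect_eq subsetI)
    then show ?thesis by (auto simp: ultrafilter_push_def in_set_nbhd)
  qed
  show "set_nbhd X (max r 1) B \<in> p" if B: "B \<in> ultrafilter_push M M f p" for B
  proof -
    have "A \<inter> {x\<in>M. f x \<in> B} \<in> p" using B ultrafilter_onD(4)[OF u(1) A] by (auto simp: ultrafilter_push_def)
    moreover have "A \<inter> {x\<in>M. f x \<in> B} \<subseteq> set_nbhd X (max r 1) B"
    proof
      fix x assume x: "x \<in> A \<inter> {x\<in>M. f x \<in> B}"
      then have "d (f x) x \<le> max r 1" using near[of x] by (auto simp: commute)
      then show "x \<in> set_nbhd X (max r 1) B" using x fM[of x] by (auto simp: in_set_nbhd)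
    qed
    moreover have "set_nbhd X (max r 1) B \<subseteq> M" by (auto simp: in_set_nbhd)
    ultimately show ?thesis using ultrafilter_onD(5)[OF u(1)] by metis
  qed
qed (rule p)

text \<open>For some \<open>r\<close> the points of \<open>P\<close> within \<open>r\<close> of
  \<open>Q\<close> are unbounded. An ultrafilter at infinity on them and its image under a choice of
  nearby points of \<open>Q\<close> are parallel.\<close>

lemma parallel_meets:
  assumes P: "P \<subseteq> M" "Q \<subseteq> M" and not: "\<not> asymp_disjoint P Q"
  shows "\<exists>p q. (p, q) \<in> parallel X \<and> P \<in> p \<and> Q \<in> q"
proof -
  obtain r where r: "\<And>R. \<exists>x\<in>P. \<exists>y\<in>Q. d x y \<le> r \<and> R < d a x"
    using not unfolding asymp_disjoint_def by (meson not_le)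
  define A where "A = {x\<in>P. \<exists>y\<in>Q. d x y \<le> r}"
  have "\<exists>x\<in>A. R < d a x" for R using r[of R] by (auto simp: A_def)
  moreover have AM: "A \<subseteq> M" using P by (auto simp: A_def)
  ultimately obtain p where p: "ultra_at_infinity p" "A \<in> p" using ultra_at_infinity_exists by meson
  note u = ultra_at_infinityD[OF p(1)]
  \<comment> \<open>The identity off \<open>A\<close> keeps \<open>f\<close> a self-map of the
    space.\<close>
  define f where "f = (\<lambda>x. if x \<in> A then SOME y. y \<in> Q \<and> d x y \<le> r else x)"
  have f: "f x \<in> Q \<and> d x (f x) \<le> r" if "x \<in> A" for x
    using someI_ex[of "\<lambda>y. y \<in> Q \<and> d x y \<le> r"] that by (auto simp: f_def A_def)
  have fM: "f \<in> M \<rightarrow> M" using f P(2) by (force simp: f_def)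
  have "(p, ultrafilter_push M M f p) \<in> parallel X" using push_parallel[OF p(1) fM _ p(2)] f by blast
  moreover have "P \<in> p" by (rule ultrafilter_onD(5)[OF u(1) p(2)]) (use P(1) in \<open>auto simp: A_def\<close>)
  moreover have "{x\<in>M. f x \<in> Q} \<in> p" by (rule ultrafilter_onD(5)[OF u(1) p(2)]) (use f AM in auto)
  then have "Q \<in> ultrafilter_push M M f p" using P(2) by (simp add: ultrafilter_push_def)
  ultimately show ?thesis by blast
qed

lemma closedin_prod_iff:
  "closedin (prod_topology T T) R \<longleftrightarrow> R \<subseteq> topspace T \<times> topspace T \<and>
     (\<forall>p\<in>topspace T. \<forall>q\<in>topspace T. (p, q) \<notin> R \<longrightarrow>
       (\<exists>U V. openin T U \<and> openin T V \<and> p \<in> U \<and> q \<in> V \<and> U \<times> V \<inter> R = {}))"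
proof -
  let ?T = "topspace T \<times> topspace T"
  have box: "U \<times> V \<subseteq> ?T - R \<longleftrightarrow> U \<times> V \<inter> R = {}" if "openin T U" "openin T V" for U V
    using openin_subset[OF that(1)] openin_subset[OF that(2)] by auto
  have "openin (prod_topology T T) (?T - R) \<longleftrightarrow> (\<forall>p q. (p, q) \<in> ?T - R \<longrightarrow>
      (\<exists>U V. openin T U \<and> openin T V \<and> p \<in> U \<and> q \<in> V \<and> U \<times> V \<inter> R = {}))"
    unfolding openin_prod_topology_alt by (metis box)
  then show ?thesis unfolding closedin_def topspace_prod_topology by auto
qed

lemma parallel_subset: "parallel X \<subseteq> topspace (sharp X) \<times> topspace (sharp X)"
  by (auto simp: parallel_def)

text \<open>One inclusion holds because the relation on the right is itself a closed equivalence
  containing parallelism. For the other, a pair outside a closed relation has a neighbourhood box,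
  given by members \<open>P\<close> and \<open>Q\<close>, that misses the relation. If
  \<open>P\<close> and \<open>Q\<close> are not asymptotically disjoint, this box contains parallel
  ultrafilters, so the relation does not contain parallelism.\<close>

lemma corona_rel_iff:
  "(p, q) \<in> corona_rel \<longleftrightarrow> ultra_at_infinity p \<and> ultra_at_infinity q \<and>
     (\<forall>P\<in>p. \<forall>Q\<in>q. \<not> asymp_disjoint P Q)"
proof
  assume pq: "(p, q) \<in> corona_rel"
  define S where "S = {(p, q). ultra_at_infinity p \<and> ultra_at_infinity q \<and>
     (\<forall>P\<in>p. \<forall>Q\<in>q. \<not> asymp_disjoint P Q)}"
  have "equiv (topspace (sharp X)) S"
  proof (rule equivI)
    show "S \<subseteq> topspace (sharp X) \<times> topspace (sharp X)" by (auto simp: S_def topspace_sharp)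
    show "refl_on (topspace (sharp X)) S"
      using not_asymp_disjoint_same by (auto simp: refl_on_def S_def topspace_sharp)
    show "sym S"
    proof (rule symI)
      fix p q assume pq: "(p, q) \<in> S"
      then have u: "ultrafilter_on M p" "ultrafilter_on M q" by (auto simp: S_def ultra_at_infinity_def)
      have "\<not> asymp_disjoint Q P" if "P \<in> p" "Q \<in> q" for P Q
        using asymp_disjoint_sym[of Q P] ultrafilter_onD(1)[OF u(1) that(1)] ultrafilter_onD(1)[OF u(2) that(2)]
          pq that by (auto simp: S_def)
      then show "(q, p) \<in> S" using pq by (simp add: S_def)
    qed
    show "trans S"
    proof (rule transI)
      fix p q r assume pq: "(p, q) \<in> S" "(q, r) \<in> S"
      then have u: "ultra_at_infinity p" "ultra_at_infinity q" "ultra_at_infinity r" by (auto simp: S_def)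
      note u = u u[THEN ultra_at_infinityD(1)]
      have "\<not> asymp_disjoint P R" if P: "P \<in> p" "R \<in> r" for P R
      proof
        assume "asymp_disjoint P R"
        then obtain C where C: "C \<subseteq> M" "asymp_disjoint P (M - C)" "asymp_disjoint C R"
          using asymp_disjoint_separate[of P R] ultrafilter_onD(1)[OF u(4) P(1)] ultrafilter_onD(1)[OF u(6) P(2)]
          by blast
        have "M - C \<notin> q" using pq(1) P(1) C(2) by (auto simp: S_def)
        moreover have "C \<notin> q" using pq(2) P(2) C(3) by (auto simp: S_def)
        ultimately show False using ultrafilter_on_compl[OF u(5) C(1)] by simp
      qed
      then show "(p, r) \<in> S" using u by (simp add: S_def)
    qed
  qed
  moreover have "closedin (prod_topology (sharp X) (sharp X)) S"
    unfolding closedin_prod_iff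
  proof (intro conjI ballI impI)
    show "S \<subseteq> topspace (sharp X) \<times> topspace (sharp X)" by (auto simp: S_def topspace_sharp)
    fix p q assume "p \<in> topspace (sharp X)" "q \<in> topspace (sharp X)" "(p, q) \<notin> S"
    then obtain P Q where "P \<in> p" "Q \<in> q" "asymp_disjoint P Q" "ultra_at_infinity p" "ultra_at_infinity q"
      by (auto simp: S_def topspace_sharp)
    then show "\<exists>U V. openin (sharp X) U \<and> openin (sharp X) V \<and> p \<in> U \<and> q \<in> V \<and> U \<times> V \<inter> S = {}"
      by (intro exI[of _ "{r. ultra_at_infinity r \<and> P \<in> r}"] exI[of _ "{r. ultra_at_infinity r \<and> Q \<in> r}"])
        (auto simp: openin_sharp_basic S_def)
  qed
  moreover have "parallel X \<subseteq> S"
  proof clarify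
    fix p q assume "(p, q) \<in> parallel X"
    then obtain r where pq: "ultra_at_infinity p" "ultra_at_infinity q" "r > 0"
      "set_nbhd X r ` p \<subseteq> q" by (auto simp: parallel_def topspace_sharp)
    note u = pq(1,2)[THEN ultra_at_infinityD(1)]
    have "\<not> asymp_disjoint P Q" if P: "P \<in> p" "Q \<in> q" for P Q
    proof
      assume "asymp_disjoint P Q"
      then obtain R where R: "\<And>x y. x \<in> P \<Longrightarrow> y \<in> Q \<Longrightarrow> d x y \<le> r \<Longrightarrow> d a x \<le> R"
        unfolding asymp_disjoint_def by meson
      have "set_nbhd X r P \<inter> Q \<in> q" using ultrafilter_onD(4)[OF u(2) _ P(2)] pq(4) P(1) by blast
      moreover have "d a y \<le> R + r" if y: "y \<in> set_nbhd X r P \<inter> Q" for y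
      proof -
        obtain x where "x \<in> P" "x \<in> M" "d x y \<le> r" "y \<in> M" "y \<in> Q" using y by (auto simp: in_set_nbhd)
        then show ?thesis using R[of x y] triangle[OF base, of x y] by force
      qed
      ultimately show False using ultra_at_infinity_bounded[OF pq(2)] by blast
    qed
    then show "(p, q) \<in> S" using pq by (simp add: S_def)
  qed
  ultimately have "(p, q) \<in> S" using pq unfolding closed_equiv_hull_def by blast
  then show "ultra_at_infinity p \<and> ultra_at_infinity q \<and> (\<forall>P\<in>p. \<forall>Q\<in>q. \<not> asymp_disjoint P Q)"
    by (simp add: S_def)
next
  assume pq: "ultra_at_infinity p \<and> ultra_at_infinity q \<and> (\<forall>P\<in>p. \<forall>Q\<in>q. \<not> asymp_disjoint P Q)"
  note u = pq[THEN conjunct1, THEN ultra_at_infinityD(1)] pq[THEN conjunct2, THEN conjunct1, THEN ultra_at_infinityD(1)]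
  have "(p, q) \<in> S"
    if S: "equiv (topspace (sharp X)) S" "closedin (prod_topology (sharp X) (sharp X)) S" "parallel X \<subseteq> S" for S
  proof (rule ccontr)
    assume "(p, q) \<notin> S"
    then obtain U V where UV: "openin (sharp X) U" "openin (sharp X) V" "p \<in> U" "q \<in> V" "U \<times> V \<inter> S = {}"
      using S(2) pq unfolding closedin_prod_iff topspace_sharp by blast
    obtain P Q where P: "P \<in> p" "\<And>q. ultra_at_infinity q \<Longrightarrow> P \<in> q \<Longrightarrow> q \<in> U"
      and Q: "Q \<in> q" "\<And>p. ultra_at_infinity p \<Longrightarrow> Q \<in> p \<Longrightarrow> p \<in> V"
      using UV unfolding openin_sharp by meson
    obtain p' q' where pq': "(p', q') \<in> parallel X" "P \<in> p'" "Q \<in> q'"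
      using parallel_meets[of P Q] ultrafilter_onD(1)[OF u(1) P(1)] ultrafilter_onD(1)[OF u(2) Q(1)] P(1) Q(1) pq
      by blast
    have "p' \<in> U" "q' \<in> V" using P(2) Q(2) pq' parallel_subset topspace_sharp by auto
    then show False using UV(5) pq'(1) S(3) by blast
  qed
  then show "(p, q) \<in> corona_rel" unfolding closed_equiv_hull_def by blast
qed

lemma equiv_corona_rel: "equiv (topspace (sharp X)) corona_rel"
  using closed_equiv_hull(1)[OF parallel_subset] .

lemma topspace_corona: "topspace (corona X) = {corona_rel `` {p} |p. ultra_at_infinity p}"
  unfolding corona_def topspace_quotient_topology[OF equiv_corona_rel]
  by (auto simp: quotient_def topspace_sharp)

lemma corona_class_eq_iff:
  assumes "ultra_at_infinity p" "ultra_at_infinity q"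
  shows "corona_rel `` {p} = corona_rel `` {q} \<longleftrightarrow> (p, q) \<in> corona_rel"
  using eq_equiv_class_iff[OF equiv_corona_rel] assms by (simp add: topspace_sharp)

section \<open>Open sets and neighbourhood bases in the corona\<close>

lemma quotient_map_corona: "quotient_map (sharp X) (corona X) (\<lambda>p. corona_rel `` {p})"
  unfolding corona_def by (rule quotient_map_quotient_topology[OF equiv_corona_rel])

lemma openin_corona_preimage:
  assumes "openin (corona X) W"
  shows "openin (sharp X) {p. ultra_at_infinity p \<and> corona_rel `` {p} \<in> W}"
  using quotient_map_corona assms openin_subset[OF assms]
  unfolding quotient_map_def topspace_sharp by auto

lemma openin_corona_image:
  assumes U: "openin (sharp X) U" and sat: "\<And>p q. p \<in> U \<Longrightarrow> (p, q) \<in> corona_rel \<Longrightarrow> q \<in> U"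
  shows "openin (corona X) ((\<lambda>p. corona_rel `` {p}) ` U)"
proof -
  have U': "U \<subseteq> {p. ultra_at_infinity p}" using openin_subset[OF U] topspace_sharp by simp
  have "{p \<in> topspace (sharp X). corona_rel `` {p} \<in> (\<lambda>p. corona_rel `` {p}) ` U} = U" (is "?L = U")
  proof (intro equalityI subsetI)
    fix p assume "p \<in> ?L"
    then obtain q where q: "q \<in> U" "corona_rel `` {p} = corona_rel `` {q}" "ultra_at_infinity p"
      by (auto simp: topspace_sharp)
    then have "(q, p) \<in> corona_rel" using corona_class_eq_iff[of q p] U' by auto
    then show "p \<in> U" using sat q(1) by blast
  qed (use U' in \<open>auto simp: topspace_sharp\<close>)
  moreover have "(\<lambda>p. corona_rel `` {p}) ` U \<subseteq> topspace (corona X)" using U' topspace_corona by auto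
  moreover from this have "openin (sharp X) ?L \<longleftrightarrow> openin (corona X) ((\<lambda>p. corona_rel `` {p}) ` U)"
    using quotient_map_corona unfolding quotient_map_def by meson
  ultimately show ?thesis using U by simp
qed

text \<open>Compactness is applied to the complements of all sets that are asymptotically disjoint
  from some member of \<open>p\<close>. An ultrafilter at infinity containing all of them is
  equivalent to \<open>p\<close>, so its class lies in \<open>W\<close>; hence one such complement
  already forces the class into \<open>W\<close>.\<close>

lemma openin_corona_basis:
  assumes W: "openin (corona X) W" and p: "ultra_at_infinity p" "corona_rel `` {p} \<in> W"
  shows "\<exists>P\<in>p. \<exists>Q\<subseteq>M. asymp_disjoint P Q \<and> (\<forall>q. ultra_at_infinity q \<and> Q \<notin> q \<longrightarrow> corona_rel `` {q} \<in> W)"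
proof -
  note u = ultra_at_infinityD(1)[OF p(1)]
  let ?U = "{q. ultra_at_infinity q \<and> corona_rel `` {q} \<in> W}"
  let ?G = "{M - Q |Q. Q \<subseteq> M \<and> (\<exists>P\<in>p. asymp_disjoint P Q)}"
  have "\<exists>A\<in>?G. \<forall>q. ultra_at_infinity q \<and> A \<in> q \<longrightarrow> q \<in> ?U"
  proof (rule compactness)
    show "openin (sharp X) ?U" by (rule openin_corona_preimage[OF W])
    have "asymp_disjoint M {}" by (simp add: asymp_disjoint_def)
    then show "?G \<noteq> {}" using ultrafilter_onD(2)[OF u] by blast
    show "?G \<subseteq> Pow M" by auto
  next
    fix A B assume "A \<in> ?G" "B \<in> ?G"
    then obtain P Q P' Q' where 1: "A = M - Q" "Q \<subseteq> M" "P \<in> p" "asymp_disjoint P Q"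
      "B = M - Q'" "Q' \<subseteq> M" "P' \<in> p" "asymp_disjoint P' Q'" by blast
    have "asymp_disjoint (P \<inter> P') (Q \<union> Q')"
      using asymp_disjoint_Un asymp_disjoint_subset 1 by (metis Int_lower1 Int_lower2 order_refl)
    moreover have "P \<inter> P' \<in> p" using ultrafilter_onD(4)[OF u] 1 by blast
    ultimately have "M - (Q \<union> Q') \<in> ?G" using 1 by blast
    then show "\<exists>C\<in>?G. C \<subseteq> A \<inter> B" using 1 by (intro bexI[of _ "M - (Q \<union> Q')"]) auto
  next
    fix q assume q: "ultra_at_infinity q" "?G \<subseteq> q"
    note uq = ultra_at_infinityD(1)[OF q(1)]
    have "(p, q) \<in> corona_rel"
      unfolding corona_rel_iff
    proof (intro conjI ballI notI)
      fix P Q assume PQ: "P \<in> p" "Q \<in> q" "asymp_disjoint P Q"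
      have "Q \<subseteq> M" using ultrafilter_onD(1)[OF uq PQ(2)] .
      then have "M - Q \<in> ?G" using PQ(1,3) by auto
      then have "M - Q \<in> q" by (rule subsetD[OF q(2)])
      then show False using ultrafilter_on_compl[OF uq \<open>Q \<subseteq> M\<close>] PQ(2) by simp
    qed (use p q in auto)
    then show "q \<in> ?U" using corona_class_eq_iff[OF p(1) q(1)] p(2) q(1) by simp
  qed
  then obtain A where A: "A \<in> ?G" "\<forall>q. ultra_at_infinity q \<and> A \<in> q \<longrightarrow> q \<in> ?U" by (elim bexE)
  obtain P Q where PQ: "Q \<subseteq> M" "P \<in> p" "asymp_disjoint P Q" "A = M - Q" using A(1) by auto
  have "corona_rel `` {q} \<in> W" if q: "ultra_at_infinity q" "Q \<notin> q" for q
    using A(2) PQ(4) q ultrafilter_on_compl[OF ultra_at_infinityD(1)[OF q(1)] PQ(1)] by simp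
  then show ?thesis using PQ by blast
qed

definition clopen_class :: "'a set \<Rightarrow> 'a set set set set" where
  "clopen_class A = {corona_rel `` {q} |q. ultra_at_infinity q \<and> A \<in> q}"

text \<open>Otherwise \<open>A\<close> and its complement would be asymptotically disjoint members
  of equivalent ultrafilters.\<close>

lemma asymp_clopen_saturated:
  assumes A: "asymp_clopen A" and pq: "(p, q) \<in> corona_rel" and "A \<in> p"
  shows "A \<in> q"
proof (rule ccontr)
  assume "A \<notin> q"
  have "ultrafilter_on M q" "A \<subseteq> M" using A pq unfolding corona_rel_iff asymp_clopen_def ultra_at_infinity_def by auto
  then have "M - A \<in> q" using ultrafilter_on_compl \<open>A \<notin> q\<close> by metis
  then show False using A pq \<open>A \<in> p\<close> unfolding corona_rel_iff asymp_clopen_def by blast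
qed

lemma in_clopen_class_iff:
  assumes "asymp_clopen A" "ultra_at_infinity p"
  shows "corona_rel `` {p} \<in> clopen_class A \<longleftrightarrow> A \<in> p"
proof
  assume "corona_rel `` {p} \<in> clopen_class A"
  then obtain q where q: "ultra_at_infinity q" "A \<in> q" "corona_rel `` {p} = corona_rel `` {q}"
    by (auto simp: clopen_class_def)
  then have "(q, p) \<in> corona_rel" using corona_class_eq_iff[OF q(1) assms(2)] by simp
  then show "A \<in> p" using asymp_clopen_saturated[OF assms(1)] q(2) by blast
qed (use assms in \<open>auto simp: clopen_class_def\<close>)

lemma openin_clopen_class:
  assumes "asymp_clopen A"
  shows "openin (corona X) (clopen_class A)"
proof -
  have "clopen_class A = (\<lambda>p. corona_rel `` {p}) ` {q. ultra_at_infinity q \<and> A \<in> q}"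
    by (auto simp: clopen_class_def)
  moreover have "openin (corona X) ((\<lambda>p. corona_rel `` {p}) ` {q. ultra_at_infinity q \<and> A \<in> q})"
  proof (rule openin_corona_image[OF openin_sharp_basic])
    fix p q assume "p \<in> {q. ultra_at_infinity q \<and> A \<in> q}" "(p, q) \<in> corona_rel"
    moreover from this have "A \<in> q" using asymp_clopen_saturated[OF assms] by blast
    ultimately show "q \<in> {q. ultra_at_infinity q \<and> A \<in> q}" using corona_rel_iff by simp
  qed
  ultimately show ?thesis by simp
qed

text \<open>The form in which the upper bounds for characters are obtained. Bounded sets belong to
  no ultrafilter at infinity, so a set meeting \<open>Q\<close> in a bounded set is as good as one
  disjoint from \<open>Q\<close>.\<close>

lemma nbhd_base_clopen:
  assumes p: "ultra_at_infinity p"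
    and C: "\<And>C. C \<in> \<C> \<Longrightarrow> asymp_clopen C \<and> C \<in> p"
    and small: "\<And>P Q. P \<in> p \<Longrightarrow> Q \<subseteq> M \<Longrightarrow> asymp_disjoint P Q \<Longrightarrow> \<exists>C\<in>\<C>. \<exists>R. \<forall>x\<in>C \<inter> Q. d a x \<le> R"
  shows "nbhd_base (corona X) (corona_rel `` {p}) (clopen_class ` \<C>)"
  unfolding nbhd_base_def
proof (intro conjI ballI allI impI)
  fix N assume "N \<in> clopen_class ` \<C>"
  then obtain A where A: "N = clopen_class A" "asymp_clopen A" "A \<in> p" using C by blast
  have "openin (corona X) N" using openin_clopen_class A by simp
  then show "N \<subseteq> topspace (corona X)" by (rule openin_subset)
  show "\<exists>U. openin (corona X) U \<and> corona_rel `` {p} \<in> U \<and> U \<subseteq> N"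
    using \<open>openin (corona X) N\<close> in_clopen_class_iff[OF A(2) p] A by blast
next
  fix W assume W: "openin (corona X) W \<and> corona_rel `` {p} \<in> W"
  then have "\<exists>P\<in>p. \<exists>Q\<subseteq>M. asymp_disjoint P Q \<and> (\<forall>q. ultra_at_infinity q \<and> Q \<notin> q \<longrightarrow> corona_rel `` {q} \<in> W)"
    by (intro openin_corona_basis[OF _ p]) simp_all
  then obtain P Q where PQ: "P \<in> p" "Q \<subseteq> M" "asymp_disjoint P Q"
    "\<And>q. ultra_at_infinity q \<Longrightarrow> Q \<notin> q \<Longrightarrow> corona_rel `` {q} \<in> W"
    by auto
  obtain A R where A: "A \<in> \<C>" "\<And>x. x \<in> A \<inter> Q \<Longrightarrow> d a x \<le> R" using small[OF PQ(1-3)] by auto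
  have "clopen_class A \<subseteq> W"
  proof
    fix c assume "c \<in> clopen_class A"
    then obtain q where q: "ultra_at_infinity q" "A \<in> q" "c = corona_rel `` {q}" by (auto simp: clopen_class_def)
    have "A \<inter> Q \<notin> q" using ultra_at_infinity_bounded[OF q(1) A(2)] .
    then have "Q \<notin> q" using ultrafilter_onD(4)[OF ultra_at_infinityD(1)[OF q(1)] q(2)] by blast
    then show "c \<in> W" using PQ(4) q by blast
  qed
  then show "\<exists>N\<in>clopen_class ` \<C>. N \<subseteq> W" using A(1) by blast
qed

end

section \<open>Dimension zero\<close>

lemma rtrancl_crossing:
  assumes "(x, y) \<in> E\<^sup>*" "x \<in> A" "y \<notin> A"
  shows "\<exists>u v. (u, v) \<in> E \<and> u \<in> A \<and> v \<notin> A"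
  using assms by (induction rule: rtrancl_induct) auto

context unbounded_space
begin

definition scale_graph :: "real \<Rightarrow> ('a \<times> 'a) set" where
  "scale_graph r = {(x, y). x \<in> M \<and> y \<in> M \<and> d x y \<le> r}"

text \<open>This is asymptotic dimension zero, phrased through the components of the graph of points
  at distance at most \<open>r\<close>.\<close>

definition asymp_zero_dim :: bool where
  "asymp_zero_dim \<longleftrightarrow> (\<forall>r. \<exists>D. \<forall>x\<in>M. \<forall>y. (x, y) \<in> (scale_graph r)\<^sup>* \<longrightarrow> d x y \<le> D)"

lemma bounded_if_no_ultra:
  assumes "A \<subseteq> M" "\<And>p. ultra_at_infinity p \<Longrightarrow> A \<notin> p"
  shows "\<exists>R. \<forall>x\<in>A. d a x \<le> R"
  using ultra_at_infinity_exists[OF assms(1)] assms(2) by (meson not_le)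

lemma asymp_clopen_compl:
  assumes "asymp_clopen A"
  shows "asymp_clopen (M - A)"
proof -
  have "A \<subseteq> M" "asymp_disjoint A (M - A)" using assms by (auto simp: asymp_clopen_def)
  then have "asymp_disjoint (M - A) A" using asymp_disjoint_sym by blast
  moreover have "M - (M - A) = A" using \<open>A \<subseteq> M\<close> by blast
  ultimately show ?thesis by (simp add: asymp_clopen_def)
qed

text \<open>Compactness with the empty open set: the complements of finite unions from \<A> lie in
  no common ultrafilter at infinity, so one of these complements lies in none.\<close>

lemma corona_cover_finite:
  assumes cover: "\<And>q. ultra_at_infinity q \<Longrightarrow> \<exists>A\<in>\<A>. A \<in> q" and sub: "\<And>A. A \<in> \<A> \<Longrightarrow> A \<subseteq> M"
  shows "\<exists>F. finite F \<and> F \<subseteq> \<A> \<and> (\<forall>q. ultra_at_infinity q \<longrightarrow> (\<exists>A\<in>F. A \<in> q))"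
proof -
  let ?G = "{M - \<Union>F |F. finite F \<and> F \<subseteq> \<A>}"
  have "\<exists>A\<in>?G. \<forall>q. ultra_at_infinity q \<and> A \<in> q \<longrightarrow> q \<in> {}"
  proof (rule compactness)
    have "M - \<Union>{} \<in> ?G" by blast
    then show "?G \<noteq> {}" by blast
    show "?G \<subseteq> Pow M" by auto
  next
    fix A B assume "A \<in> ?G" "B \<in> ?G"
    then obtain F H where F: "A = M - \<Union>F" "B = M - \<Union>H" "finite F" "finite H" "F \<subseteq> \<A>" "H \<subseteq> \<A>" by auto
    then have "M - \<Union>(F \<union> H) \<in> ?G" by (intro CollectI exI[of _ "F \<union> H"]) auto
    then show "\<exists>C\<in>?G. C \<subseteq> A \<inter> B" by (rule bexI[rotated]) (use F in auto)
  next
    fix q assume q: "ultra_at_infinity q" "?G \<subseteq> q"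
    obtain A where A: "A \<in> \<A>" "A \<in> q" using cover[OF q(1)] by auto
    then have "M - \<Union>{A} \<in> ?G" by (intro CollectI exI[of _ "{A}"]) auto
    then have "M - A \<in> q" using subsetD[OF q(2)] by simp
    then show "q \<in> {}" using ultrafilter_on_compl[OF ultra_at_infinityD(1)[OF q(1)] sub[OF A(1)]] A(2) by simp
  qed simp
  then obtain B where B: "B \<in> ?G" "\<And>q. ultra_at_infinity q \<Longrightarrow> B \<notin> q" by auto
  then obtain F where F: "B = M - \<Union>F" "finite F" "F \<subseteq> \<A>" by auto
  have "\<exists>A\<in>F. A \<in> q" if q: "ultra_at_infinity q" for q
  proof -
    note u = ultra_at_infinityD(1)[OF q]
    have s: "A \<subseteq> M" if "A \<in> F" for A using F(3) sub that by auto
    then have UF: "\<Union>F \<subseteq> M" by auto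
    have "\<Union>F \<in> q" using B(2)[OF q] ultrafilter_on_compl[OF u UF] F(1) by simp
    then show ?thesis using ultrafilter_on_UN[OF u F(2), of "\<lambda>A. A"] s by auto
  qed
  then show ?thesis using F(2,3) by auto
qed

text \<open>Separation makes the classes of asymptotically clopen sets fine enough to refine any
  open cover, and by compactness finitely many of them cover the corona. The atoms of the Boolean
  algebra that they generate are open, pairwise disjoint and still refine the cover.\<close>

lemma covering_dim_le_corona:
  assumes sep: "\<And>P Q. P \<subseteq> M \<Longrightarrow> Q \<subseteq> M \<Longrightarrow> asymp_disjoint P Q \<Longrightarrow>
    \<exists>A R. asymp_clopen A \<and> (\<forall>x\<in>P - A. d a x \<le> R) \<and> A \<inter> Q = {}"
  shows "covering_dim_le (corona X) 0"
  unfolding covering_dim_le_def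
proof (intro allI impI)
  fix \<U> assume U: "finite_open_cover (corona X) \<U>"
  define \<A> where "\<A> = {A. asymp_clopen A \<and> (\<exists>U\<in>\<U>. clopen_class A \<subseteq> U)}"
  have "\<exists>F. finite F \<and> F \<subseteq> \<A> \<and> (\<forall>q. ultra_at_infinity q \<longrightarrow> (\<exists>A\<in>F. A \<in> q))"
  proof (rule corona_cover_finite)
    fix q assume q: "ultra_at_infinity q"
    note u = ultra_at_infinityD(1)[OF q]
    have "corona_rel `` {q} \<in> \<Union>\<U>" using q U unfolding finite_open_cover_def topspace_corona by auto
    then obtain W where W: "W \<in> \<U>" "corona_rel `` {q} \<in> W" by blast
    have oW: "openin (corona X) W" using U W(1) unfolding finite_open_cover_def by auto
    obtain P Q where PQ: "P \<in> q" "Q \<subseteq> M" "asymp_disjoint P Q"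
      "\<And>q. ultra_at_infinity q \<Longrightarrow> Q \<notin> q \<Longrightarrow> corona_rel `` {q} \<in> W"
      using openin_corona_basis[OF oW q W(2)] by auto
    have "P \<subseteq> M" using ultrafilter_onD(1)[OF u PQ(1)] .
    then obtain A R where A: "asymp_clopen A" "\<And>x. x \<in> P - A \<Longrightarrow> d a x \<le> R" "A \<inter> Q = {}"
      using sep[OF _ PQ(2,3)] by metis
    have AM: "A \<subseteq> M" using A(1) by (auto simp: asymp_clopen_def)
    have "P - A \<notin> q" using ultra_at_infinity_bounded[OF q A(2)] .
    moreover have "P - A = P \<inter> (M - A)" using \<open>P \<subseteq> M\<close> by auto
    ultimately have "M - A \<notin> q" using ultrafilter_onD(4)[OF u PQ(1)] by auto
    then have "A \<in> q" using ultrafilter_on_compl[OF u AM] by simp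
    moreover have "clopen_class A \<subseteq> W"
    proof
      fix c assume "c \<in> clopen_class A"
      then obtain p where p: "ultra_at_infinity p" "A \<in> p" "c = corona_rel `` {p}" by (auto simp: clopen_class_def)
      note up = ultra_at_infinityD(1)[OF p(1)]
      have "Q \<notin> p" using ultrafilter_onD(4)[OF up p(2), of Q] ultrafilter_onD(3)[OF up] A(3) by auto
      then show "c \<in> W" using PQ(4) p by simp
    qed
    ultimately show "\<exists>A\<in>\<A>. A \<in> q" using A(1) W(1) by (auto simp: \<A>_def)
  qed (auto simp: \<A>_def asymp_clopen_def)
  then obtain F where F: "finite F" "F \<subseteq> \<A>" "\<And>q. ultra_at_infinity q \<Longrightarrow> \<exists>A\<in>F. A \<in> q" by auto
  have clo: "asymp_clopen A" if "A \<in> F" for A using F(2) that by (auto simp: \<A>_def)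
  \<comment> \<open>The cells are the fibres of \<open>type\<close>. The empty type is left out
    below: it does not occur, and its cell would not be tied to a member of the cover.\<close>
  define type where "type c = {A\<in>F. c \<in> clopen_class A}" for c
  define cell where "cell T = {c \<in> topspace (corona X). type c = T}" for T
  define \<V> where "\<V> = cell ` (Pow F - {{}})"
  have cell_open: "openin (corona X) (cell T)" if T: "T \<subseteq> F" for T
  proof -
    have "cell T = (\<Inter>A\<in>F. if A \<in> T then clopen_class A else clopen_class (M - A)) \<inter> topspace (corona X)" (is "_ = ?R")
    proof -
      have "c \<in> cell T \<longleftrightarrow> c \<in> ?R" for c
      proof (cases "c \<in> topspace (corona X)")
        case True
        then obtain q where q: "ultra_at_infinity q" "c = corona_rel `` {q}" by (auto simp: topspace_corona)
        have "c \<in> clopen_class (M - A) \<longleftrightarrow> c \<notin> clopen_class A" if "A \<in> F" for A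
          using in_clopen_class_iff[OF clo[OF that] q(1)] in_clopen_class_iff[OF asymp_clopen_compl[OF clo[OF that]] q(1)]
            ultrafilter_on_compl[OF ultra_at_infinityD(1)[OF q(1)]] clo[OF that] q(2) by (simp add: asymp_clopen_def)
        then have "(c \<in> (if A \<in> T then clopen_class A else clopen_class (M - A))) = (A \<in> T \<longleftrightarrow> A \<in> type c)" if "A \<in> F" for A
          using that by (simp add: type_def)
        moreover have "c \<in> ?R \<longleftrightarrow> (\<forall>A\<in>F. c \<in> (if A \<in> T then clopen_class A else clopen_class (M - A)))"
          by (simp only: Int_iff INT_iff True simp_thms)
        ultimately have "c \<in> ?R \<longleftrightarrow> (\<forall>A\<in>F. A \<in> T \<longleftrightarrow> A \<in> type c)" by simp
        also have "\<dots> \<longleftrightarrow> type c = T" using T by (auto simp: type_def)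
        finally show ?thesis using True by (simp add: cell_def)
      qed (simp add: cell_def)
      then show ?thesis by blast
    qed
    moreover have "openin (corona X) ?R"
      by (rule openin_INT[OF F(1)]) (simp add: openin_clopen_class asymp_clopen_compl clo)
    ultimately show ?thesis by simp
  qed
  have type_ne: "type c \<noteq> {}" if "c \<in> topspace (corona X)" for c
  proof -
    obtain q where q: "ultra_at_infinity q" "c = corona_rel `` {q}" using \<open>c \<in> topspace (corona X)\<close> by (auto simp: topspace_corona)
    then obtain A where "A \<in> F" "A \<in> q" using F(3) by auto
    then show ?thesis using in_clopen_class_iff[OF clo q(1)] q(2) by (auto simp: type_def)
  qed
  have "finite_open_cover (corona X) \<V>"
    unfolding finite_open_cover_def
  proof (intro conjI ballI)
    show "finite \<V>" using F(1) by (simp add: \<V>_def)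
    show "openin (corona X) V" if "V \<in> \<V>" for V using that cell_open by (auto simp: \<V>_def)
    have "c \<in> \<Union>\<V>" if c: "c \<in> topspace (corona X)" for c
    proof -
      have "type c \<in> Pow F - {{}}" using type_ne[OF c] by (auto simp: type_def)
      moreover have "c \<in> cell (type c)" using c by (simp add: cell_def)
      ultimately show ?thesis unfolding \<V>_def by blast
    qed
    then show "\<Union>\<V> = topspace (corona X)" by (auto simp: \<V>_def cell_def)
  qed
  moreover have "\<exists>U\<in>\<U>. V \<subseteq> U" if "V \<in> \<V>" for V
  proof -
    obtain T where T: "V = cell T" "T \<subseteq> F" "T \<noteq> {}" using \<open>V \<in> \<V>\<close> by (auto simp: \<V>_def)
    then obtain A where A: "A \<in> T" "A \<in> F" by blast
    then obtain U where "U \<in> \<U>" "clopen_class A \<subseteq> U" using F(2) by (auto simp: \<A>_def)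
    moreover have "V \<subseteq> clopen_class A" using A(1) unfolding T(1) cell_def type_def by auto
    ultimately show ?thesis by auto
  qed
  moreover have "int (card {V\<in>\<V>. c \<in> V}) \<le> 0 + 1" for c
  proof -
    have "{V\<in>\<V>. c \<in> V} \<subseteq> {cell (type c)}" by (auto simp: \<V>_def cell_def)
    then have "card {V\<in>\<V>. c \<in> V} \<le> card {cell (type c)}" by (rule card_mono[rotated]) simp
    then show ?thesis by simp
  qed
  ultimately show "\<exists>\<V>. finite_open_cover (corona X) \<V> \<and> (\<forall>V\<in>\<V>. \<exists>U\<in>\<U>. V \<subseteq> U) \<and>
    (\<forall>x\<in>topspace (corona X). int (card {V\<in>\<V>. x \<in> V}) \<le> 0 + 1)"
    by (intro exI[of _ \<V>] conjI ballI)
qed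

text \<open>Stone duality for the space at infinity. The sets forcing membership in \<open>U\<close>
  are closed under finite unions, and an ultrafilter containing all their complements lies in
  \<open>U'\<close>; by compactness a single complement already forces membership in
  \<open>U'\<close>.\<close>

lemma sharp_clopen_set:
  assumes U: "openin (sharp X) U" "openin (sharp X) U'"
    and part: "\<And>q. ultra_at_infinity q \<Longrightarrow> q \<in> U \<longleftrightarrow> q \<notin> U'"
  shows "\<exists>A\<subseteq>M. \<forall>q. ultra_at_infinity q \<longrightarrow> (A \<in> q \<longleftrightarrow> q \<in> U)"
proof -
  define inside where "inside A \<longleftrightarrow> (\<forall>q. ultra_at_infinity q \<and> A \<in> q \<longrightarrow> q \<in> U)" for A
  let ?G = "{M - A |A. A \<subseteq> M \<and> inside A}"
  have "\<exists>B\<in>?G. \<forall>q. ultra_at_infinity q \<and> B \<in> q \<longrightarrow> q \<in> U'"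
  proof (rule compactness[OF U(2)])
    have "inside {}" unfolding inside_def using ultrafilter_onD(3) ultra_at_infinityD(1) by metis
    then have "M - {} \<in> ?G" by (intro CollectI exI[of _ "{}"]) auto
    then show "?G \<noteq> {}" by blast
    show "?G \<subseteq> Pow M" by auto
  next
    fix A B assume "A \<in> ?G" "B \<in> ?G"
    then obtain A' B' where AB: "A = M - A'" "B = M - B'" "A' \<subseteq> M" "B' \<subseteq> M" "inside A'" "inside B'" by auto
    have "inside (A' \<union> B')"
      unfolding inside_def
    proof (intro allI impI)
      fix q assume "ultra_at_infinity q \<and> A' \<union> B' \<in> q"
      then show "q \<in> U" using ultrafilter_on_Un[of M q A' B'] ultra_at_infinityD(1) AB(5,6) unfolding inside_def by metis
    qed
    then have "M - (A' \<union> B') \<in> ?G" using AB by (intro CollectI exI[of _ "A' \<union> B'"]) auto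
    then show "\<exists>C\<in>?G. C \<subseteq> A \<inter> B" by (rule bexI[rotated]) (use AB in auto)
  next
    fix q assume q: "ultra_at_infinity q" "?G \<subseteq> q"
    show "q \<in> U'"
    proof (rule ccontr)
      assume "q \<notin> U'"
      then have "q \<in> U" using part[OF q(1)] by simp
      then obtain A where A: "A \<in> q" "inside A" using U(1) unfolding openin_sharp inside_def by metis
      note u = ultra_at_infinityD(1)[OF q(1)]
      have AM: "A \<subseteq> M" using ultrafilter_onD(1)[OF u A(1)] .
      then have "M - A \<in> ?G" using A(2) by auto
      then have "M - A \<in> q" by (rule subsetD[OF q(2)])
      then show False using ultrafilter_on_compl[OF u AM] A(1) by simp
    qed
  qed
  then obtain B where B: "B \<in> ?G" "\<forall>q. ultra_at_infinity q \<and> B \<in> q \<longrightarrow> q \<in> U'" by (elim bexE)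
  then obtain A where A: "B = M - A" "A \<subseteq> M" "inside A" by auto
  have "A \<in> q \<longleftrightarrow> q \<in> U" if q: "ultra_at_infinity q" for q
    using A(1,3)[unfolded inside_def] B(2) q part[OF q] ultrafilter_on_compl[OF ultra_at_infinityD(1)[OF q] A(2)] by auto
  then show ?thesis using A(2) by auto
qed

text \<open>By normality, the points away from \<open>P\<close> and the points away from
  \<open>Q\<close> cover the corona. Refining this open cover by disjoint open sets splits the
  corona into two clopen halves, and Stone duality turns one half into a set \<open>A\<close>. The
  remaining claims are read off ultrafilter by ultrafilter.\<close>

lemma clopen_separation:
  assumes dim: "covering_dim_le (corona X) 0"
    and PQ: "P \<subseteq> M" "Q \<subseteq> M" "asymp_disjoint P Q"
  shows "\<exists>A R. asymp_clopen A \<and> (\<forall>x\<in>P - A. d a x \<le> R) \<and> (\<forall>x\<in>A \<inter> Q. d a x \<le> R)"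
proof -
  \<comment> \<open>The complement of the closed trace that \<open>B\<close> leaves in the corona,
    seen among the ultrafilters.\<close>
  define away where "away B = {p. ultra_at_infinity p \<and> (\<exists>A\<in>p. asymp_disjoint A B)}" for B
  have away_open: "openin (sharp X) (away B)" for B
    unfolding openin_sharp by (auto simp: away_def)
  have away_sat: "q \<in> away B" if B: "B \<subseteq> M" and pq: "p \<in> away B" "(p, q) \<in> corona_rel" for B p q
  proof -
    obtain A where A: "A \<in> p" "asymp_disjoint A B" "ultra_at_infinity p" using pq(1) by (auto simp: away_def)
    then have "A \<subseteq> M" using ultrafilter_onD(1) ultra_at_infinityD(1) by metis
    then obtain C where C: "C \<subseteq> M" "asymp_disjoint A (M - C)" "asymp_disjoint C B"
      using asymp_disjoint_separate[OF A(2) _ B] by auto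
    have q: "ultra_at_infinity q" "M - C \<notin> q" using pq(2) A(1) C(2) unfolding corona_rel_iff by auto
    then have "C \<in> q" using ultrafilter_on_compl[OF ultra_at_infinityD(1)[OF q(1)] C(1)] by simp
    then show ?thesis using q(1) C(3) by (auto simp: away_def)
  qed
  define img where "img B = (\<lambda>p. corona_rel `` {p}) ` away B" for B
  have img_open: "openin (corona X) (img B)" if "B \<subseteq> M" for B
    unfolding img_def by (rule openin_corona_image[OF away_open]) (rule away_sat[OF that])
  have img_iff: "corona_rel `` {p} \<in> img B \<longleftrightarrow> p \<in> away B" if p: "ultra_at_infinity p" and B: "B \<subseteq> M" for p B
  proof
    assume "corona_rel `` {p} \<in> img B"
    then obtain q where q: "q \<in> away B" "corona_rel `` {p} = corona_rel `` {q}" by (auto simp: img_def)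
    then have "(q, p) \<in> corona_rel" using corona_class_eq_iff[of q p] p by (simp add: away_def)
    then show "p \<in> away B" using away_sat[OF B q(1)] by simp
  qed (simp add: img_def)
  obtain C where C: "C \<subseteq> M" "asymp_disjoint P (M - C)" "asymp_disjoint C Q"
    using asymp_disjoint_separate[OF PQ(3,1,2)] by auto
  have C': "asymp_disjoint (M - C) P" using asymp_disjoint_sym[OF C(2)] PQ(1) by auto
  have cov: "p \<in> away P \<or> p \<in> away Q" if p: "ultra_at_infinity p" for p
    using ultrafilter_on_compl[OF ultra_at_infinityD(1)[OF p] C(1)] C(3) C' p by (auto simp: away_def)
  have foc: "finite_open_cover (corona X) {img P, img Q}"
    unfolding finite_open_cover_def
  proof (intro conjI ballI)
    have "c \<in> img P \<union> img Q" if c: "c \<in> topspace (corona X)" for c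
    proof -
      obtain p where p: "ultra_at_infinity p" "c = corona_rel `` {p}" using c by (auto simp: topspace_corona)
      show ?thesis using cov[OF p(1)] unfolding p(2) Un_iff img_iff[OF p(1) PQ(1)] img_iff[OF p(1) PQ(2)] .
    qed
    then show "\<Union>{img P, img Q} = topspace (corona X)"
      using openin_subset[OF img_open[OF PQ(1)]] openin_subset[OF img_open[OF PQ(2)]] by auto
  qed (use img_open PQ in auto)
  obtain \<V> where V: "finite_open_cover (corona X) \<V>" "\<And>V. V \<in> \<V> \<Longrightarrow> V \<subseteq> img P \<or> V \<subseteq> img Q"
    "\<And>c. c \<in> topspace (corona X) \<Longrightarrow> int (card {V\<in>\<V>. c \<in> V}) \<le> 0 + 1"
    using dim[unfolded covering_dim_le_def, rule_format, OF foc] by auto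
  \<comment> \<open>Order at most one means that distinct members of the refinement are
    disjoint.\<close>
  have same: "V = V'" if "V \<in> \<V>" "V' \<in> \<V>" "c \<in> V" "c \<in> V'" for V V' c
  proof (rule ccontr)
    assume "V \<noteq> V'"
    have "openin (corona X) V" using V(1) that(1) unfolding finite_open_cover_def by auto
    then have "c \<in> topspace (corona X)" using openin_subset that(3) by blast
    then have "card {V\<in>\<V>. c \<in> V} \<le> 1" using V(3) by fastforce
    moreover have "card {V, V'} \<le> card {V\<in>\<V>. c \<in> V}"
      by (rule card_mono) (use V(1) that in \<open>auto simp: finite_open_cover_def\<close>)
    ultimately show False using \<open>V \<noteq> V'\<close> by simp
  qed
  \<comment> \<open>Members lying in both images go to \<open>W\<close>. Thus \<open>W\<close> is
    away from \<open>Q\<close>, and the rest \<open>W'\<close> is away from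
    \<open>P\<close>.\<close>
  define W where "W = \<Union>{V\<in>\<V>. V \<subseteq> img Q}"
  define W' where "W' = \<Union>{V\<in>\<V>. \<not> V \<subseteq> img Q}"
  have WW: "openin (corona X) W" "openin (corona X) W'"
    using V(1) unfolding W_def W'_def finite_open_cover_def by (auto intro!: openin_Union)
  have disj: "c \<notin> W'" if cW: "c \<in> W" for c
  proof
    assume "c \<in> W'"
    then obtain V' where V': "V' \<in> \<V>" "c \<in> V'" "\<not> V' \<subseteq> img Q" by (auto simp: W'_def)
    obtain V where "V \<in> \<V>" "c \<in> V" "V \<subseteq> img Q" using cW by (auto simp: W_def)
    then show False using same V' by metis
  qed
  have un: "c \<in> W" if "c \<in> topspace (corona X)" "c \<notin> W'" for c
  proof -
    have "c \<in> \<Union>\<V>" using that(1) V(1) by (simp add: finite_open_cover_def)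
    then show ?thesis using that(2) by (auto simp: W_def W'_def)
  qed
  have "\<exists>A\<subseteq>M. \<forall>q. ultra_at_infinity q \<longrightarrow> (A \<in> q \<longleftrightarrow> q \<in> {p. ultra_at_infinity p \<and> corona_rel `` {p} \<in> W})"
    by (rule sharp_clopen_set[OF openin_corona_preimage[OF WW(1)] openin_corona_preimage[OF WW(2)]])
      (use disj un topspace_corona in auto)
  then obtain A where A: "A \<subseteq> M" "\<And>q. ultra_at_infinity q \<Longrightarrow> A \<in> q \<longleftrightarrow> corona_rel `` {q} \<in> W" by auto
  \<comment> \<open>If not, parallel ultrafilters would contain \<open>A\<close> and its complement;
    having the same class, they cannot differ about \<open>W\<close>.\<close>
  have "asymp_clopen A"
    unfolding asymp_clopen_def
  proof (intro conjI, rule A(1), rule ccontr)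
    assume "\<not> asymp_disjoint A (M - A)"
    then obtain p q where pq: "(p, q) \<in> parallel X" "A \<in> p" "M - A \<in> q"
      using parallel_meets[of A "M - A"] A(1) by auto
    then have "(p, q) \<in> corona_rel" using closed_equiv_hull(3)[OF parallel_subset] by blast
    moreover have u: "ultra_at_infinity p" "ultra_at_infinity q" using pq(1) parallel_subset topspace_sharp by auto
    ultimately have "corona_rel `` {p} = corona_rel `` {q}" using corona_class_eq_iff[of p q] by simp
    then have "A \<in> q" using A(2) u pq(2) by metis
    then show False using ultrafilter_on_compl[OF ultra_at_infinityD(1)[OF u(2)] A(1)] pq(3) by simp
  qed
  moreover have "\<exists>R. \<forall>x\<in>P - A. d a x \<le> R"
  proof (rule bounded_if_no_ultra)
    fix p assume p: "ultra_at_infinity p"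
    note u = ultra_at_infinityD(1)[OF p]
    show "P - A \<notin> p"
    proof
      assume "P - A \<in> p"
      then have "P \<in> p" "M - A \<in> p" using ultrafilter_onD(5)[OF u] PQ(1) by (metis Diff_subset, metis Diff_mono Diff_subset order_refl)
      then have "corona_rel `` {p} \<notin> W" using A p ultrafilter_on_compl[OF u A(1)] by auto
      then have "corona_rel `` {p} \<in> W'" using un p topspace_corona by auto
      then have "corona_rel `` {p} \<in> img P" using V(2) by (auto simp: W'_def)
      then obtain B where "B \<in> p" "asymp_disjoint B P" using img_iff[OF p PQ(1)] by (auto simp: away_def)
      then show False using not_asymp_disjoint_same[OF p] \<open>P \<in> p\<close> by auto
    qed
  qed (use PQ in auto)
  moreover have "\<exists>R. \<forall>x\<in>A \<inter> Q. d a x \<le> R"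
  proof (rule bounded_if_no_ultra)
    fix p assume p: "ultra_at_infinity p"
    note u = ultra_at_infinityD(1)[OF p]
    show "A \<inter> Q \<notin> p"
    proof
      assume "A \<inter> Q \<in> p"
      then have "A \<in> p" "Q \<in> p" using ultrafilter_onD(5)[OF u] PQ(2) A(1) by (metis Int_lower1, metis Int_lower2)
      then have "corona_rel `` {p} \<in> W" using A p by auto
      then have "corona_rel `` {p} \<in> img Q" by (auto simp: W_def)
      then obtain B where "B \<in> p" "asymp_disjoint B Q" using img_iff[OF p PQ(2)] by (auto simp: away_def)
      then show False using not_asymp_disjoint_same[OF p] \<open>Q \<in> p\<close> by auto
    qed
  qed (use A in auto)
  ultimately obtain R R' where "asymp_clopen A" "\<forall>x\<in>P - A. d a x \<le> R" "\<forall>x\<in>A \<inter> Q. d a x \<le> R'" by auto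
  then show ?thesis by (intro exI[of _ A] exI[of _ "max R R'"]) (auto simp: le_max_iff_disj)
qed

text \<open>A long chain may run close to the base point. So it is followed from its remote end only
  until its distance from that end reaches \<open>R\<close>; up to this moment it stays outside the
  ball of radius \<open>R\<close>.\<close>

lemma far_chains:
  assumes "\<not> asymp_zero_dim"
  shows "\<exists>r. \<forall>R\<ge>0. \<exists>x\<in>M. \<exists>y\<in>M. (x, y) \<in> {(x, y) \<in> scale_graph r. R \<le> d a x \<and> R \<le> d a y}\<^sup>* \<and>
    R \<le> d a x \<and> R \<le> d a y \<and> R \<le> d x y"
proof -
  obtain r where r: "\<And>D. \<exists>x\<in>M. \<exists>y. (x, y) \<in> (scale_graph r)\<^sup>* \<and> D < d x y"
    using assms unfolding asymp_zero_dim_def by (meson not_le)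
  have sym: "(y, x) \<in> (scale_graph r)\<^sup>*" if "(x, y) \<in> (scale_graph r)\<^sup>*" for x y
    using that by (rule symD[OF sym_rtrancl, rotated]) (auto simp: sym_def scale_graph_def commute)
  have inM: "y \<in> M" if "(x, y) \<in> (scale_graph r)\<^sup>*" "x \<in> M" for x y
    using that by (induction rule: rtrancl_induct) (auto simp: scale_graph_def)
  have "\<exists>x\<in>M. \<exists>y\<in>M. (x, y) \<in> {(x, y) \<in> scale_graph r. R \<le> d a x \<and> R \<le> d a y}\<^sup>* \<and>
    R \<le> d a x \<and> R \<le> d a y \<and> R \<le> d x y" if R: "R \<ge> 0" for R
  proof -
    let ?E = "{(x, y) \<in> scale_graph r. R \<le> d a x \<and> R \<le> d a y}"
    \<comment> \<open>Ends farther apart than \<open>?D\<close> cannot both be within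
      \<open>2 * R + \<bar>r\<bar>\<close> of the base point. The term \<open>\<bar>r\<bar>\<close>
      absorbs the last edge, which may overshoot the distance \<open>R\<close>.\<close>
    let ?D = "2 * (2 * R + \<bar>r\<bar>)"
    obtain x0 y0 where 0: "x0 \<in> M" "(x0, y0) \<in> (scale_graph r)\<^sup>*" "?D < d x0 y0" using r[of ?D] by auto
    have "y0 \<in> M" using inM 0 by auto
    then have "d x0 y0 \<le> d a x0 + d a y0" using triangle[OF 0(1) base, of y0] by (simp add: commute)
    then have "2 * R + \<bar>r\<bar> \<le> d a x0 \<or> 2 * R + \<bar>r\<bar> \<le> d a y0" using 0(3) by (intro disjCI) simp
    then obtain x y where x: "x \<in> M" "(x, y) \<in> (scale_graph r)\<^sup>*" "?D < d x y" "2 * R + \<bar>r\<bar> \<le> d a x"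
      using 0 sym \<open>y0 \<in> M\<close> commute by metis
    let ?z = "\<exists>z\<in>M. (x, z) \<in> ?E\<^sup>* \<and> R \<le> d a z \<and> R \<le> d x z"
    \<comment> \<open>Along the chain, either a suitable end has already been met or everything so
      far is within \<open>R\<close> of \<open>x\<close>. The strict bound \<open>d x y < R\<close>
      fails at the start for \<open>R = 0\<close>, where \<open>x\<close> itself serves as the
      end.\<close>
    have "?z \<or> ((x, y) \<in> ?E\<^sup>* \<and> d x y < R)" if "R > 0"
      using x(2)
    proof (induction rule: rtrancl_induct)
      case base
      then show ?case using that x(1) by simp
    next
      case (step y y')
      show ?case
      proof (cases ?z)
        case False
        then have y: "(x, y) \<in> ?E\<^sup>*" "d x y < R" using step by auto
        have M: "y \<in> M" "y' \<in> M" "d y y' \<le> r" using step(2) by (auto simp: scale_graph_def)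
        have "d a x \<le> d a y + d x y" "d a x \<le> d a y' + d x y'" "d x y' \<le> d x y + d y y'"
          using triangle[OF base _ x(1)] triangle[OF x(1) M(1,2)] M commute by metis+
        then have "R \<le> d a y" "R \<le> d a y'" using x(4) y(2) M(3) R by linarith+
        then have "(y, y') \<in> ?E" using step(2) by auto
        then have "(x, y') \<in> ?E\<^sup>*" using y(1) by (rule rtrancl_into_rtrancl[rotated])
        then show ?thesis using \<open>R \<le> d a y'\<close> M(2) by (meson not_le)
      qed blast
    qed
    moreover have "?z" if "R = 0" using that x(1) nonneg by (intro bexI[of _ x]) auto
    moreover have "R \<le> d x y" using x(3) R abs_ge_zero[of r] by argo
    ultimately have ?z using R by linarith
    then obtain z where z: "z \<in> M" "(x, z) \<in> ?E\<^sup>*" "R \<le> d a z" "R \<le> d x z" by (elim bexE conjE)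
    have "R \<le> d a x" using x(4) R abs_ge_zero[of r] by argo
    then show ?thesis by (intro bexI[OF _ x(1)] bexI[OF _ z(1)] conjI z(2-4))
  qed
  then show ?thesis by blast
qed

text \<open>
  If some chains are long, far ends of ever longer and more remote chains form two asymptotically
  disjoint sets; an asymptotically clopen set separating them would have to be crossed by the chains.
\<close>

lemma asymp_zero_dim_if_covering_dim:
  assumes dim: "covering_dim_le (corona X) 0"
  shows asymp_zero_dim
proof (rule ccontr)
  assume "\<not> asymp_zero_dim"
  then obtain r where r: "\<forall>R\<ge>0. \<exists>x\<in>M. \<exists>y\<in>M. (x, y) \<in> {(x, y) \<in> scale_graph r. R \<le> d a x \<and> R \<le> d a y}\<^sup>* \<and>
    R \<le> d a x \<and> R \<le> d a y \<and> R \<le> d x y" using far_chains by auto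
  define E where "E R = {(x, y) \<in> scale_graph r. R \<le> d a x \<and> R \<le> d a y}" for R
  define g where "g R s = (fst s \<in> M \<and> snd s \<in> M \<and> s \<in> (E R)\<^sup>* \<and> R \<le> d a (fst s) \<and> R \<le> d a (snd s) \<and> R \<le> d (fst s) (snd s))" for R s
  have ex: "\<exists>s. g R s" if R0: "R \<ge> 0" for R
  proof -
    obtain x y where "x \<in> M" "y \<in> M" "(x, y) \<in> (E R)\<^sup>*" "R \<le> d a x" "R \<le> d a y" "R \<le> d x y"
      using r[rule_format, OF R0] unfolding E_def by (elim bexE conjE)
    then show ?thesis by (intro exI[of _ "(x, y)"]) (simp add: g_def)
  qed
  define B where "B s = max (d a (fst s)) (d a (snd s))" for s
  have B0: "B s \<ge> 0" for s unfolding B_def by (simp add: le_max_iff_disj)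
  \<comment> \<open>Each pair of ends lies farther out than the preceding pair by more than
    \<open>n\<close>, so ends with different indices are far apart as well.\<close>
  obtain s where s: "\<And>n. g (B (s n) + real n + 1) (s (Suc n))"
  proof -
    have "\<exists>s. \<forall>n. True \<and> g (B (s n) + real n + 1) (s (Suc n))"
    proof (rule dependent_nat_choice)
      fix t and n :: nat
      show "\<exists>t'. True \<and> g (B t + real n + 1) t'" using ex[of "B t + real n + 1"] B0[of t] by auto
    qed simp
    then show thesis using that by auto
  qed
  \<comment> \<open>The choice starts with an arbitrary pair \<open>s 0\<close>, about which nothing
    is known except that \<open>B (s 0)\<close> is nonnegative; hence the shift.\<close>
  define x where "x n = fst (s (Suc n))" for n
  define y where "y n = snd (s (Suc n))" for n
  define b where "b n = B (s n)" for n
  have xy: "x n \<in> M" "y n \<in> M" "b n + real n + 1 \<le> d a (x n)" "b n + real n + 1 \<le> d a (y n)"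
    "b n + real n + 1 \<le> d (x n) (y n)" "(x n, y n) \<in> (E (b n + real n + 1))\<^sup>*"
    "d a (x n) \<le> b (Suc n)" "d a (y n) \<le> b (Suc n)" "b n \<ge> 0" for n
    using s[of n] B0[of "s n"] by (auto simp: g_def x_def y_def b_def B_def)
  have "b n \<le> b (Suc n)" for n using xy(3,7)[of n] by linarith
  then have bmono: "b m \<le> b n" if "m \<le> n" for m n using that by (rule lift_Suc_mono_le)
  have far: "real (max m n) \<le> d (x m) (y n)" for m n
  proof (cases m n rule: linorder_cases)
    case equal
    then show ?thesis using xy(5,9)[of n] by simp
  next
    case less
    have "d a (y n) \<le> d a (x m) + d (x m) (y n)" using triangle[OF base xy(1,2)] .
    moreover have "b (Suc m) \<le> b n" using bmono less by simp
    ultimately show ?thesis using xy(4)[of n] xy(7)[of m] less by simp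
  next
    case greater
    have "d a (x m) \<le> d a (y n) + d (x m) (y n)" using triangle[OF base xy(2)[of n] xy(1)[of m]] by (simp add: commute)
    moreover have "b (Suc n) \<le> b m" using bmono greater by simp
    ultimately show ?thesis using xy(3)[of m] xy(8)[of n] greater by simp
  qed
  have "asymp_disjoint (range x) (range y)"
    unfolding asymp_disjoint_def
  proof
    fix \<rho>
    have "d a (x m) \<le> b (Suc (nat \<lceil>\<rho>\<rceil>))" if "d (x m) (y n) \<le> \<rho>" for m n
    proof -
      have "real m \<le> \<rho>" using far[of m n] that by linarith
      then have "m \<le> nat \<lceil>\<rho>\<rceil>" by linarith
      then have "b (Suc m) \<le> b (Suc (nat \<lceil>\<rho>\<rceil>))" using bmono by simp
      then show ?thesis using xy(7)[of m] by linarith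
    qed
    then show "\<exists>R. \<forall>u\<in>range x. \<forall>v\<in>range y. d u v \<le> \<rho> \<longrightarrow> d a u \<le> R" by auto
  qed
  moreover have "range x \<subseteq> M" "range y \<subseteq> M" using xy(1,2) by auto
  ultimately obtain A R where A: "asymp_clopen A" "\<And>u. u \<in> range x - A \<Longrightarrow> d a u \<le> R" "\<And>u. u \<in> A \<inter> range y \<Longrightarrow> d a u \<le> R"
    using clopen_separation[OF dim, of "range x" "range y"] by metis
  obtain R' where R': "\<And>u v. u \<in> A \<Longrightarrow> v \<in> M - A \<Longrightarrow> d u v \<le> r \<Longrightarrow> d a u \<le> R'"
    using A(1) unfolding asymp_clopen_def asymp_disjoint_def by meson
  \<comment> \<open>Beyond \<open>R\<close> the ends lie on the sides prescribed by
    \<open>A\<close>, and beyond \<open>R'\<close> no edge of length at most \<open>r\<close> leaves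
    \<open>A\<close>.\<close>
  define n where "n = nat \<lceil>max R R'\<rceil>"
  have n: "R \<le> real n" "R' \<le> real n" unfolding n_def by linarith+
  have far_n: "R < d a (x n)" "R < d a (y n)" using xy(3,4,9)[of n] n by auto
  have "x n \<in> A"
  proof (rule ccontr)
    assume "x n \<notin> A"
    then show False using A(2)[of "x n"] far_n(1) by simp
  qed
  moreover have "y n \<notin> A"
  proof
    assume "y n \<in> A"
    then show False using A(3)[of "y n"] far_n(2) by simp
  qed
  ultimately have "\<exists>u v. (u, v) \<in> E (b n + real n + 1) \<and> u \<in> A \<and> v \<notin> A"
    using rtrancl_crossing[OF xy(6)] by simp
  then obtain u v where "(u, v) \<in> E (b n + real n + 1)" "u \<in> A" "v \<notin> A" by auto
  then show False using R'[of u v] n xy(9)[of n] by (auto simp: E_def scale_graph_def)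
qed

end

section \<open>Characters\<close>

lemma nbhd_base_all_open:
  assumes "t \<in> topspace T"
  shows "nbhd_base T t {U. openin T U \<and> t \<in> U}"
  unfolding nbhd_base_def by (auto dest: openin_subset)

lemma character_min_cardinal:
  assumes "t \<in> topspace T"
  shows "\<exists>\<B>. nbhd_base T t \<B> \<and> character T t = |\<B>|"
    and "nbhd_base T t \<B> \<Longrightarrow> character T t \<le>o |\<B>|"
proof -
  let ?K = "card_of ` {\<B>. nbhd_base T t \<B>}"
  have K: "?K \<noteq> {}" "\<forall>r\<in>?K. Card_order r"
    using nbhd_base_all_open[OF assms] by (auto simp: card_of_Card_order)
  show "\<exists>\<B>. nbhd_base T t \<B> \<and> character T t = |\<B>|"
    using min_cardinal(1)[OF K] unfolding character_def by auto
  show "character T t \<le>o |\<B>|" if "nbhd_base T t \<B>"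
    using min_cardinal(2)[OF K] that unfolding character_def by auto
qed

lemma min_character_min_cardinal:
  assumes "topspace T \<noteq> {}"
  shows "\<exists>t\<in>topspace T. min_character T = character T t"
    and "t \<in> topspace T \<Longrightarrow> min_character T \<le>o character T t"
proof -
  let ?K = "character T ` topspace T"
  have "Card_order (character T t)" if "t \<in> topspace T" for t
    using character_min_cardinal(1)[OF that] card_of_Card_order by metis
  then have K: "?K \<noteq> {}" "\<forall>r\<in>?K. Card_order r" using assms by auto
  show "\<exists>t\<in>topspace T. min_character T = character T t"
    using min_cardinal(1)[OF K] unfolding min_character_def by auto
  show "min_character T \<le>o character T t" if "t \<in> topspace T"
    using min_cardinal(2)[OF K] that unfolding min_character_def by auto
qed

lemma min_character_le:
  assumes "t \<in> topspace T" "nbhd_base T t \<B>"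
  shows "min_character T \<le>o |\<B>|"
proof -
  have "topspace T \<noteq> {}" using assms(1) by auto
  then show ?thesis
    using min_character_min_cardinal(2) character_min_cardinal(2) assms ordLeq_transitive by metis
qed

lemma min_character_attained:
  assumes "topspace T \<noteq> {}"
  shows "\<exists>t\<in>topspace T. \<exists>\<B>. nbhd_base T t \<B> \<and> min_character T = |\<B>|"
  using min_character_min_cardinal(1)[OF assms] character_min_cardinal(1) by metis

section \<open>Free ultrafilters on the natural numbers\<close>

lemma finite_notin_ultrafilter:
  assumes p: "ultrafilter_on UNIV p" "p \<notin> range (\<lambda>n. {A. n \<in> A})" and "finite F"
  shows "F \<notin> p"
proof
  assume "F \<in> p"
  then have "\<exists>n\<in>F. {n} \<in> p" using ultrafilter_on_UN[OF p(1) \<open>finite F\<close>, of "\<lambda>n. {n}"] by simp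
  then obtain n where n: "{n} \<in> p" by blast
  have "A \<in> p \<longleftrightarrow> n \<in> A" for A
  proof
    assume "A \<in> p"
    then have "A \<inter> {n} \<in> p" using n ultrafilter_onD(4)[OF p(1)] by simp
    then show "n \<in> A" using ultrafilter_onD(3)[OF p(1)] by (cases "n \<in> A") auto
  qed (use n ultrafilter_onD(5)[OF p(1) n] in auto)
  then have "p = {A. n \<in> A}" by auto
  then show False using p(2) by auto
qed

lemma free_ultrafilter_exists:
  assumes "infinite B"
  shows "\<exists>p. ultrafilter_on UNIV p \<and> p \<notin> range (\<lambda>n. {A. n \<in> A}) \<and> B \<in> p"
proof -
  have "\<exists>p. ultrafilter_on UNIV p \<and> insert B (range (\<lambda>n. UNIV - {n})) \<subseteq> p"
  proof (rule ultrafilter_on_extend)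
    fix G assume G: "finite G" "G \<subseteq> insert B (range (\<lambda>n. UNIV - {n}))"
    obtain T where T: "finite T" "G - {B} = (\<lambda>n. UNIV - {n}) ` T"
      using finite_subset_image[of "G - {B}" "\<lambda>n. UNIV - {n}" UNIV] G by blast
    obtain x where x: "x \<in> B" "x \<notin> T" using assms T(1) by (meson finite_subset subsetI)
    have "x \<in> A" if "A \<in> G" for A
    proof (cases "A = B")
      case False
      then have "A \<in> (\<lambda>n. UNIV - {n}) ` T" using that T(2) by blast
      then show ?thesis using x by auto
    qed (use x in simp)
    then show "UNIV \<inter> \<Inter>G \<noteq> {}" by auto
  qed simp
  then obtain p where p: "ultrafilter_on UNIV p" "B \<in> p" "\<And>n. UNIV - {n} \<in> p" by auto
  have "p \<noteq> {A. n \<in> A}" for n using p(3)[of n] by auto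
  then show ?thesis using p by auto
qed

definition free_ultrafilter :: "nat set set \<Rightarrow> bool" where
  "free_ultrafilter p \<longleftrightarrow> ultrafilter_on UNIV p \<and> (\<forall>F. finite F \<longrightarrow> F \<notin> p)"

lemma topspace_omega_star: "topspace omega_star = {p. free_ultrafilter p}"
proof -
  have "free_ultrafilter p \<longleftrightarrow> ultrafilter_on UNIV p \<and> p \<notin> range (\<lambda>n. {A. n \<in> A})" for p
    unfolding free_ultrafilter_def using finite_notin_ultrafilter[of p] by (auto dest: spec[of _ "{_}"])
  then show ?thesis
    unfolding omega_star_def topspace_subtopology topspace_beta_discrete by auto
qed

lemma openin_omega_star:
  "openin omega_star U \<longleftrightarrow> U \<subseteq> {p. free_ultrafilter p} \<and>
     (\<forall>p\<in>U. \<exists>A\<in>p. \<forall>q. free_ultrafilter q \<and> A \<in> q \<longrightarrow> q \<in> U)" (is "?L \<longleftrightarrow> ?R")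
proof -
  define F where "F = {p. free_ultrafilter p}"
  have om: "openin omega_star U \<longleftrightarrow> (\<exists>V. openin (beta_discrete UNIV) V \<and> U = V \<inter> F)"
  proof -
    have "topspace (beta_discrete (UNIV :: nat set)) - range (\<lambda>n. {A. n \<in> A}) = F"
      using topspace_omega_star unfolding omega_star_def topspace_subtopology F_def by auto
    then show ?thesis unfolding omega_star_def openin_subtopology by simp
  qed
  show ?thesis
  proof
    assume ?L
    then obtain V where V: "openin (beta_discrete UNIV) V" "U = V \<inter> F" unfolding om by auto
    have "\<exists>A\<in>p. \<forall>q. free_ultrafilter q \<and> A \<in> q \<longrightarrow> q \<in> U" if "p \<in> U" for p
    proof -
      have "p \<in> V" using that V(2) by simp
      then obtain A where "A \<in> p" "\<forall>q. ultrafilter_on UNIV q \<and> A \<in> q \<longrightarrow> q \<in> V"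
        using V(1)[unfolded openin_beta_discrete] by auto
      then show ?thesis unfolding V(2) F_def free_ultrafilter_def by auto
    qed
    then show ?R using V(2) by (auto simp: F_def)
  next
    assume R: ?R
    define V where "V = {q. ultrafilter_on UNIV q \<and> (\<exists>A\<in>q. \<forall>q'. free_ultrafilter q' \<and> A \<in> q' \<longrightarrow> q' \<in> U)}"
    have "openin (beta_discrete UNIV) V" unfolding openin_beta_discrete by (auto simp: V_def)
    moreover have "U = V \<inter> F"
    proof (intro equalityI subsetI)
      fix p assume "p \<in> U"
      then show "p \<in> V \<inter> F" using R by (auto simp: V_def F_def free_ultrafilter_def)
    next
      fix p assume "p \<in> V \<inter> F"
      then show "p \<in> U" by (auto simp: V_def F_def)
    qed
    ultimately show ?L unfolding om by auto
  qed
qed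

lemma free_ultrafilter_extend: "infinite B \<Longrightarrow> \<exists>p. free_ultrafilter p \<and> B \<in> p"
  using free_ultrafilter_exists[of B] finite_notin_ultrafilter by (metis free_ultrafilter_def)

text \<open>A neighbourhood in the remainder of the naturals determines a set only modulo finite
  sets: an infinite difference \<open>I - J\<close> would carry a free ultrafilter containing
  \<open>I\<close> and not \<open>J\<close>. Hence a smallest neighbourhood base becomes a base of
  the ultrafilter modulo finite sets.\<close>

lemma ultrafilter_number_base:
  "\<exists>p \<A>. free_ultrafilter p \<and> \<A> \<subseteq> p \<and> (\<forall>J\<in>p. \<exists>I\<in>\<A>. finite (I - J)) \<and> |\<A>| \<le>o ultrafilter_number"
proof -
  have "topspace omega_star \<noteq> {}" using free_ultrafilter_extend[of UNIV] topspace_omega_star by auto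
  then obtain p \<B> where p: "p \<in> topspace omega_star" "nbhd_base omega_star p \<B>" "ultrafilter_number = |\<B>|"
    using min_character_attained unfolding ultrafilter_number_def by metis
  have "\<exists>A\<in>p. \<forall>q. free_ultrafilter q \<and> A \<in> q \<longrightarrow> q \<in> N" if N: "N \<in> \<B>" for N
  proof -
    obtain U where U: "openin omega_star U" "p \<in> U" "U \<subseteq> N" using p(2) N unfolding nbhd_base_def by auto
    obtain A where "A \<in> p" "\<forall>q. free_ultrafilter q \<and> A \<in> q \<longrightarrow> q \<in> U" using U(1,2) unfolding openin_omega_star by auto
    then show ?thesis using U(3) by auto
  qed
  then obtain f where f: "\<And>N. N \<in> \<B> \<Longrightarrow> f N \<in> p" "\<And>N q. N \<in> \<B> \<Longrightarrow> free_ultrafilter q \<Longrightarrow> f N \<in> q \<Longrightarrow> q \<in> N"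
    by metis
  have "\<exists>I\<in>f ` \<B>. finite (I - J)" if J: "J \<in> p" for J
  proof -
    have "openin omega_star {q. free_ultrafilter q \<and> J \<in> q}" unfolding openin_omega_star by auto
    then obtain N where N: "N \<in> \<B>" "N \<subseteq> {q. free_ultrafilter q \<and> J \<in> q}"
      using p(1,2) J unfolding nbhd_base_def topspace_omega_star by auto
    have "finite (f N - J)"
    proof (rule ccontr)
      assume "infinite (f N - J)"
      then obtain q where q: "free_ultrafilter q" "f N - J \<in> q" using free_ultrafilter_extend by auto
      then have u: "ultrafilter_on UNIV q" by (simp add: free_ultrafilter_def)
      have "f N \<in> q" by (rule ultrafilter_onD(5)[OF u q(2)]) auto
      then have "J \<in> q" using f(2)[OF N(1) q(1)] N(2) by auto
      moreover have "UNIV - J \<in> q" by (rule ultrafilter_onD(5)[OF u q(2)]) auto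
      ultimately show False using ultrafilter_on_compl[OF u, of J] by simp
    qed
    then show ?thesis using N(1) by auto
  qed
  moreover have "|f ` \<B>| \<le>o ultrafilter_number" using p(3) card_of_image by metis
  moreover have "free_ultrafilter p" "f ` \<B> \<subseteq> p" using p(1) f(1) topspace_omega_star by auto
  ultimately show ?thesis by (intro exI[of _ p] exI[of _ "f ` \<B>"]) simp
qed

lemma free_ultrafilter_cofinite:
  assumes "free_ultrafilter p" "J \<in> p" "finite (J - I)"
  shows "I \<in> p"
proof -
  have u: "ultrafilter_on UNIV p" and "J - I \<notin> p" using assms by (auto simp: free_ultrafilter_def)
  then have "UNIV - (J - I) \<in> p" using ultrafilter_on_compl[OF u, of "J - I"] by simp
  then have "J \<inter> (UNIV - (J - I)) \<in> p" using ultrafilter_onD(4)[OF u assms(2)] by simp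
  then show ?thesis by (rule ultrafilter_onD(5)[OF u]) auto
qed

section \<open>Homeomorphism invariance of the minimal character and of the dimension\<close>

lemma homeomorphic_nbhd_base:
  assumes hom: "homeomorphic_maps T T' f g" and t: "t \<in> topspace T" and B: "nbhd_base T t \<B>"
  shows "nbhd_base T' (f t) ((`) f ` \<B>)"
proof -
  have hf: "homeomorphic_map T T' f" using hom homeomorphic_maps_map by blast
  have gf: "\<And>x. x \<in> topspace T \<Longrightarrow> g (f x) = x" and fg: "\<And>y. y \<in> topspace T' \<Longrightarrow> f (g y) = y"
    and cf: "continuous_map T T' f"
    using hom by (auto simp: homeomorphic_maps_def)
  have img: "f ` N \<subseteq> topspace T'" if "N \<subseteq> topspace T" for N
    using that homeomorphic_imp_surjective_map[OF hf] by auto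
  show ?thesis
    unfolding nbhd_base_def
  proof (intro conjI ballI allI impI)
    fix N assume "N \<in> (`) f ` \<B>"
    then obtain N0 where N0: "N0 \<in> \<B>" "N = f ` N0" by auto
    then obtain U where U: "N0 \<subseteq> topspace T" "openin T U" "t \<in> U" "U \<subseteq> N0" using B unfolding nbhd_base_def by auto
    show "N \<subseteq> topspace T'" using img U(1) N0(2) by simp
    have "openin T' (f ` U)"
      using homeomorphic_imp_open_map[OF hf] U(2) by (simp add: open_map_def)
    then show "\<exists>U. openin T' U \<and> f t \<in> U \<and> U \<subseteq> N" using U N0(2) by (intro exI[of _ "f ` U"]) auto
  next
    fix W assume W: "openin T' W \<and> f t \<in> W"
    have "openin T {x \<in> topspace T. f x \<in> W}" using openin_continuous_map_preimage[OF cf] W by auto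
    then obtain N where "N \<in> \<B>" "N \<subseteq> {x \<in> topspace T. f x \<in> W}"
      using B W t unfolding nbhd_base_def by auto
    then show "\<exists>N\<in>(`) f ` \<B>. N \<subseteq> W" by (intro bexI[of _ "f ` N"]) auto
  qed
qed

lemma homeomorphic_min_character_le:
  assumes "T homeomorphic_space T'" "topspace T \<noteq> {}"
  shows "min_character T' \<le>o min_character T"
proof -
  obtain f g where fg: "homeomorphic_maps T T' f g" using assms(1) by (auto simp: homeomorphic_space_def)
  obtain t \<B> where t: "t \<in> topspace T" "nbhd_base T t \<B>" "min_character T = |\<B>|"
    using min_character_attained[OF assms(2)] by auto
  have "f t \<in> topspace T'" using fg t(1) by (auto simp: homeomorphic_maps_def continuous_map_def)
  then have "min_character T' \<le>o |(`) f ` \<B>|"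
    by (rule min_character_le[OF _ homeomorphic_nbhd_base[OF fg t(1,2)]])
  also have "|(`) f ` \<B>| \<le>o min_character T" unfolding t(3) by (rule card_of_image)
  finally show ?thesis .
qed

lemma homeomorphic_covering_dim_le:
  assumes hom: "T homeomorphic_space T'" and dim: "covering_dim_le T n"
  shows "covering_dim_le T' n"
  unfolding covering_dim_le_def
proof (intro allI impI)
  fix \<U> assume U: "finite_open_cover T' \<U>"
  obtain f g where fg: "homeomorphic_maps T T' f g" using hom by (auto simp: homeomorphic_space_def)
  have hf: "homeomorphic_map T T' f" using fg homeomorphic_maps_map by blast
  have cf: "continuous_map T T' f" and surj: "f ` topspace T = topspace T'" and inj: "inj_on f (topspace T)"
    using hf homeomorphic_imp_continuous_map homeomorphic_imp_surjective_map homeomorphic_imp_injective_map by blast+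
  let ?pre = "\<lambda>U. {x \<in> topspace T. f x \<in> U}"
  have foc: "finite_open_cover T (?pre ` \<U>)"
    unfolding finite_open_cover_def
  proof (intro conjI ballI)
    show "openin T V" if "V \<in> ?pre ` \<U>" for V
      using that U openin_continuous_map_preimage[OF cf] unfolding finite_open_cover_def by auto
    show "\<Union>(?pre ` \<U>) = topspace T"
    proof (intro equalityI subsetI)
      fix x assume x: "x \<in> topspace T"
      then have "f x \<in> \<Union>\<U>" using surj U unfolding finite_open_cover_def by auto
      then show "x \<in> \<Union>(?pre ` \<U>)" using x by auto
    qed auto
  qed (use U in \<open>simp add: finite_open_cover_def\<close>)
  obtain \<V> where V: "finite_open_cover T \<V>" "\<forall>V\<in>\<V>. \<exists>W\<in>?pre ` \<U>. V \<subseteq> W"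
    "\<And>x. x \<in> topspace T \<Longrightarrow> int (card {V\<in>\<V>. x \<in> V}) \<le> n + 1"
    using dim[unfolded covering_dim_le_def, rule_format, OF foc] by (elim exE conjE) simp
  have sub: "V \<subseteq> topspace T" if "V \<in> \<V>" for V
    using V(1) that unfolding finite_open_cover_def by (meson openin_subset)
  show "\<exists>\<V>. finite_open_cover T' \<V> \<and> (\<forall>V\<in>\<V>. \<exists>U\<in>\<U>. V \<subseteq> U) \<and>
      (\<forall>x\<in>topspace T'. int (card {V \<in> \<V>. x \<in> V}) \<le> n + 1)"
  proof (intro exI[of _ "(`) f ` \<V>"] conjI ballI)
    show "finite_open_cover T' ((`) f ` \<V>)"
      unfolding finite_open_cover_def
    proof (intro conjI ballI)
      show "finite ((`) f ` \<V>)" using V(1) by (simp add: finite_open_cover_def)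
      show "openin T' W" if "W \<in> (`) f ` \<V>" for W
        using that V(1) homeomorphic_imp_open_map[OF hf] by (auto simp: open_map_def finite_open_cover_def)
      have "\<Union>((`) f ` \<V>) = f ` \<Union>\<V>" by auto
      then show "\<Union>((`) f ` \<V>) = topspace T'" using V(1) surj by (simp add: finite_open_cover_def)
    qed
    fix W assume "W \<in> (`) f ` \<V>"
    then obtain V0 where V0: "V0 \<in> \<V>" "W = f ` V0" by auto
    then obtain U0 where "U0 \<in> \<U>" "V0 \<subseteq> ?pre U0" using V(2) by blast
    then show "\<exists>U\<in>\<U>. W \<subseteq> U" using V0(2) by (intro bexI[of _ U0]) auto
  next
    fix y assume "y \<in> topspace T'"
    then obtain x where x: "x \<in> topspace T" "y = f x" using surj by auto
    have "{W \<in> (`) f ` \<V>. y \<in> W} \<subseteq> (`) f ` {V\<in>\<V>. x \<in> V}"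
    proof
      fix W assume "W \<in> {W \<in> (`) f ` \<V>. y \<in> W}"
      then obtain V0 z where V0: "V0 \<in> \<V>" "W = f ` V0" "z \<in> V0" "f x = f z" using x(2) by auto
      then have "z = x" using inj x(1) sub[OF V0(1)] by (auto dest: inj_onD)
      then show "W \<in> (`) f ` {V\<in>\<V>. x \<in> V}" using V0 by auto
    qed
    moreover have fin: "finite {V\<in>\<V>. x \<in> V}" using V(1) by (simp add: finite_open_cover_def)
    ultimately have "card {W \<in> (`) f ` \<V>. y \<in> W} \<le> card {V\<in>\<V>. x \<in> V}"
      using surj_card_le by blast
    then show "int (card {W \<in> (`) f ` \<V>. y \<in> W}) \<le> n + 1" using V(3)[OF x(1)] by linarith
  qed
qed

text \<open>A cover of order zero covers no point, so a nonempty space excludes \<open>- 1\<close>.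
  The infimum runs over integers and is below 1 only if 0 is among them.\<close>

lemma covering_dim_eq_0_iff:
  assumes "topspace T \<noteq> {}"
  shows "covering_dim T = 0 \<longleftrightarrow> covering_dim_le T 0"
proof -
  have no: "\<not> covering_dim_le T (- 1)"
  proof
    assume le: "covering_dim_le T (- 1)"
    obtain x where x: "x \<in> topspace T" using assms by blast
    have foc: "finite_open_cover T {topspace T}" by (simp add: finite_open_cover_def)
    obtain \<V> where V: "finite_open_cover T \<V>" "\<And>x. x \<in> topspace T \<Longrightarrow> int (card {V\<in>\<V>. x \<in> V}) \<le> 0"
      using le[unfolded covering_dim_le_def, rule_format, OF foc] by auto
    obtain V0 where "V0 \<in> \<V>" "x \<in> V0" using V(1) x unfolding finite_open_cover_def by blast
    moreover have "finite {V\<in>\<V>. x \<in> V}" using V(1) by (simp add: finite_open_cover_def)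
    ultimately show False using V(2)[OF x] by auto
  qed
  let ?N = "{n::int. - 1 \<le> n \<and> covering_dim_le T n}"
  have pos: "0 \<le> n" if "n \<in> ?N" for n
    using that no by (cases "n = - 1") auto
  have ge: "0 \<le> covering_dim T"
    unfolding covering_dim_def by (rule INF_greatest) (use pos in auto)
  show ?thesis
  proof
    assume "covering_dim T = 0"
    then have "(INF n \<in> ?N. ereal (real_of_int n)) < 1" unfolding covering_dim_def by simp
    then obtain n where n: "n \<in> ?N" "ereal (real_of_int n) < 1" unfolding INF_less_iff by auto
    then have "n < 1" by (simp add: one_ereal_def)
    then have "n = 0" using pos[OF n(1)] by simp
    then show "covering_dim_le T 0" using n(1) by simp
  next
    assume "covering_dim_le T 0"
    then have "covering_dim T \<le> ereal (real_of_int 0)" unfolding covering_dim_def by (intro INF_lower) simp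
    then show "covering_dim T = 0" using ge by (simp add: zero_ereal_def)
  qed
qed

section \<open>Small characters from isolated balls\<close>

context unbounded_space
begin

lemma topspace_corona_nonempty: "topspace (corona X) \<noteq> {}"
  using ultra_at_infinity_exists[of M] unbounded by (auto simp: topspace_corona)

lemma ultra_at_infinity_seq:
  assumes p: "free_ultrafilter p" and x: "\<And>n. x n \<in> M" "\<And>n::nat. real n \<le> d a (x n)"
  shows "ultra_at_infinity (ultrafilter_push UNIV M x p)"
  unfolding ultra_at_infinity_def
proof (intro conjI allI)
  have u: "ultrafilter_on UNIV p" using p by (simp add: free_ultrafilter_def)
  show "ultrafilter_on M (ultrafilter_push UNIV M x p)"
    using ultrafilter_on_push[OF u, of x M] x(1) by auto
  fix R
  have "{n. \<not> R < d a (x n)} \<subseteq> {..nat \<lceil>R\<rceil>}"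
  proof
    fix n assume "n \<in> {n. \<not> R < d a (x n)}"
    then have "real n \<le> R" using x(2)[of n] by simp
    then show "n \<in> {..nat \<lceil>R\<rceil>}" by (simp; linarith)
  qed
  then have "finite {n. \<not> R < d a (x n)}" using finite_subset by blast
  moreover have "UNIV - {n. R < d a (x n)} = {n. \<not> R < d a (x n)}" by auto
  ultimately have "{n. R < d a (x n)} \<in> p"
    using free_ultrafilter_cofinite[OF p ultrafilter_onD(2)[OF u]] by metis
  then show "{y\<in>M. R < d a y} \<in> ultrafilter_push UNIV M x p" using x(1) by (simp add: ultrafilter_push_def)
qed

lemma min_character_corona_le:
  assumes "ultra_at_infinity p"
    and "\<And>C. C \<in> \<C> \<Longrightarrow> asymp_clopen C \<and> C \<in> p"
    and "\<And>P Q. P \<in> p \<Longrightarrow> Q \<subseteq> M \<Longrightarrow> asymp_disjoint P Q \<Longrightarrow> \<exists>C\<in>\<C>. \<exists>R. \<forall>x\<in>C \<inter> Q. d a x \<le> R"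
  shows "min_character (corona X) \<le>o |\<C>|"
proof -
  have "min_character (corona X) \<le>o |clopen_class ` \<C>|"
  proof (rule min_character_le[OF _ nbhd_base_clopen[OF assms]])
    show "corona_rel `` {p} \<in> topspace (corona X)" using assms(1) topspace_corona by auto
  qed
  then show ?thesis using card_of_image ordLeq_transitive by blast
qed

text \<open>The balls of radius \<open>e\<close> around the \<open>x n\<close> have gaps growing
  with \<open>n\<close>, so every union of them over an index set is asymptotically clopen. Unions
  over a base of the ultrafilter suffice: a ball that is centred in \<open>P\<close> and meets
  \<open>Q\<close> shows a point of \<open>P\<close> within \<open>e\<close> of \<open>Q\<close>,
  hence has a bounded centre.\<close>

lemma min_character_isolated_balls:
  assumes iso: "\<And>\<delta>. \<exists>x\<in>M. \<forall>y\<in>M. d x y \<le> \<delta> \<longrightarrow> d x y \<le> e"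
  shows "min_character (corona X) \<le>o ultrafilter_number"
proof -
  have "\<exists>x\<in>M. real n \<le> d a x \<and> (\<forall>y\<in>M. d x y \<le> real n \<longrightarrow> d x y \<le> e)" for n
  proof -
    \<comment> \<open>The assumption does not say where the isolated ball lies. If its centre were
      within \<open>n\<close> of the base point, then \<open>z\<close> would be within
      \<open>real n + d a z\<close> of the centre, hence within \<open>e\<close>, which is too close
      for \<open>z\<close>.\<close>
    obtain z where z: "z \<in> M" "real n + e < d a z" using unbounded by auto
    obtain x where x: "x \<in> M" "\<forall>y\<in>M. d x y \<le> real n + d a z \<longrightarrow> d x y \<le> e" using iso by auto
    have "real n \<le> d a x"
    proof (rule ccontr)
      assume "\<not> real n \<le> d a x"
      moreover have "d x z \<le> d a x + d a z" using triangle[OF x(1) base z(1)] by (simp add: commute)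
      ultimately have "d x z \<le> e" using x z by simp
      moreover have "d a z \<le> d a x + d x z" using triangle[OF base x(1) z(1)] .
      ultimately show False using z(2) \<open>\<not> real n \<le> d a x\<close> by linarith
    qed
    moreover have "d x y \<le> e" if "y \<in> M" "d x y \<le> real n" for y
    proof -
      have "d x y \<le> real n + d a z" using that(2) nonneg[of a z] by linarith
      then show ?thesis using x(2) that(1) by simp
    qed
    ultimately show ?thesis using x(1) by auto
  qed
  then obtain x where x: "\<And>n. x n \<in> M" "\<And>n. real n \<le> d a (x n)"
    "\<And>n y. y \<in> M \<Longrightarrow> d (x n) y \<le> real n \<Longrightarrow> d (x n) y \<le> e" by metis
  have e: "0 \<le> e" using x(3)[OF x(1)[of 0], of 0] x(1) by simp
  obtain p0 \<A> where p0: "free_ultrafilter p0" "\<A> \<subseteq> p0" "\<And>J. J \<in> p0 \<Longrightarrow> \<exists>I\<in>\<A>. finite (I - J)"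
    "|\<A>| \<le>o ultrafilter_number" using ultrafilter_number_base by auto
  have u0: "ultrafilter_on UNIV p0" using p0(1) by (simp add: free_ultrafilter_def)
  define C where "C I = {y\<in>M. \<exists>n\<in>I. d (x n) y \<le> e}" for I
  have "min_character (corona X) \<le>o |C ` \<A>|"
  proof (rule min_character_corona_le)
    show "ultra_at_infinity (ultrafilter_push UNIV M x p0)" using ultra_at_infinity_seq[OF p0(1) x(1,2)] .
  next
    fix K assume "K \<in> C ` \<A>"
    then obtain I where I: "I \<in> \<A>" "K = C I" by auto
    have "asymp_disjoint K (M - K)"
      unfolding asymp_disjoint_def
    proof
      fix r
      \<comment> \<open>Only the balls with index at most \<open>e + r\<close> can have a point
        outside \<open>K\<close> within \<open>r\<close> of them.\<close>
      let ?B = "Max (insert 0 ((\<lambda>n. d a (x n)) ` {..nat \<lceil>e + r\<rceil>}))"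
      have "d a y \<le> ?B + e" if y: "y \<in> K" "z \<in> M - K" "d y z \<le> r" for y z
      proof -
        obtain n where n: "n \<in> I" "d (x n) y \<le> e" "y \<in> M" using y(1) I(2) by (auto simp: C_def)
        have "d (x n) z \<le> e + r" using triangle[OF x(1) n(3), of z n] y n by simp
        moreover have "\<not> d (x n) z \<le> e" using y(2) n(1) I(2) by (auto simp: C_def)
        ultimately have "real n \<le> e + r" using x(3)[of z n] y(2) by fastforce
        then have "n \<le> nat \<lceil>e + r\<rceil>" by linarith
        then have "d a (x n) \<le> ?B" by (intro Max_ge) auto
        then show ?thesis using triangle[OF base x(1) n(3), of n] n(2) by linarith
      qed
      then show "\<exists>R. \<forall>y\<in>K. \<forall>z\<in>M - K. d y z \<le> r \<longrightarrow> d a y \<le> R" by blast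
    qed
    moreover have "K \<subseteq> M" using I(2) by (auto simp: C_def)
    moreover have "{n. x n \<in> K} \<in> p0"
    proof (rule ultrafilter_onD(5)[OF u0])
      show "I \<in> p0" using I(1) p0(2) by auto
      show "I \<subseteq> {n. x n \<in> K}"
      proof
        fix n assume "n \<in> I"
        moreover have "d (x n) (x n) \<le> e" using e x(1)[of n] by simp
        ultimately show "n \<in> {n. x n \<in> K}" using I(2) x(1)[of n] unfolding C_def by blast
      qed
    qed simp
    ultimately show "asymp_clopen K \<and> K \<in> ultrafilter_push UNIV M x p0"
      by (simp add: asymp_clopen_def ultrafilter_push_def)
  next
    fix P Q assume P: "P \<in> ultrafilter_push UNIV M x p0" and Q: "Q \<subseteq> M" "asymp_disjoint P Q"
    have "{n. x n \<in> P} \<in> p0" using P by (simp add: ultrafilter_push_def)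
    then obtain I where I: "I \<in> \<A>" "finite (I - {n. x n \<in> P})" using p0(3) by auto
    obtain R where R: "\<And>y z. y \<in> P \<Longrightarrow> z \<in> Q \<Longrightarrow> d y z \<le> e \<Longrightarrow> d a y \<le> R"
      using Q(2) unfolding asymp_disjoint_def by meson
    \<comment> \<open>Centres in \<open>P\<close> of balls meeting \<open>Q\<close> are bounded by
      \<open>R\<close>; only finitely many centres with index in \<open>I\<close> are not in
      \<open>P\<close>.\<close>
    let ?B = "Max (insert R ((\<lambda>n. d a (x n)) ` (I - {n. x n \<in> P})))"
    have "d a y \<le> ?B + e" if y: "y \<in> C I \<inter> Q" for y
    proof -
      obtain n where n: "n \<in> I" "d (x n) y \<le> e" "y \<in> M" using y by (auto simp: C_def)
      have "d a (x n) \<le> ?B"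
      proof (cases "x n \<in> P")
        case True
        then have "d a (x n) \<le> R" using R[of "x n" y] n(2) y by simp
        also have "R \<le> ?B" using I(2) by (intro Max_ge) auto
        finally show ?thesis .
      next
        case False
        then show ?thesis using I(2) n(1) by (intro Max_ge) auto
      qed
      then show ?thesis using triangle[OF base x(1) n(3), of n] n(2) by linarith
    qed
    then show "\<exists>K\<in>C ` \<A>. \<exists>R. \<forall>y\<in>K \<inter> Q. d a y \<le> R" using I(1) by blast
  qed
  also have "|C ` \<A>| \<le>o |\<A>|" by (rule card_of_image)
  also have "|\<A>| \<le>o ultrafilter_number" by (rule p0(4))
  finally show ?thesis .
qed

end

section \<open>The Cantor macro-cube\<close>

definition tail_eq :: "nat \<Rightarrow> (nat \<Rightarrow> nat) \<Rightarrow> (nat \<Rightarrow> nat) \<Rightarrow> bool" where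
  "tail_eq k x y \<longleftrightarrow> (\<forall>m\<ge>k. x m = y m)"

text \<open>Integer stand-in for the distance from the origin: \<open>2 ^ level x\<close> is that
  distance for every nonzero \<open>x\<close>.\<close>

definition level :: "(nat \<Rightarrow> nat) \<Rightarrow> nat" where
  "level x = (LEAST n. tail_eq n x (\<lambda>_. 0))"

lemma tail_eq_refl [simp]: "tail_eq k x x"
  and tail_eq_sym: "tail_eq k x y \<longleftrightarrow> tail_eq k y x"
  and tail_eq_trans: "tail_eq k x y \<Longrightarrow> tail_eq k y z \<Longrightarrow> tail_eq k x z"
  and tail_eq_mono: "tail_eq k x y \<Longrightarrow> k \<le> l \<Longrightarrow> tail_eq l x y"
  by (auto simp: tail_eq_def)

lemma zero_macro_cube: "(\<lambda>_. 0) \<in> macro_cube_carrier"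
  by (auto simp: macro_cube_carrier_def)

text \<open>A difference in coordinate \<open>n\<close> weighs \<open>2 ^ (n + 1)\<close>, which is
  at most \<open>2 ^ k\<close> exactly for \<open>n < k\<close>.\<close>

lemma macro_cube_dist_le_power_iff:
  assumes "x \<in> macro_cube_carrier" "y \<in> macro_cube_carrier"
  shows "macro_cube_dist x y \<le> 2 ^ k \<longleftrightarrow> tail_eq k x y"
proof -
  have "2 ^ (n + 1) * \<bar>real (x n) - real (y n)\<bar> \<le> 2 ^ k \<longleftrightarrow> n < k \<or> x n = y n" for n
  proof (cases "x n = y n")
    case False
    have "x n \<in> {0, 1}" "y n \<in> {0, 1}" using assms by (auto simp: macro_cube_carrier_def)
    then have "\<bar>real (x n) - real (y n)\<bar> = 1" using False by auto
    moreover have "(2::real) ^ (n + 1) \<le> 2 ^ k \<longleftrightarrow> n + 1 \<le> k" by (rule power_increasing_iff) simp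
    ultimately show ?thesis using False by auto
  qed simp
  then show ?thesis unfolding macro_cube_dist_le_iff[OF assms] tail_eq_def by (meson not_le)
qed

lemma level_le_iff:
  assumes "x \<in> macro_cube_carrier"
  shows "level x \<le> k \<longleftrightarrow> tail_eq k x (\<lambda>_. 0)"
proof
  have "\<exists>n. tail_eq n x (\<lambda>_. 0)" using assms by (auto simp: macro_cube_carrier_def tail_eq_def)
  then have "tail_eq (level x) x (\<lambda>_. 0)" unfolding level_def by (rule LeastI_ex)
  then show "level x \<le> k \<Longrightarrow> tail_eq k x (\<lambda>_. 0)" by (rule tail_eq_mono)
  show "tail_eq k x (\<lambda>_. 0) \<Longrightarrow> level x \<le> k" unfolding level_def by (rule Least_le)
qed

lemma level_le_dist_iff:
  assumes "x \<in> macro_cube_carrier"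
  shows "macro_cube_dist (\<lambda>_. 0) x \<le> 2 ^ k \<longleftrightarrow> level x \<le> k"
  using macro_cube_dist_le_power_iff[OF zero_macro_cube assms] level_le_iff[OF assms] tail_eq_sym by simp

text \<open>The ultrametric isosceles property: the last nonzero coordinate has index
  \<open>level x - 1\<close>, which the change below \<open>k\<close> does not reach.\<close>

lemma level_eqI:
  assumes "x \<in> macro_cube_carrier" "y \<in> macro_cube_carrier" "tail_eq k x y" "k < level x"
  shows "level y = level x"
proof -
  have iff: "level y \<le> j \<longleftrightarrow> level x \<le> j" if "k \<le> j" for j
    using assms(3) tail_eq_mono[OF _ that] tail_eq_sym tail_eq_trans
    unfolding level_le_iff[OF assms(1)] level_le_iff[OF assms(2)] by metis
  have "level y \<le> level x" using iff[of "level x"] assms(4) by simp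
  moreover have "k \<le> level y" using iff[of k] assms(4) by simp
  then have "level x \<le> level y" using iff[of "level y"] by simp
  ultimately show ?thesis by simp
qed

definition unit_point :: "nat \<Rightarrow> nat \<Rightarrow> nat" where
  "unit_point n i = (if i = n then 1 else 0)"

lemma unit_point_in: "unit_point n \<in> macro_cube_carrier"
  by (auto simp: macro_cube_carrier_def unit_point_def intro!: exI[of _ "Suc n"])

lemma level_unit_point: "level (unit_point n) = Suc n"
proof -
  have "level (unit_point n) \<le> Suc n" "\<not> level (unit_point n) \<le> n"
    unfolding level_le_iff[OF unit_point_in] by (auto simp: tail_eq_def unit_point_def)
  then show ?thesis by simp
qed

lemma real_le_two_power: "\<exists>k. r \<le> 2 ^ k" for r :: real
  using real_arch_pow[of 2 r] by (auto intro: less_imp_le)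

interpretation macro_cube: unbounded_space cantor_macro_cube "\<lambda>_. 0"
proof
  show "(\<lambda>_. 0) \<in> mspace cantor_macro_cube" using zero_macro_cube by simp
  fix r :: real
  obtain k where "r \<le> 2 ^ k" using real_le_two_power by auto
  moreover have "\<not> macro_cube_dist (\<lambda>_. 0) (unit_point k) \<le> 2 ^ k"
    unfolding level_le_dist_iff[OF unit_point_in] level_unit_point by simp
  ultimately show "\<exists>x\<in>mspace cantor_macro_cube. r < mdist cantor_macro_cube (\<lambda>_. 0) x"
    using unit_point_in by (intro bexI[of _ "unit_point k"]) auto
qed

lemma macro_cube_bounded_iff:
  assumes "A \<subseteq> macro_cube_carrier"
  shows "(\<exists>R. \<forall>x\<in>A. macro_cube_dist (\<lambda>_. 0) x \<le> R) \<longleftrightarrow> (\<exists>K. \<forall>x\<in>A. level x \<le> K)"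
proof
  assume "\<exists>R. \<forall>x\<in>A. macro_cube_dist (\<lambda>_. 0) x \<le> R"
  then obtain R where R: "\<forall>x\<in>A. macro_cube_dist (\<lambda>_. 0) x \<le> R" by auto
  obtain k where "R \<le> 2 ^ k" using real_le_two_power by auto
  then have "\<forall>x\<in>A. macro_cube_dist (\<lambda>_. 0) x \<le> 2 ^ k" using R by force
  then show "\<exists>K. \<forall>x\<in>A. level x \<le> K" using level_le_dist_iff assms by blast
next
  assume "\<exists>K. \<forall>x\<in>A. level x \<le> K"
  then obtain K where "\<forall>x\<in>A. level x \<le> K" by auto
  then have "\<forall>x\<in>A. macro_cube_dist (\<lambda>_. 0) x \<le> 2 ^ K" using level_le_dist_iff assms by blast
  then show "\<exists>R. \<forall>x\<in>A. macro_cube_dist (\<lambda>_. 0) x \<le> R" by blast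
qed

lemma macro_cube_asymp_disjoint_iff:
  assumes "P \<subseteq> macro_cube_carrier" "Q \<subseteq> macro_cube_carrier"
  shows "macro_cube.asymp_disjoint P Q \<longleftrightarrow> (\<forall>k. \<exists>K. \<forall>x\<in>P. \<forall>y\<in>Q. tail_eq k x y \<longrightarrow> level x \<le> K)"
proof -
  have dist: "tail_eq k x y \<longleftrightarrow> macro_cube_dist x y \<le> 2 ^ k" if "x \<in> P" "y \<in> Q" for k x y
    using macro_cube_dist_le_power_iff[of x y k] that assms by auto
  have lev: "level x \<le> K \<longleftrightarrow> macro_cube_dist (\<lambda>_. 0) x \<le> 2 ^ K" if "x \<in> P" for x K
    using level_le_dist_iff[of x K] that assms by auto
  show ?thesis
    unfolding macro_cube.asymp_disjoint_def mdist_cantor_macro_cube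
  proof (intro iffI allI)
    fix k assume "\<forall>r. \<exists>R. \<forall>x\<in>P. \<forall>y\<in>Q. macro_cube_dist x y \<le> r \<longrightarrow> macro_cube_dist (\<lambda>_. 0) x \<le> R"
    then obtain R where R: "\<And>x y. x \<in> P \<Longrightarrow> y \<in> Q \<Longrightarrow> macro_cube_dist x y \<le> 2 ^ k \<Longrightarrow> macro_cube_dist (\<lambda>_. 0) x \<le> R"
      by meson
    obtain K where K: "R \<le> 2 ^ K" using real_le_two_power by auto
    have "level x \<le> K" if "x \<in> P" "y \<in> Q" "tail_eq k x y" for x y
      using R[OF that(1,2)] that(3) K unfolding dist[OF that(1,2)] lev[OF that(1)] by linarith
    then show "\<exists>K. \<forall>x\<in>P. \<forall>y\<in>Q. tail_eq k x y \<longrightarrow> level x \<le> K" by blast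
  next
    fix r :: real assume K: "\<forall>k. \<exists>K. \<forall>x\<in>P. \<forall>y\<in>Q. tail_eq k x y \<longrightarrow> level x \<le> K"
    obtain k where k: "r \<le> 2 ^ k" using real_le_two_power by auto
    obtain K where "\<And>x y. x \<in> P \<Longrightarrow> y \<in> Q \<Longrightarrow> tail_eq k x y \<Longrightarrow> level x \<le> K" using K by meson
    moreover have "tail_eq k x y" if "x \<in> P" "y \<in> Q" "macro_cube_dist x y \<le> r" for x y
      using that(3) k unfolding dist[OF that(1,2)] by linarith
    ultimately have "macro_cube_dist (\<lambda>_. 0) x \<le> 2 ^ K" if "x \<in> P" "y \<in> Q" "macro_cube_dist x y \<le> r" for x y
      using that lev[OF that(1)] by metis
    then show "\<exists>R. \<forall>x\<in>P. \<forall>y\<in>Q. macro_cube_dist x y \<le> r \<longrightarrow> macro_cube_dist (\<lambda>_. 0) x \<le> R" by blast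
  qed
qed

lemma macro_cube_asymp_clopenI:
  assumes "A \<subseteq> macro_cube_carrier"
    and "\<And>k. \<exists>K. \<forall>x\<in>A. \<forall>y\<in>macro_cube_carrier. tail_eq k x y \<and> K < level x \<longrightarrow> y \<in> A"
  shows "macro_cube.asymp_clopen A"
  unfolding macro_cube.asymp_clopen_def mspace_cantor_macro_cube
proof (intro conjI, rule assms(1))
  have "\<exists>K. \<forall>x\<in>A. \<forall>y\<in>macro_cube_carrier - A. tail_eq k x y \<longrightarrow> level x \<le> K" for k
    using assms(2)[of k] by (meson DiffD1 DiffD2 not_le)
  then show "macro_cube.asymp_disjoint A (macro_cube_carrier - A)"
    using macro_cube_asymp_disjoint_iff[of A "macro_cube_carrier - A"] assms(1) by auto
qed

text \<open>The separating set \<open>A\<close> consists of the points having a tail class that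
  meets \<open>P\<close> and misses \<open>Q\<close>. It is disjoint from \<open>Q\<close>, and a
  point of \<open>P\<close> outside \<open>A\<close> already lies in \<open>Q\<close>, hence is
  bounded.\<close>

lemma covering_dim_le_macro_cube: "covering_dim_le (corona cantor_macro_cube) 0"
proof (rule macro_cube.covering_dim_le_corona)
  fix P Q assume "P \<subseteq> macro_cube.M" "Q \<subseteq> macro_cube.M" and PQ: "macro_cube.asymp_disjoint P Q"
  then have sub: "P \<subseteq> macro_cube_carrier" "Q \<subseteq> macro_cube_carrier" by auto
  define A where "A = {x\<in>macro_cube_carrier. \<exists>k. (\<exists>y\<in>P. tail_eq k x y) \<and> (\<forall>z\<in>Q. \<not> tail_eq k x z)}"
  have near: "\<exists>K. \<forall>y\<in>P. \<forall>z\<in>Q. tail_eq k y z \<longrightarrow> level y \<le> K" for k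
    using PQ macro_cube_asymp_disjoint_iff[OF sub] by auto
  have "macro_cube.asymp_clopen A"
  proof (rule macro_cube_asymp_clopenI)
    fix k
    obtain K where K: "\<And>y z. y \<in> P \<Longrightarrow> z \<in> Q \<Longrightarrow> tail_eq k y z \<Longrightarrow> level y \<le> K" using near by meson
    have "w \<in> A" if x: "x \<in> A" "w \<in> macro_cube_carrier" "tail_eq k x w" "max K k < level x" for x w
    proof -
      obtain k' y where y: "y \<in> P" "tail_eq k' x y" "\<And>z. z \<in> Q \<Longrightarrow> \<not> tail_eq k' x z"
        using x(1) by (auto simp: A_def)
      have xM: "x \<in> macro_cube_carrier" "y \<in> macro_cube_carrier" using x(1) y(1) sub by (auto simp: A_def)
      show ?thesis
      proof (cases "k \<le> k'")
        case True
        then have "tail_eq k' x w" using x(3) tail_eq_mono by blast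
        then have "tail_eq k' w y" "\<And>z. z \<in> Q \<Longrightarrow> \<not> tail_eq k' w z"
          using y tail_eq_trans tail_eq_sym by blast+
        then show ?thesis using x(2) y(1) by (auto simp: A_def)
      next
        case False
        \<comment> \<open>The class witnessing \<open>x \<in> A\<close> may be too small to contain
          \<open>w\<close>. The larger class for \<open>k\<close> still misses \<open>Q\<close>
          beyond level \<open>K\<close>, because a point of \<open>Q\<close> in it would be close to
          \<open>y \<in> P\<close>.\<close>
        then have xy: "tail_eq k x y" using y(2) tail_eq_mono by fastforce
        have "\<not> tail_eq k w z" if "z \<in> Q" for z
        proof
          assume "tail_eq k w z"
          then have "tail_eq k y z" using xy x(3) tail_eq_trans tail_eq_sym by blast
          then have "level y \<le> K" using K y(1) that by blast
          moreover have "level y = level x" using level_eqI[OF xM xy] x(4) by simp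
          ultimately show False using x(4) by simp
        qed
        moreover have "tail_eq k w y" using xy x(3) tail_eq_trans tail_eq_sym by blast
        ultimately show ?thesis using x(2) y(1) by (auto simp: A_def)
      qed
    qed
    then show "\<exists>K. \<forall>x\<in>A. \<forall>y\<in>macro_cube_carrier. tail_eq k x y \<and> K < level x \<longrightarrow> y \<in> A" by blast
  qed (auto simp: A_def)
  moreover have "A \<inter> Q = {}" by (auto simp: A_def)
  moreover have "\<exists>R. \<forall>x\<in>P - A. macro_cube_dist (\<lambda>_. 0) x \<le> R"
  proof -
    obtain K where K: "\<And>y z. y \<in> P \<Longrightarrow> z \<in> Q \<Longrightarrow> tail_eq 0 y z \<Longrightarrow> level y \<le> K" using near by meson
    have "level x \<le> K" if x: "x \<in> P - A" for x
    proof -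
      have "\<exists>z\<in>Q. tail_eq 0 x z" using x sub(1) tail_eq_refl unfolding A_def by blast
      then show ?thesis using K x by blast
    qed
    then show ?thesis using macro_cube_bounded_iff[of "P - A"] sub(1) by blast
  qed
  ultimately show "\<exists>A R. macro_cube.asymp_clopen A \<and>
      (\<forall>x\<in>P - A. mdist cantor_macro_cube (\<lambda>_. 0) x \<le> R) \<and> A \<inter> Q = {}"
    by auto
qed

section \<open>The minimal character of the corona of the macro-cube\<close>

lemma downward_closed_nat:
  fixes S :: "nat set"
  assumes "finite S" "\<And>j k. k \<in> S \<Longrightarrow> j \<le> k \<Longrightarrow> j \<in> S"
  shows "k < card S \<longleftrightarrow> k \<in> S"
proof (cases "S = {}")
  case False
  have "S = {..Max S}"
  proof (intro equalityI subsetI)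
    show "x \<in> {..Max S}" if "x \<in> S" for x using that assms(1) by simp
    show "x \<in> S" if "x \<in> {..Max S}" for x using assms(2)[OF Max_in[OF assms(1) False]] that by simp
  qed
  then have "card S = Suc (Max S)" by (metis card_atMost)
  then show ?thesis using \<open>S = {..Max S}\<close> by (metis atMost_iff less_Suc_eq_le)
qed simp

lemma dominating_number_min:
  fixes D :: "(nat \<Rightarrow> nat) set"
  shows "\<exists>D. (\<forall>f. \<exists>g\<in>D. \<forall>n. f n \<le> g n) \<and> dominating_number = |D|"
    and "(\<forall>f. \<exists>g\<in>D. \<forall>n. f n \<le> g n) \<Longrightarrow> dominating_number \<le>o |D|"
proof -
  let ?K = "card_of ` {D :: (nat \<Rightarrow> nat) set. \<forall>f. \<exists>g\<in>D. \<forall>n. f n \<le> g n}"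
  have "\<forall>f :: nat \<Rightarrow> nat. \<exists>g\<in>UNIV. \<forall>n. f n \<le> g n" by auto
  then have "?K \<noteq> {}" by auto
  then have K: "?K \<noteq> {}" "\<forall>r\<in>?K. Card_order r" by (auto simp: card_of_Card_order)
  show "\<exists>D. (\<forall>f. \<exists>g\<in>D. \<forall>n. f n \<le> g n) \<and> dominating_number = |D|"
    using min_cardinal(1)[OF K] unfolding dominating_number_def by auto
  show "dominating_number \<le>o |D|" if "\<forall>f. \<exists>g\<in>D. \<forall>n. f n \<le> g n"
    using min_cardinal(2)[OF K] that unfolding dominating_number_def by auto
qed

lemma card_of_Times_le_infinite:
  assumes "infinite C" "|A| \<le>o |C|" "|B| \<le>o |C|"
  shows "|A \<times> B| \<le>o |C|"
  using card_of_Times_ordLeq_infinite_Field[OF _ assms(2,3) card_of_Card_order] assms(1)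
  by (simp add: Field_card_of)

text \<open>Diagonalisation against an enumeration. It guarantees that the index sets below are
  infinite and thus absorb countable factors.\<close>

lemma dominating_uncountable:
  assumes "\<forall>f. \<exists>g\<in>D. \<forall>n::nat. f n \<le> (g n :: nat)"
  shows "uncountable D"
proof
  assume "countable D"
  have ne: "D \<noteq> {}" using assms by auto
  define f where "f n = Suc (from_nat_into D n n)" for n
  obtain g where g: "g \<in> D" "\<And>n. f n \<le> g n" using assms by meson
  obtain n where "from_nat_into D n = g" using from_nat_into_surj[OF \<open>countable D\<close> g(1)] by auto
  then show False using g(2)[of n] by (simp add: f_def)
qed

text \<open>
  For a slow function \<open>s\<close>, the sets of points whose coordinate number \<open>s (level x)\<close> is \<open>0\<close>, or \<open>1\<close>, are
  asymptotically clopen. Flipping that coordinate leads out of the set, so a neighbourhood contained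
  in it cannot grow faster than \<open>s\<close>.
\<close>

lemma macro_cube_nbhd_base_ge:
  assumes t: "t \<in> topspace (corona cantor_macro_cube)" and B: "nbhd_base (corona cantor_macro_cube) t \<B>"
  shows "dominating_number \<le>o |\<B>|"
proof -
  let ?M = macro_cube_carrier
  let ?c = "\<lambda>p. macro_cube.corona_rel `` {p}"
  obtain p where p: "macro_cube.ultra_at_infinity p" "t = ?c p"
    using t unfolding macro_cube.topspace_corona by auto
  have u: "ultrafilter_on ?M p" using macro_cube.ultra_at_infinityD(1)[OF p(1)] by simp
  have "\<exists>P Q. P \<in> p \<and> Q \<subseteq> ?M \<and> macro_cube.asymp_disjoint P Q \<and>
      (\<forall>q. macro_cube.ultra_at_infinity q \<and> Q \<notin> q \<longrightarrow> ?c q \<in> N)" if N: "N \<in> \<B>" for N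
  proof -
    obtain U where U: "openin (corona cantor_macro_cube) U" "t \<in> U" "U \<subseteq> N" using B N unfolding nbhd_base_def by auto
    have "\<exists>P\<in>p. \<exists>Q\<subseteq>?M. macro_cube.asymp_disjoint P Q \<and> (\<forall>q. macro_cube.ultra_at_infinity q \<and> Q \<notin> q \<longrightarrow> ?c q \<in> U)"
      using macro_cube.openin_corona_basis[OF U(1) p(1)] U(2) p(2) by simp
    then show ?thesis using U(3) by (meson subsetD)
  qed
  then obtain P Q where P: "\<And>N. N \<in> \<B> \<Longrightarrow> P N \<in> p" and Q: "\<And>N. N \<in> \<B> \<Longrightarrow> Q N \<subseteq> ?M"
    and PQ: "\<And>N. N \<in> \<B> \<Longrightarrow> macro_cube.asymp_disjoint (P N) (Q N)"
    and sub: "\<And>N q. N \<in> \<B> \<Longrightarrow> macro_cube.ultra_at_infinity q \<Longrightarrow> Q N \<notin> q \<Longrightarrow> ?c q \<in> N"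
    by metis
  have PM: "P N \<subseteq> ?M" if "N \<in> \<B>" for N using ultrafilter_onD(1)[OF u P[OF that]] .
  \<comment> \<open>\<open>g N\<close> measures how fast the neighbourhood \<open>N\<close> closes
    up: beyond level \<open>g N k\<close>, points of \<open>P N\<close> have no point of
    \<open>Q N\<close> in their tail class for \<open>k\<close>.\<close>
  define g where "g N k = (SOME K. \<forall>x\<in>P N. \<forall>y\<in>Q N. tail_eq k x y \<longrightarrow> level x \<le> K)" for N k
  have g: "level x \<le> g N k" if N: "N \<in> \<B>" and xy: "x \<in> P N" "y \<in> Q N" "tail_eq k x y" for N k x y
  proof -
    have ex: "\<exists>K. \<forall>x\<in>P N. \<forall>y\<in>Q N. tail_eq k x y \<longrightarrow> level x \<le> K"
      using PQ[OF N] unfolding macro_cube_asymp_disjoint_iff[OF PM[OF N] Q[OF N]] by (rule spec)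
    show ?thesis using someI_ex[OF ex, folded g_def, rule_format, OF xy] .
  qed
  \<comment> \<open>\<open>P N\<close> belongs to \<open>p\<close>, so it contains points of
    arbitrarily high level.\<close>
  have hex: "\<exists>n. g N (Suc i) < n \<and> i < n \<and> (\<exists>x\<in>P N. level x = n)" if N: "N \<in> \<B>" for N i
  proof (rule ccontr)
    assume no: "\<not> ?thesis"
    have "level x \<le> max (g N (Suc i)) i" if "x \<in> P N" for x
    proof (rule ccontr)
      assume "\<not> ?thesis"
      then have "g N (Suc i) < level x" "i < level x" by auto
      then show False using no that by metis
    qed
    then have "\<exists>R. \<forall>x\<in>P N. macro_cube_dist (\<lambda>_. 0) x \<le> R"
      unfolding macro_cube_bounded_iff[OF PM[OF N]] by (intro exI ballI)
    then obtain R where "\<And>x. x \<in> P N \<Longrightarrow> macro_cube_dist (\<lambda>_. 0) x \<le> R" by blast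
    then show False using macro_cube.ultra_at_infinity_bounded[OF p(1), of "P N" R] P[OF N] by simp
  qed
  define h where "h N i = (SOME n. g N (Suc i) < n \<and> i < n \<and> (\<exists>x\<in>P N. level x = n))" for N i
  have h: "g N (Suc i) < h N i" "i < h N i" "\<exists>x\<in>P N. level x = h N i" if "N \<in> \<B>" for N i
    using someI_ex[OF hex[OF that, of i]] unfolding h_def by simp_all
  \<comment> \<open>The constants \<open>m\<close> make up for the finitely many arguments at which
    \<open>h N\<close> may fail to dominate.\<close>
  let ?D = "(\<lambda>(N, m) i. h N i + m) ` (\<B> \<times> (UNIV :: nat set))"
  have dom: "\<forall>f. \<exists>g\<in>?D. \<forall>n. f n \<le> g n"
  proof
    fix f :: "nat \<Rightarrow> nat"
    \<comment> \<open>The set is an initial segment, so its cardinality \<open>s n\<close> is a slow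
      inverse of \<open>f\<close>: an index \<open>k\<close> is below \<open>s n\<close> iff it
      belongs to \<open>S n\<close>.\<close>
    define S where "S n = {k. k + 2 < n \<and> (\<forall>i\<le>k. f i \<le> n)}" for n
    define s where "s n = card (S n)" for n
    have s: "k < s n \<longleftrightarrow> k + 2 < n \<and> (\<forall>i\<le>k. f i \<le> n)" for k n
    proof -
      have "S n \<subseteq> {..<n}" by (auto simp: S_def)
      then have "finite (S n)" using finite_subset by blast
      then show ?thesis using downward_closed_nat[of "S n" k] by (auto simp: s_def S_def)
    qed
    \<comment> \<open>At level \<open>n\<close> the last nonzero coordinate has index
      \<open>n - 1\<close>. The summand 2 in \<open>S\<close> keeps the coordinate
      \<open>s n\<close> below it, so flipping that coordinate preserves the level.\<close>
    have s_less: "s n + 1 < n" if "2 < n" for n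
      using s[of "s n - 1" n] that by (cases "s n") auto
    define A1 where "A1 = {x\<in>?M. x (s (level x)) = 1}"
    have "macro_cube.asymp_clopen A1"
    proof (rule macro_cube_asymp_clopenI)
      fix k
      have "y \<in> A1" if x: "x \<in> A1" "y \<in> ?M" "tail_eq k x y" "k + 2 + (\<Sum>i\<le>k. f i) < level x" for x y
      proof -
        have "level y = level x" using level_eqI[of x y k] x by (auto simp: A1_def)
        moreover have "f i \<le> level x" if "i \<le> k" for i
        proof -
          have "f i \<le> (\<Sum>i\<le>k. f i)" using that by (intro member_le_sum) auto
          then show ?thesis using x(4) by simp
        qed
        then have "k < s (level x)" unfolding s using x(4) by simp
        then have "x (s (level x)) = y (s (level x))" using x(3) by (simp add: tail_eq_def)
        ultimately show ?thesis using x(1,2) by (simp add: A1_def)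
      qed
      then show "\<exists>K. \<forall>x\<in>A1. \<forall>y\<in>?M. tail_eq k x y \<and> K < level x \<longrightarrow> y \<in> A1" by blast
    qed (auto simp: A1_def)
    then have clo: "macro_cube.asymp_clopen A1" "macro_cube.asymp_clopen (?M - A1)"
      using macro_cube.asymp_clopen_compl[of A1] by auto
    have A1M: "A1 \<subseteq> ?M" by (auto simp: A1_def)
    obtain A where A: "macro_cube.asymp_clopen A" "A \<in> p" "A = A1 \<or> A = ?M - A1"
      using clo ultrafilter_on_compl[OF u A1M] by blast
    have AM: "A \<subseteq> ?M" using A(3) A1M by auto
    obtain N where N: "N \<in> \<B>" "N \<subseteq> macro_cube.clopen_class A"
      using B macro_cube.openin_clopen_class[OF A(1)] macro_cube.in_clopen_class_iff[OF A(1) p(1)] A(2) p(2)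
      unfolding nbhd_base_def by auto
    \<comment> \<open>An ultrafilter at infinity omitting \<open>Q N\<close> has its class in
      \<open>N\<close>, hence contains \<open>A\<close>; so beyond some level everything outside
      \<open>Q N\<close> lies in \<open>A\<close>.\<close>
    have "\<exists>R. \<forall>x\<in>?M - Q N - A. macro_cube_dist (\<lambda>_. 0) x \<le> R"
    proof -
      have "?M - Q N - A \<notin> q" if q: "macro_cube.ultra_at_infinity q" for q
      proof
        assume in_q: "?M - Q N - A \<in> q"
        have uq: "ultrafilter_on ?M q" using macro_cube.ultra_at_infinityD(1)[OF q] by simp
        have "?M - Q N \<in> q" "?M - A \<in> q" by (rule ultrafilter_onD(5)[OF uq in_q]; auto)+
        then have "Q N \<notin> q" "A \<notin> q" using ultrafilter_on_compl[OF uq] Q[OF N(1)] AM by auto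
        then show False using sub[OF N(1) q] N(2) macro_cube.in_clopen_class_iff[OF A(1) q] by auto
      qed
      then show ?thesis using macro_cube.bounded_if_no_ultra[of "?M - Q N - A"] by auto
    qed
    then obtain K0 where K0: "\<And>x. x \<in> ?M \<Longrightarrow> x \<notin> Q N \<Longrightarrow> x \<notin> A \<Longrightarrow> level x \<le> K0"
      using macro_cube_bounded_iff[of "?M - Q N - A"] by auto
    define K1 where "K1 = K0 + 2 + g N 0"
    \<comment> \<open>A point of \<open>P N\<close> at level \<open>h N i\<close> lies in
      \<open>A\<close>. Flipping its coordinate \<open>s ?n\<close> leads out of \<open>A\<close> at
      the same level, hence into \<open>Q N\<close>. If \<open>s ?n \<le> i\<close>, the two points
      would share a tail class for \<open>Suc i\<close> beyond level \<open>g N (Suc i)\<close>. So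
      \<open>i < s ?n\<close>, which includes the claim.\<close>
    have big: "f i \<le> h N i" if i: "K1 \<le> i" for i
    proof -
      let ?n = "h N i"
      obtain x where x: "x \<in> P N" "level x = ?n" using h(3)[OF N(1)] by auto
      have xM: "x \<in> ?M" using PM[OF N(1)] x(1) by auto
      have n: "K0 < ?n" "2 < ?n" "g N 0 < ?n" using h(2)[OF N(1), of i] i by (auto simp: K1_def)
      have "x \<notin> Q N" using g[OF N(1) x(1), of x 0] n(3) x(2) by auto
      then have "x \<in> A" using K0[OF xM] n(1) x(2) by fastforce
      define y where "y = x(s ?n := 1 - x (s ?n))"
      have xy: "tail_eq (Suc (s ?n)) x y" by (auto simp: tail_eq_def y_def)
      have yM: "y \<in> ?M"
      proof -
        obtain l where "\<forall>m\<ge>l. x m = 0" using xM by (auto simp: macro_cube_carrier_def)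
        then have "\<forall>m\<ge>l + Suc (s ?n). y m = 0" by (auto simp: y_def)
        moreover have "y m \<in> {0, 1}" for m using xM by (auto simp: macro_cube_carrier_def y_def)
        ultimately show ?thesis by (auto simp: macro_cube_carrier_def)
      qed
      have ly: "level y = ?n" using level_eqI[OF xM yM xy] s_less[OF n(2)] x(2) by simp
      have "x (s ?n) \<in> {0, 1}" using xM by (auto simp: macro_cube_carrier_def)
      then have "x \<in> A1 \<longleftrightarrow> y \<notin> A1" using xM yM ly x(2) by (auto simp: A1_def y_def)
      then have "y \<notin> A" using A(3) \<open>x \<in> A\<close> xM yM by auto
      then have "y \<in> Q N" using K0[OF yM] ly n(1) by fastforce
      have "\<not> Suc (s ?n) \<le> Suc i"
      proof
        assume "Suc (s ?n) \<le> Suc i"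
        then have "tail_eq (Suc i) x y" using xy tail_eq_mono by blast
        then have "level x \<le> g N (Suc i)" using g[OF N(1) x(1) \<open>y \<in> Q N\<close>] by simp
        then show False using h(1)[OF N(1), of i] x(2) by simp
      qed
      then have "i < s ?n" by simp
      then show ?thesis unfolding s by simp
    qed
    have le: "f i \<le> h N i + (\<Sum>j<K1. f j)" for i
    proof (cases "i < K1")
      case True
      then have "f i \<le> (\<Sum>j<K1. f j)" by (intro member_le_sum) auto
      then show ?thesis by simp
    next
      case False
      then show ?thesis using big[of i] by simp
    qed
    have "(\<lambda>i. h N i + (\<Sum>j<K1. f j)) \<in> ?D"
      using N(1) by (intro image_eqI[of _ _ "(N, \<Sum>j<K1. f j)"]) auto
    then show "\<exists>g\<in>?D. \<forall>n. f n \<le> g n" by (rule bexI[rotated]) (intro allI le)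
  qed
  have "infinite \<B>"
  proof
    assume "finite \<B>"
    then have "countable ?D" by (intro countable_image countable_SIGMA) (auto intro: countable_finite)
    then show False using dominating_uncountable[OF dom] by simp
  qed
  have "dominating_number \<le>o |?D|" by (rule dominating_number_min(2)[OF dom])
  also have "|?D| \<le>o |\<B> \<times> (UNIV :: nat set)|" by (rule card_of_image)
  also have "|\<B> \<times> (UNIV :: nat set)| \<le>o |\<B>|"
    using \<open>infinite \<B>\<close> infinite_iff_card_of_nat[of \<B>]
    by (intro card_of_Times_le_infinite) (simp_all add: card_of_mono1)
  finally show ?thesis .
qed

text \<open>The point is the image, under the unit points, of an ultrafilter with a small base. Its
  basic neighbourhoods have two parameters: an index set from that base, and a function from a
  dominating family, which governs how slowly the tail classes around the unit points grow.\<close>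

lemma macro_cube_min_character_le:
  assumes "ultrafilter_number \<le>o dominating_number"
  shows "min_character (corona cantor_macro_cube) \<le>o dominating_number"
proof -
  let ?M = macro_cube_carrier
  obtain D where D: "\<And>f. \<exists>g\<in>D. \<forall>n. f n \<le> g n" "dominating_number = |D|" using dominating_number_min(1) by auto
  obtain p0 \<A> where p0: "free_ultrafilter p0" "\<A> \<subseteq> p0" "\<And>J. J \<in> p0 \<Longrightarrow> \<exists>I\<in>\<A>. finite (I - J)"
    "|\<A>| \<le>o ultrafilter_number" using ultrafilter_number_base by auto
  have u0: "ultrafilter_on UNIV p0" using p0(1) by (simp add: free_ultrafilter_def)
  \<comment> \<open>Again a slow inverse. The bound \<open>k < n\<close> keeps the class around
    \<open>unit_point n\<close> among the points of level \<open>Suc n\<close>.\<close>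
  define s where "s g n = card {k. k < n \<and> (\<forall>i\<le>k. g i \<le> n)}" for g :: "nat \<Rightarrow> nat" and n
  have s: "k < s g n \<longleftrightarrow> k < n \<and> (\<forall>i\<le>k. g i \<le> n)" for k g n
    using downward_closed_nat[of "{k. k < n \<and> (\<forall>i\<le>k. g i \<le> n)}" k] by (auto simp: s_def)
  define C where "C = (\<lambda>(I, g). {y\<in>?M. \<exists>n\<in>I. tail_eq (s g n) (unit_point n) y})"
  have s_le: "s g n \<le> n" for g n using s[of n g n] by simp
  have C_level: "level y = Suc n" if "y \<in> ?M" "tail_eq (s g n) (unit_point n) y" for y g n
    using level_eqI[OF unit_point_in that(1), of "s g n" n] that(2) s_le[of g n] by (simp add: level_unit_point)
  have "min_character (corona cantor_macro_cube) \<le>o |C ` (\<A> \<times> D)|"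
  proof (rule macro_cube.min_character_corona_le)
    show "macro_cube.ultra_at_infinity (ultrafilter_push UNIV macro_cube.M unit_point p0)"
    proof (rule macro_cube.ultra_at_infinity_seq[OF p0(1)])
      show "unit_point n \<in> macro_cube.M" for n using unit_point_in by simp
      show "real n \<le> mdist cantor_macro_cube (\<lambda>_. 0) (unit_point n)" for n
      proof -
        have "\<not> macro_cube_dist (\<lambda>_. 0) (unit_point n) \<le> 2 ^ n"
          unfolding level_le_dist_iff[OF unit_point_in] level_unit_point by simp
        moreover have "real n < 2 ^ n" by (rule of_nat_less_two_power)
        ultimately show ?thesis unfolding mdist_cantor_macro_cube by linarith
      qed
    qed
  next
    fix K assume "K \<in> C ` (\<A> \<times> D)"
    then obtain I g where I: "I \<in> \<A>" "K = {y\<in>?M. \<exists>n\<in>I. tail_eq (s g n) (unit_point n) y}" by (auto simp: C_def)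
    have "macro_cube.asymp_clopen K"
    proof (rule macro_cube_asymp_clopenI)
      fix k
      have "z \<in> K" if y: "y \<in> K" "z \<in> ?M" "tail_eq k y z" "Suc k + (\<Sum>i\<le>k. g i) < level y" for y z
      proof -
        obtain n where n: "n \<in> I" "y \<in> ?M" "tail_eq (s g n) (unit_point n) y" using y(1) I(2) by auto
        have "level y = Suc n" using C_level[OF n(2,3)] .
        then have n': "k + (\<Sum>i\<le>k. g i) < n" using y(4) by simp
        have "g i \<le> n" if "i \<le> k" for i
        proof -
          have "g i \<le> (\<Sum>i\<le>k. g i)" using that by (intro member_le_sum) auto
          then show ?thesis using n' by simp
        qed
        then have "k < s g n" unfolding s using n' by simp
        then have "tail_eq (s g n) y z" using y(3) tail_eq_mono by (meson less_imp_le)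
        then show ?thesis using n tail_eq_trans y(2) I(2) by blast
      qed
      then show "\<exists>K'. \<forall>x\<in>K. \<forall>y\<in>?M. tail_eq k x y \<and> K' < level x \<longrightarrow> y \<in> K" by blast
    qed (auto simp: I(2))
    moreover have "{n. unit_point n \<in> K} \<in> p0"
    proof (rule ultrafilter_onD(5)[OF u0])
      show "I \<in> p0" using I(1) p0(2) by auto
      show "I \<subseteq> {n. unit_point n \<in> K}" using I(2) unit_point_in tail_eq_refl by blast
    qed simp
    ultimately show "macro_cube.asymp_clopen K \<and> K \<in> ultrafilter_push UNIV macro_cube.M unit_point p0"
      by (auto simp: ultrafilter_push_def I(2))
  next
    fix P Q assume P: "P \<in> ultrafilter_push UNIV macro_cube.M unit_point p0"
      and Q: "Q \<subseteq> macro_cube.M" "macro_cube.asymp_disjoint P Q"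
    have sub: "P \<subseteq> ?M" "Q \<subseteq> ?M" using P Q by (auto simp: ultrafilter_push_def)
    have "{n. unit_point n \<in> P} \<in> p0" using P by (simp add: ultrafilter_push_def)
    then obtain I where I: "I \<in> \<A>" "finite (I - {n. unit_point n \<in> P})" using p0(3) by auto
    \<comment> \<open>The shift to \<open>Suc k\<close> fits the case \<open>s g n = Suc k\<close>:
      then \<open>g k \<le> n\<close>, while a point of \<open>Q\<close> in the class of a unit
      point in \<open>P\<close> would give \<open>Suc n \<le> f k \<le> g k\<close>. The case
      \<open>s g n = 0\<close> is left to the bound \<open>f 0\<close>.\<close>
    have "\<forall>k. \<exists>K. \<forall>x\<in>P. \<forall>y\<in>Q. tail_eq (Suc k) x y \<longrightarrow> level x \<le> K"
      using Q(2) macro_cube_asymp_disjoint_iff[OF sub] by blast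
    then obtain f where f: "\<And>k x y. x \<in> P \<Longrightarrow> y \<in> Q \<Longrightarrow> tail_eq (Suc k) x y \<Longrightarrow> level x \<le> f k" by metis
    obtain g where g: "g \<in> D" "\<And>n. f n \<le> g n" using D(1) by meson
    \<comment> \<open>The second summand covers the finitely many \<open>n \<in> I\<close> whose
      unit point is not in \<open>P\<close>.\<close>
    let ?K = "f 0 + Suc (Max (insert 0 (I - {n. unit_point n \<in> P})))"
    have "level y \<le> ?K" if y: "y \<in> C (I, g) \<inter> Q" for y
    proof -
      obtain n where n: "n \<in> I" "y \<in> ?M" "tail_eq (s g n) (unit_point n) y" "y \<in> Q" using y by (auto simp: C_def)
      have ly: "level y = Suc n" using C_level[OF n(2,3)] .
      show ?thesis
      proof (cases "unit_point n \<in> P")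
        case True
        show ?thesis
        proof (cases "s g n")
          case 0
          then have "tail_eq (Suc 0) (unit_point n) y" using n(3) tail_eq_mono by (metis le0)
          then have "Suc n \<le> f 0" using f[OF True n(4)] level_unit_point by metis
          then show ?thesis using ly by simp
        next
          case (Suc k)
          then have "Suc n \<le> f k" using f[OF True n(4), of k] n(3) by (simp add: level_unit_point)
          moreover have "k < s g n" using Suc by simp
          then have "g k \<le> n" unfolding s by simp
          ultimately show ?thesis using g(2)[of k] by simp
        qed
      next
        case False
        then have "n \<le> Max (insert 0 (I - {n. unit_point n \<in> P}))" using n(1) I(2) by (intro Max_ge) auto
        then show ?thesis using ly by simp
      qed
    qed
    then have "\<exists>R. \<forall>y\<in>C (I, g) \<inter> Q. macro_cube_dist (\<lambda>_. 0) y \<le> R"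
      using macro_cube_bounded_iff[of "C (I, g) \<inter> Q"] sub(2) by blast
    then show "\<exists>K\<in>C ` (\<A> \<times> D). \<exists>R. \<forall>y\<in>K \<inter> Q. mdist cantor_macro_cube (\<lambda>_. 0) y \<le> R"
      using I(1) g(1) by auto
  qed
  also have "|C ` (\<A> \<times> D)| \<le>o |\<A> \<times> D|" by (rule card_of_image)
  also have "|\<A> \<times> D| \<le>o |D|"
  proof -
    have "infinite D" using dominating_uncountable[of D] D(1) countable_finite by blast
    moreover have "|\<A>| \<le>o |D|" using ordLeq_transitive[OF p0(4) assms] D(2) by simp
    ultimately show ?thesis
      by (intro card_of_Times_le_infinite) (simp_all add: card_of_mono1)
  qed
  finally show ?thesis using D(2) by simp
qed

lemma macro_cube_min_character:
  assumes "ultrafilter_number \<le>o dominating_number"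
  shows "min_character (corona cantor_macro_cube) =o dominating_number"
proof -
  obtain t \<B> where t: "t \<in> topspace (corona cantor_macro_cube)" "nbhd_base (corona cantor_macro_cube) t \<B>"
    "min_character (corona cantor_macro_cube) = |\<B>|"
    using min_character_attained[OF macro_cube.topspace_corona_nonempty] by auto
  then show ?thesis
    using macro_cube_min_character_le[OF assms] macro_cube_nbhd_base_ge[OF t(1,2)] by (simp add: ordIso_iff_ordLeq)
qed

section \<open>Coarse invariance of the corona\<close>

lemma unbounded_metric_imp_locale:
  assumes "unbounded_metric X"
  shows "\<exists>a. unbounded_space X a"
proof -
  interpret Metric_space "mspace X" "mdist X" by (rule Metric_space_mspace_mdist)
  have nb: "\<not> mbounded (mspace X)" using assms by (simp add: unbounded_metric_def)
  then have "mspace X \<noteq> {}" using mbounded_empty by metis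
  then obtain a where a: "a \<in> mspace X" by blast
  have "\<exists>x\<in>mspace X. r < mdist X a x" for r
  proof (rule ccontr)
    assume "\<not> ?thesis"
    then have "mspace X \<subseteq> mcball a r" using a by (auto simp: in_mcball not_less)
    then show False using nb unfolding mbounded_def by blast
  qed
  then have "unbounded_space X a" using a by (simp add: unbounded_space_def)
  then show ?thesis by blast
qed

lemma coarse_map_bound:
  assumes "coarse_map X Y f"
  shows "\<exists>e. \<forall>x\<in>mspace X. \<forall>x'\<in>mspace X. mdist X x x' \<le> r \<longrightarrow> mdist Y (f x) (f x') \<le> e"
  using assms unfolding coarse_map_def by blast

text \<open>Only \<open>g \<circ> f\<close> is required to be close to the identity. Interpreting
  the locale a second time with the roles exchanged supplies the inverse map.\<close>

locale coarse_embedding = X: unbounded_space X a + Y: unbounded_space Y b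
  for X :: "'a metric" and a and Y :: "'b metric" and b +
  fixes f :: "'a \<Rightarrow> 'b" and g :: "'b \<Rightarrow> 'a" and C :: real
  assumes f: "coarse_map X Y f" and g: "coarse_map Y X g"
    and gf: "\<And>x. x \<in> mspace X \<Longrightarrow> mdist X (g (f x)) x \<le> C"
begin

lemma f_in: "x \<in> X.M \<Longrightarrow> f x \<in> Y.M" and g_in: "y \<in> Y.M \<Longrightarrow> g y \<in> X.M"
  using f g by (auto simp: coarse_map_def)

abbreviation push where "push \<equiv> ultrafilter_push X.M Y.M f"

text \<open>The map \<open>g\<close> sends bounded sets to bounded sets, and \<open>g (f x)\<close>
  is within \<open>C\<close> of \<open>x\<close>. So \<open>f\<close> carries points at infinity to
  points at infinity.\<close>

lemma proper: "\<exists>R'. \<forall>x\<in>X.M. Y.d b (f x) \<le> R \<longrightarrow> X.d a x \<le> R'"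
proof -
  obtain e where e: "\<And>y y'. y \<in> Y.M \<Longrightarrow> y' \<in> Y.M \<Longrightarrow> Y.d y y' \<le> R \<Longrightarrow> X.d (g y) (g y') \<le> e"
    using coarse_map_bound[OF g] by meson
  have "X.d a x \<le> X.d a (g b) + e + C" if x: "x \<in> X.M" "Y.d b (f x) \<le> R" for x
  proof -
    have "X.d (g b) (g (f x)) \<le> e" using e[OF Y.base f_in[OF x(1)] x(2)] .
    moreover have "X.d a x \<le> X.d a (g (f x)) + X.d (g (f x)) x"
      using X.triangle[OF X.base g_in[OF f_in[OF x(1)]] x(1)] .
    moreover have "X.d a (g (f x)) \<le> X.d a (g b) + X.d (g b) (g (f x))"
      using X.triangle[OF X.base g_in[OF Y.base] g_in[OF f_in[OF x(1)]]] .
    ultimately show ?thesis using gf[OF x(1)] by linarith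
  qed
  then show ?thesis by blast
qed

lemma push_ultra:
  assumes p: "X.ultra_at_infinity p"
  shows "Y.ultra_at_infinity (push p)"
  unfolding Y.ultra_at_infinity_def
proof (intro conjI allI)
  note u = X.ultra_at_infinityD[OF p]
  show "ultrafilter_on Y.M (push p)" by (rule ultrafilter_on_push[OF u(1)]) (use f_in in auto)
  fix R
  obtain R' where R': "\<And>x. x \<in> X.M \<Longrightarrow> Y.d b (f x) \<le> R \<Longrightarrow> X.d a x \<le> R'" using proper[of R] by auto
  have "{x\<in>X.M. R' < X.d a x} \<subseteq> {x\<in>X.M. f x \<in> {y\<in>Y.M. R < Y.d b y}}"
    using R' f_in by (auto simp: not_le[symmetric])
  then have "{x\<in>X.M. f x \<in> {y\<in>Y.M. R < Y.d b y}} \<in> p"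
    by (rule ultrafilter_onD(5)[OF u(1) u(2)]) auto
  then show "{y\<in>Y.M. R < Y.d b y} \<in> push p" by (simp add: ultrafilter_push_def)
qed

text \<open>Preimages of asymptotically disjoint sets under a proper coarse map are asymptotically
  disjoint.\<close>

lemma push_rel:
  assumes "(p, q) \<in> X.corona_rel"
  shows "(push p, push q) \<in> Y.corona_rel"
  unfolding Y.corona_rel_iff
proof (intro conjI ballI notI)
  have pq: "X.ultra_at_infinity p" "X.ultra_at_infinity q" and sep: "\<And>P Q. P \<in> p \<Longrightarrow> Q \<in> q \<Longrightarrow> \<not> X.asymp_disjoint P Q"
    using assms unfolding X.corona_rel_iff by auto
  show "Y.ultra_at_infinity (push p)" "Y.ultra_at_infinity (push q)" using push_ultra pq by auto
  fix P Q assume P: "P \<in> push p" and Q: "Q \<in> push q" and PQ: "Y.asymp_disjoint P Q"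
  have "X.asymp_disjoint {x\<in>X.M. f x \<in> P} {x\<in>X.M. f x \<in> Q}"
    unfolding X.asymp_disjoint_def
  proof
    fix r
    obtain e where e: "\<And>x x'. x \<in> X.M \<Longrightarrow> x' \<in> X.M \<Longrightarrow> X.d x x' \<le> r \<Longrightarrow> Y.d (f x) (f x') \<le> e"
      using coarse_map_bound[OF f] by meson
    obtain R where R: "\<And>x y. x \<in> P \<Longrightarrow> y \<in> Q \<Longrightarrow> Y.d x y \<le> e \<Longrightarrow> Y.d b x \<le> R"
      using PQ unfolding Y.asymp_disjoint_def by meson
    obtain R' where R': "\<And>x. x \<in> X.M \<Longrightarrow> Y.d b (f x) \<le> R \<Longrightarrow> X.d a x \<le> R'" using proper[of R] by auto
    have "X.d a x \<le> R'" if "x \<in> {x\<in>X.M. f x \<in> P}" "y \<in> {x\<in>X.M. f x \<in> Q}" "X.d x y \<le> r" for x y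
      using that R' R e by auto
    then show "\<exists>R. \<forall>x\<in>{x\<in>X.M. f x \<in> P}. \<forall>y\<in>{x\<in>X.M. f x \<in> Q}. X.d x y \<le> r \<longrightarrow> X.d a x \<le> R" by blast
  qed
  then show False using sep P Q by (auto simp: ultrafilter_push_def)
qed

lemma continuous_push: "continuous_map (sharp X) (sharp Y) push"
  unfolding continuous_map_def
proof (intro conjI allI impI)
  show "push \<in> topspace (sharp X) \<rightarrow> topspace (sharp Y)"
    using push_ultra unfolding X.topspace_sharp Y.topspace_sharp by auto
  fix U assume U: "openin (sharp Y) U"
  show "openin (sharp X) {p \<in> topspace (sharp X). push p \<in> U}"
    unfolding X.openin_sharp X.topspace_sharp
  proof (intro conjI ballI)
    fix p assume p: "p \<in> {p \<in> {p. X.ultra_at_infinity p}. push p \<in> U}"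
    then obtain A where A: "A \<in> push p" "\<And>q. Y.ultra_at_infinity q \<Longrightarrow> A \<in> q \<Longrightarrow> q \<in> U"
      using U unfolding Y.openin_sharp by auto
    have "\<forall>q. X.ultra_at_infinity q \<and> {x\<in>X.M. f x \<in> A} \<in> q \<longrightarrow> q \<in> {p \<in> {p. X.ultra_at_infinity p}. push p \<in> U}"
      using A push_ultra by (auto simp: ultrafilter_push_def)
    then show "\<exists>A\<in>p. \<forall>q. X.ultra_at_infinity q \<and> A \<in> q \<longrightarrow> q \<in> {p \<in> {p. X.ultra_at_infinity p}. push p \<in> U}"
      using A(1) by (intro bexI[of _ "{x\<in>X.M. f x \<in> A}"]) (auto simp: ultrafilter_push_def)
  qed auto
qed

text \<open>The composite map displaces every point by at most \<open>C\<close>, so the twofold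
  image of an ultrafilter is parallel to it.\<close>

lemma push_push_rel:
  assumes p: "X.ultra_at_infinity p"
  shows "(p, ultrafilter_push Y.M X.M g (push p)) \<in> X.corona_rel"
proof -
  have "{x\<in>X.M. f x \<in> {y\<in>Y.M. g y \<in> B}} = {x\<in>X.M. g (f x) \<in> B}" for B using f_in by auto
  then have "ultrafilter_push Y.M X.M g (push p) = ultrafilter_push X.M X.M (\<lambda>x. g (f x)) p"
    by (auto simp: ultrafilter_push_def)
  moreover have "(p, ultrafilter_push X.M X.M (\<lambda>x. g (f x)) p) \<in> parallel X"
    by (rule X.push_parallel[OF p _ _ ultrafilter_onD(2)[OF X.ultra_at_infinityD(1)[OF p]], of _ C])
      (use f_in g_in gf in \<open>auto simp: X.commute\<close>)
  ultimately show ?thesis using closed_equiv_hull(3)[OF X.parallel_subset] by auto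
qed

lemma corona_map:
  "\<exists>\<phi>. continuous_map (corona X) (corona Y) \<phi> \<and>
    (\<forall>p. X.ultra_at_infinity p \<longrightarrow> \<phi> (X.corona_rel `` {p}) = Y.corona_rel `` {push p})"
proof -
  have cont: "continuous_map (sharp X) (corona Y) ((\<lambda>p. Y.corona_rel `` {p}) \<circ> push)"
    using continuous_map_compose[OF continuous_push quotient_imp_continuous_map[OF Y.quotient_map_corona]] .
  have const: "((\<lambda>p. Y.corona_rel `` {p}) \<circ> push) p = ((\<lambda>p. Y.corona_rel `` {p}) \<circ> push) q"
    if "p \<in> topspace (sharp X)" "q \<in> topspace (sharp X)" "X.corona_rel `` {p} = X.corona_rel `` {q}" for p q
  proof -
    have u: "X.ultra_at_infinity p" "X.ultra_at_infinity q" using that by (auto simp: X.topspace_sharp)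
    then have "(p, q) \<in> X.corona_rel" using X.corona_class_eq_iff that(3) by simp
    then show ?thesis using push_rel Y.corona_class_eq_iff push_ultra u by simp
  qed
  show ?thesis
  proof (rule quotient_map_lift_exists[OF X.quotient_map_corona cont const])
    fix \<phi>
    assume "continuous_map (corona X) (corona Y) \<phi>"
      "\<And>p. p \<in> topspace (sharp X) \<Longrightarrow> \<phi> (X.corona_rel `` {p}) = ((\<lambda>p. Y.corona_rel `` {p}) \<circ> push) p"
    then show ?thesis unfolding X.topspace_sharp by (intro exI[of _ \<phi>]) simp
  qed
qed

end

lemma coarsely_equivalent_corona:
  assumes "unbounded_space X a" "unbounded_space Y b" "coarsely_equivalent X Y"
  shows "corona X homeomorphic_space corona Y"
proof -
  obtain f g C where fg: "coarse_map X Y f" "coarse_map Y X g"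
    "\<And>y. y \<in> mspace Y \<Longrightarrow> mdist Y (f (g y)) y \<le> C" "\<And>x. x \<in> mspace X \<Longrightarrow> mdist X (g (f x)) x \<le> C"
    using assms(3) unfolding coarsely_equivalent_def by blast
  interpret F: coarse_embedding X a Y b f g C
    by (intro coarse_embedding.intro coarse_embedding_axioms.intro assms(1,2) fg)
  interpret G: coarse_embedding Y b X a g f C
    by (intro coarse_embedding.intro coarse_embedding_axioms.intro assms(1,2) fg)
  obtain \<phi> where \<phi>: "continuous_map (corona X) (corona Y) \<phi>"
    "\<And>p. F.X.ultra_at_infinity p \<Longrightarrow> \<phi> (F.X.corona_rel `` {p}) = F.Y.corona_rel `` {F.push p}"
    using F.corona_map by auto
  obtain \<psi> where \<psi>: "continuous_map (corona Y) (corona X) \<psi>"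
    "\<And>p. F.Y.ultra_at_infinity p \<Longrightarrow> \<psi> (F.Y.corona_rel `` {p}) = F.X.corona_rel `` {G.push p}"
    using G.corona_map by auto
  have "\<psi> (\<phi> c) = c" if c: "c \<in> topspace (corona X)" for c
  proof -
    obtain p where p: "F.X.ultra_at_infinity p" "c = F.X.corona_rel `` {p}" using c by (auto simp: F.X.topspace_corona)
    have "\<psi> (\<phi> c) = F.X.corona_rel `` {G.push (F.push p)}" using \<phi>(2) \<psi>(2) F.push_ultra p by simp
    also have "\<dots> = c"
      using F.X.corona_class_eq_iff[OF p(1) G.push_ultra[OF F.push_ultra[OF p(1)]]] F.push_push_rel[OF p(1)] p(2) by simp
    finally show ?thesis .
  qed
  moreover have "\<phi> (\<psi> c) = c" if c: "c \<in> topspace (corona Y)" for c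
  proof -
    obtain p where p: "F.Y.ultra_at_infinity p" "c = F.Y.corona_rel `` {p}" using c by (auto simp: F.Y.topspace_corona)
    have "\<phi> (\<psi> c) = F.Y.corona_rel `` {F.push (G.push p)}" using \<phi>(2) \<psi>(2) G.push_ultra p by simp
    also have "\<dots> = c"
      using F.Y.corona_class_eq_iff[OF p(1) F.push_ultra[OF G.push_ultra[OF p(1)]]] G.push_push_rel[OF p(1)] p(2) by simp
    finally show ?thesis .
  qed
  ultimately have "homeomorphic_maps (corona X) (corona Y) \<phi> \<psi>"
    using \<phi>(1) \<psi>(1) by (simp add: homeomorphic_maps_def)
  then show ?thesis by (auto simp: homeomorphic_space_def)
qed

section \<open>Matching a tree of partitions with the binary tree\<close>

text \<open>The interval is cut at the floors of \<open>x\<close> times the partial sums of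
  \<open>c\<close>. The length of a piece is a difference of two floors, hence within 1 of the
  difference of the numbers rounded.\<close>

lemma rounding_partition:
  fixes c :: "'i \<Rightarrow> real"
  assumes "finite I" "\<And>i. i \<in> I \<Longrightarrow> 0 \<le> c i" "0 \<le> x"
  shows "\<exists>T :: 'i \<Rightarrow> nat set. disjoint_family_on T I \<and> (\<Union>i\<in>I. T i) = {..<nat \<lfloor>x * sum c I\<rfloor>} \<and>
    (\<forall>i\<in>I. \<bar>real (card (T i)) - x * c i\<bar> \<le> 1)"
  using assms(1,2)
proof (induction I rule: finite_induct)
  case empty
  then show ?case by (auto simp: disjoint_family_on_def)
next
  case (insert j I)
  obtain T :: "'i \<Rightarrow> nat set" where T: "disjoint_family_on T I" "(\<Union>i\<in>I. T i) = {..<nat \<lfloor>x * sum c I\<rfloor>}"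
    "\<forall>i\<in>I. \<bar>real (card (T i)) - x * c i\<bar> \<le> 1"
    using insert by auto
  have c: "0 \<le> sum c I" "0 \<le> c j" using insert.prems by (auto intro: sum_nonneg)
  let ?a = "x * sum c I" and ?b = "x * (c j + sum c I)"
  let ?J = "{nat \<lfloor>?a\<rfloor>..<nat \<lfloor>?b\<rfloor>}"
  have ab: "0 \<le> ?a" "?a \<le> ?b" "?b - ?a = x * c j"
    using c assms(3) by (auto intro!: mult_left_mono simp: algebra_simps)
  then have nab: "nat \<lfloor>?a\<rfloor> \<le> nat \<lfloor>?b\<rfloor>" by (intro nat_mono floor_mono)
  have sum: "sum c (insert j I) = c j + sum c I" using insert.hyps by simp
  have J: "\<bar>real (card ?J) - x * c j\<bar> \<le> 1"
  proof -
    have "real (card ?J) = real_of_int \<lfloor>?b\<rfloor> - real_of_int \<lfloor>?a\<rfloor>" using nab ab by (simp add: of_nat_diff)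
    moreover have "real_of_int \<lfloor>?a\<rfloor> \<le> ?a" "?a < real_of_int \<lfloor>?a\<rfloor> + 1" "real_of_int \<lfloor>?b\<rfloor> \<le> ?b" "?b < real_of_int \<lfloor>?b\<rfloor> + 1"
      by linarith+
    ultimately show ?thesis using ab(3) by linarith
  qed
  have "disjoint_family_on (T(j := ?J)) (insert j I)"
  proof -
    have "T i \<inter> ?J = {}" if "i \<in> I" for i
    proof -
      have "T i \<subseteq> {..<nat \<lfloor>?a\<rfloor>}" using T(2) that by blast
      then show ?thesis by auto
    qed
    then show ?thesis using T(1) insert.hyps by (auto simp: disjoint_family_on_def)
  qed
  moreover have "(\<Union>i\<in>insert j I. (T(j := ?J)) i) = {..<nat \<lfloor>x * sum c (insert j I)\<rfloor>}"
  proof -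
    have "(\<Union>i\<in>insert j I. (T(j := ?J)) i) = ?J \<union> (\<Union>i\<in>I. T i)" using insert.hyps by auto
    also have "\<dots> = {..<nat \<lfloor>?b\<rfloor>}" unfolding T(2) using nab by auto
    finally show ?thesis unfolding sum .
  qed
  moreover have "\<bar>real (card ((T(j := ?J)) i)) - x * c i\<bar> \<le> 1" if "i \<in> insert j I" for i
    using T(3) that J by (cases "i = j") auto
  ultimately show ?case by blast
qed

text \<open>When the weights are laid end to end, \<open>P i\<close> is the place where item
  \<open>i\<close> starts. The items starting before \<open>x\<close> cover the segment up to
  \<open>x\<close> and overshoot it by less than one weight.\<close>

lemma positions:
  fixes c :: "'i \<Rightarrow> real"
  assumes "finite I" "\<And>i. i \<in> I \<Longrightarrow> 0 < c i \<and> c i \<le> N" "0 < N"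
  shows "\<exists>P. (\<forall>i\<in>I. 0 \<le> P i \<and> P i < sum c I) \<and>
    (\<forall>x\<ge>0. x \<le> sum c I \<longrightarrow> x \<le> sum c {i\<in>I. P i < x} \<and> sum c {i\<in>I. P i < x} < x + N)"
  using assms(1,2)
proof (induction I rule: finite_induct)
  case empty
  then show ?case using assms(3) by auto
next
  case (insert j I)
  obtain P where P: "\<forall>i\<in>I. 0 \<le> P i \<and> P i < sum c I"
    "\<And>x. 0 \<le> x \<Longrightarrow> x \<le> sum c I \<Longrightarrow> x \<le> sum c {i\<in>I. P i < x} \<and> sum c {i\<in>I. P i < x} < x + N"
    using insert by auto
  have c: "0 \<le> sum c I" "0 < c j" "c j \<le> N"
    using insert.prems by (auto intro!: sum_nonneg dest: less_imp_le)
  have sum: "sum c (insert j I) = c j + sum c I" using insert.hyps by simp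
  let ?P = "P(j := sum c I)"
  have "x \<le> sum c {i\<in>insert j I. ?P i < x} \<and> sum c {i\<in>insert j I. ?P i < x} < x + N"
    if x: "0 \<le> x" "x \<le> sum c (insert j I)" for x
  proof (cases "x \<le> sum c I")
    case True
    then have "{i\<in>insert j I. ?P i < x} = {i\<in>I. P i < x}" using insert.hyps by auto
    then show ?thesis using P(2)[OF x(1) True] by simp
  next
    case False
    then have "{i\<in>insert j I. ?P i < x} = insert j I" using P(1) by force
    then show ?thesis using x(2) False sum c by simp
  qed
  moreover have "\<forall>i\<in>insert j I. 0 \<le> ?P i \<and> ?P i < sum c (insert j I)"
    using P(1) c unfolding sum by force
  ultimately show ?case by blast
qed

text \<open>Cut the line of items into \<open>m\<close> segments of the average length and put each
  item into the segment where it starts. The overshoots at the two ends of a segment lie in the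
  interval from 0 to \<open>N\<close>, so their difference is less than \<open>N\<close>.\<close>

lemma binning:
  fixes c :: "'i \<Rightarrow> real"
  assumes I: "finite I" "I \<noteq> {}" and c: "\<And>i. i \<in> I \<Longrightarrow> 0 < c i \<and> c i \<le> N" and m: "0 < (m::nat)"
  shows "\<exists>b. (\<forall>i\<in>I. b i < m) \<and> (\<forall>k<m. \<bar>sum c {i\<in>I. b i = k} - sum c I / m\<bar> < N)"
proof -
  define u where "u = sum c I / m"
  have N: "0 < N" using I(2) c by force
  have S: "0 < sum c I" using I c by (intro sum_pos) auto
  then have u: "0 < u" "sum c I = m * u" using m by (auto simp: u_def)
  obtain P where P: "(\<forall>i\<in>I. 0 \<le> P i \<and> P i < sum c I) \<and>
    (\<forall>x\<ge>0. x \<le> sum c I \<longrightarrow> x \<le> sum c {i\<in>I. P i < x} \<and> sum c {i\<in>I. P i < x} < x + N)"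
    using positions[OF I(1) c N] by (rule exE)
  note P = P[THEN conjunct1, rule_format] P[THEN conjunct2, rule_format]
  define b where "b i = nat \<lfloor>P i / u\<rfloor>" for i
  have b: "b i = k \<longleftrightarrow> real k * u \<le> P i \<and> P i < real (k + 1) * u" if "i \<in> I" for i k
  proof -
    have "b i = k \<longleftrightarrow> \<lfloor>P i / u\<rfloor> = int k" using P(1)[OF that] u(1) by (auto simp: b_def nat_eq_iff)
    also have "\<dots> \<longleftrightarrow> real k \<le> P i / u \<and> P i / u < real (k + 1)" by (simp add: floor_eq_iff add.commute)
    also have "\<dots> \<longleftrightarrow> real k * u \<le> P i \<and> P i < real (k + 1) * u" using u(1) by (simp add: pos_le_divide_eq pos_divide_less_eq)
    finally show ?thesis .
  qed
  have "b i < m" if "i \<in> I" for i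
  proof -
    have "real (b i) * u < real m * u" using b[OF that, of "b i"] P(1)[OF that] u(2) by force
    then show ?thesis using u(1) by simp
  qed
  moreover have "\<bar>sum c {i\<in>I. b i = k} - u\<bar> < N" if k: "k < m" for k
  proof -
    let ?G = "\<lambda>x. {i\<in>I. P i < x}"
    have "{i\<in>I. b i = k} = ?G (real (k + 1) * u) - ?G (real k * u)" using b by force
    moreover have "real k * u \<le> real (k + 1) * u" using u(1) by (intro mult_right_mono) auto
    then have "?G (real k * u) \<subseteq> ?G (real (k + 1) * u)" by force
    ultimately have "sum c {i\<in>I. b i = k} = sum c (?G (real (k + 1) * u)) - sum c (?G (real k * u))"
      using I(1) by (simp add: sum_diff)
    moreover have "real k * u \<le> sum c (?G (real k * u)) \<and> sum c (?G (real k * u)) < real k * u + N"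
      by (rule P(2)) (use u k in auto)
    moreover have "real (k + 1) * u \<le> sum c (?G (real (k + 1) * u)) \<and> sum c (?G (real (k + 1) * u)) < real (k + 1) * u + N"
    proof (rule P(2))
      have "real (k + 1) \<le> real m" using k by linarith
      then show "real (k + 1) * u \<le> sum c I" unfolding u(2) using u(1) by (intro mult_right_mono) auto
    qed (use u in simp)
    moreover have "real (k + 1) * u = real k * u + u" by (simp add: algebra_simps)
    ultimately show ?thesis by linarith
  qed
  ultimately show ?thesis unfolding u_def by blast
qed

text \<open>One step down the tree: \<open>S\<close> holds the nodes given to a component,
  \<open>I\<close> its subcomponents with weights \<open>c\<close>, each node has \<open>D\<close>
  subnodes, and \<open>s\<close> is the size of a subnode. The subcomponents are packed into
  \<open>card S\<close> bins of nearly equal weight, each bin is given one node, and the subnodes of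
  that node are shared out in proportion. The margin \<eta> is spent in two halves, on the unequal
  bins and on rounding. Each subcomponent stays below a single node, which a matching needs for its
  reverse implication.\<close>

lemma distribute:
  fixes c :: "'i \<Rightarrow> real" and A B \<eta> s N a :: real
  assumes I: "finite I" "I \<noteq> {}" and c: "\<And>i. i \<in> I \<Longrightarrow> a \<le> c i \<and> c i \<le> N" and a: "0 < a"
    and S: "finite S" "0 < card S" and \<eta>: "0 < \<eta>" and A: "0 \<le> A" "A + \<eta> \<le> 4" and B: "B \<le> 4"
    and s: "0 < s" "s \<le> \<eta> / 2 * a" and N: "32 * N \<le> s * real D * \<eta>"
    and ratio: "(A + \<eta>) * sum c I \<le> card S * (s * D)" "card S * (s * D) \<le> (B - \<eta>) * sum c I"
  shows "\<exists>T :: 'i \<Rightarrow> nat set. disjoint_family_on T I \<and> (\<Union>i\<in>I. T i) = {y. y div D \<in> S} \<and>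
    (\<forall>i\<in>I. \<exists>q\<in>S. T i \<subseteq> {y. y div D = q}) \<and> (\<forall>i\<in>I. A * c i \<le> card (T i) * s \<and> card (T i) * s \<le> B * c i)"
proof -
  define m where "m = card S"
  define u where "u = sum c I / m"
  define t where "t = s * D"
  have m: "0 < m" using S by (simp add: m_def)
  have c': "0 < c i \<and> c i \<le> N" if "i \<in> I" for i using c[OF that] a by linarith
  have N0: "0 < N" using I(2) c' by force
  have "0 < sum c I" using I c' by (intro sum_pos) auto
  then have u: "0 < u" "sum c I = m * u" using m by (auto simp: u_def)
  have "0 < s * real D * \<eta>" using N N0 by linarith
  then have D: "0 < D" using s(1) \<eta> by (cases D) auto
  have "m * ((A + \<eta>) * u) \<le> m * t" "m * t \<le> m * ((B - \<eta>) * u)"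
    using ratio unfolding u(2) m_def[symmetric] t_def by (simp_all add: algebra_simps)
  then have t: "(A + \<eta>) * u \<le> t" "t \<le> (B - \<eta>) * u" using m by simp_all
  have "(B - \<eta>) * u \<le> 4 * u" using B \<eta> u(1) by (intro mult_right_mono) auto
  then have "t * \<eta> \<le> 4 * u * \<eta>" using t(2) \<eta> by (intro mult_right_mono) auto
  \<comment> \<open>The bin error is at most an eighth of \<open>\<eta> * u\<close>. All
    coefficients are at most 4, so replacing the average \<open>u\<close> by an actual bin weight
    costs at most half of \<eta>.\<close>
  then have uN: "8 * N \<le> \<eta> * u" using N by (simp add: t_def algebra_simps)
  have "(A + \<eta>) * u \<le> (B - \<eta>) * u" using t by linarith
  then have AB: "A + \<eta> \<le> B - \<eta>" using u(1) by simp
  have lo: "(A + \<eta> / 2) * (u + N) \<le> t"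
  proof -
    have "(A + \<eta> / 2) * N \<le> 4 * N" using A \<eta> N0 by (intro mult_right_mono) auto
    moreover have "(A + \<eta> / 2) * (u + N) = (A + \<eta>) * u - \<eta> * u / 2 + (A + \<eta> / 2) * N" by (simp add: field_simps)
    ultimately show ?thesis using t(1) uN by linarith
  qed
  have hi: "t \<le> (B - \<eta> / 2) * (u - N)"
  proof -
    have "(B - \<eta> / 2) * N \<le> 4 * N" using B \<eta> N0 by (intro mult_right_mono) auto
    moreover have "(B - \<eta> / 2) * (u - N) = (B - \<eta>) * u + \<eta> * u / 2 - (B - \<eta> / 2) * N" by (simp add: field_simps)
    ultimately show ?thesis using t(2) uN by linarith
  qed
  obtain b where b: "\<And>i. i \<in> I \<Longrightarrow> b i < m" "\<And>k. k < m \<Longrightarrow> \<bar>sum c {i\<in>I. b i = k} - u\<bar> < N"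
    using binning[where c = c and N = N, OF I c' m] unfolding u_def by auto
  define W where "W k = sum c {i\<in>I. b i = k}" for k
  have \<eta>4: "\<eta> \<le> 4" using A by linarith
  have "\<eta> * u \<le> 4 * u" using \<eta>4 u(1) by (intro mult_right_mono) auto
  then have uN2: "N < u" using uN N0 by linarith
  have W: "0 < W k" "W k < u + N" "u - N < W k" if "k < m" for k
    using b(2)[OF that] uN2 unfolding W_def by linarith+
  define good where "good k T \<longleftrightarrow> disjoint_family_on T {i\<in>I. b i = k} \<and> (\<Union>i\<in>{i\<in>I. b i = k}. T i) = {..<D} \<and>
      (\<forall>i\<in>{i\<in>I. b i = k}. \<bar>real (card (T i)) - D / W k * c i\<bar> \<le> 1)" for k and T :: "'i \<Rightarrow> nat set"
  have ex: "\<exists>T. good k T" if k: "k < m" for k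
  proof -
    have "D / W k * sum c {i\<in>I. b i = k} = D" using W(1)[OF k] by (simp add: W_def)
    then show ?thesis
      using rounding_partition[of "{i\<in>I. b i = k}" c "D / W k"] I(1) c' W(1)[OF k]
      unfolding good_def by (simp add: less_imp_le)
  qed
  define R where "R k = (SOME T. good k T)" for k
  have good: "good k (R k)" if "k < m" for k using someI_ex[OF ex[OF that]] unfolding R_def .
  have R: "disjoint_family_on (R k) {i\<in>I. b i = k}" "(\<Union>i\<in>{i\<in>I. b i = k}. R k i) = {..<D}" if "k < m" for k
    using good[OF that, unfolded good_def, THEN conjunct1]
      good[OF that, unfolded good_def, THEN conjunct2, THEN conjunct1] .
  have R3: "\<bar>real (card (R k i)) - D / W k * c i\<bar> \<le> 1" if "k < m" "i \<in> I" "b i = k" for k i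
    using good[OF that(1)] that(2,3) unfolding good_def by simp
  \<comment> \<open>Bin number \<open>k\<close> is served by the node \<open>e k\<close>.\<close>
  obtain e where e: "bij_betw e {0..<m} S" using ex_bij_betw_nat_finite[OF S(1)] by (auto simp: m_def)
  have eS: "e k \<in> S" if "k < m" for k using e that by (auto simp: bij_betw_def)
  have einj: "k = l" if "e k = e l" "k < m" "l < m" for k l using e that by (auto simp: bij_betw_def dest: inj_onD)
  define T where "T i = (\<lambda>y. e (b i) * D + y) ` R (b i) i" for i
  have RD: "R (b i) i \<subseteq> {..<D}" if "i \<in> I" for i using R(2)[OF b(1)[OF that]] that by blast
  have T_iff: "y \<in> T i \<longleftrightarrow> y div D = e (b i) \<and> y mod D \<in> R (b i) i" if i: "i \<in> I" for i y
  proof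
    assume "y \<in> T i"
    then obtain z where z: "y = e (b i) * D + z" "z \<in> R (b i) i" by (auto simp: T_def)
    then have "z < D" using RD[OF i] by auto
    then show "y div D = e (b i) \<and> y mod D \<in> R (b i) i" using z D by simp
  next
    assume "y div D = e (b i) \<and> y mod D \<in> R (b i) i"
    moreover have "y = y div D * D + y mod D" by simp
    ultimately show "y \<in> T i" unfolding T_def by (intro image_eqI[of _ _ "y mod D"]) auto
  qed
  have "disjoint_family_on T I"
    unfolding disjoint_family_on_def
  proof (intro ballI impI)
    fix i j assume ij: "i \<in> I" "j \<in> I" "i \<noteq> j"
    show "T i \<inter> T j = {}"
    proof (rule ccontr)
      assume "T i \<inter> T j \<noteq> {}"
      then obtain y where y: "y \<in> T i" "y \<in> T j" by auto
      then have "e (b i) = e (b j)" "y mod D \<in> R (b i) i" "y mod D \<in> R (b j) j" using T_iff ij by auto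
      moreover from this have bb: "b i = b j" using einj b(1) ij by auto
      ultimately show False using R(1)[OF b(1)[OF ij(1)]] ij unfolding disjoint_family_on_def by auto
    qed
  qed
  moreover have "(\<Union>i\<in>I. T i) = {y. y div D \<in> S}"
  proof (intro equalityI subsetI)
    fix y assume "y \<in> (\<Union>i\<in>I. T i)"
    then show "y \<in> {y. y div D \<in> S}" using T_iff eS b(1) by auto
  next
    fix y assume "y \<in> {y. y div D \<in> S}"
    then obtain k where k: "k < m" "y div D = e k" using e by (auto simp: bij_betw_def)
    have "y mod D \<in> (\<Union>i\<in>{i\<in>I. b i = k}. R k i)" unfolding R(2)[OF k(1)] using D by simp
    then obtain i where "i \<in> I" "b i = k" "y mod D \<in> R k i" by auto
    then show "y \<in> (\<Union>i\<in>I. T i)" using T_iff k(2) by auto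
  qed
  moreover have "\<exists>q\<in>S. T i \<subseteq> {y. y div D = q}" if "i \<in> I" for i
    using T_iff[OF that] eS[OF b(1)[OF that]] by (intro bexI[of _ "e (b i)"]) auto
  moreover have "A * c i \<le> card (T i) * s \<and> card (T i) * s \<le> B * c i" if i: "i \<in> I" for i
  proof -
    let ?W = "W (b i)"
    note W = W[OF b(1)[OF i]]
    have card: "card (T i) = card (R (b i) i)" unfolding T_def by (intro card_image) (auto simp: inj_on_def)
    have "\<bar>real (card (T i)) - D / ?W * c i\<bar> \<le> 1" unfolding card using R3[OF b(1)[OF i] i] by simp
    \<comment> \<open>Rounding misplaces at most one subnode, of size \<open>s\<close>, and
      \<open>s\<close> is at most \<open>\<eta> / 2 * c i\<close>.\<close>
    then have "\<bar>real (card (T i)) - D / ?W * c i\<bar> * s \<le> 1 * s" using s(1) by (intro mult_right_mono) auto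
    then have "\<bar>(real (card (T i)) - D / ?W * c i) * s\<bar> \<le> s" using s(1) by (simp add: abs_mult)
    moreover have "(real (card (T i)) - D / ?W * c i) * s = card (T i) * s - t / ?W * c i"
      by (simp add: t_def algebra_simps)
    ultimately have n0: "\<bar>card (T i) * s - t / ?W * c i\<bar> \<le> s" by metis
    have n: "t / ?W * c i - s \<le> card (T i) * s" "card (T i) * s \<le> t / ?W * c i + s"
      using abs_le_D1[OF n0] abs_le_D2[OF n0] by simp_all
    have "\<eta> / 2 * a \<le> \<eta> / 2 * c i" using c[OF i] \<eta> by (intro mult_left_mono) auto
    then have ci: "0 < c i" "s \<le> \<eta> / 2 * c i" using s(2) c'[OF i] by auto
    have "(A + \<eta> / 2) * ?W \<le> (A + \<eta> / 2) * (u + N)" using W A \<eta> by (intro mult_left_mono) auto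
    then have "A + \<eta> / 2 \<le> t / ?W" using lo W(1) by (simp add: pos_le_divide_eq)
    then have "(A + \<eta> / 2) * c i \<le> t / ?W * c i" using ci(1) by (intro mult_right_mono) auto
    moreover have "(B - \<eta> / 2) * (u - N) \<le> (B - \<eta> / 2) * ?W" using W A AB \<eta> by (intro mult_left_mono) auto
    then have "t / ?W \<le> B - \<eta> / 2" using hi W(1) by (simp add: pos_divide_le_eq)
    then have "t / ?W * c i \<le> (B - \<eta> / 2) * c i" using ci(1) by (intro mult_right_mono) auto
    ultimately show ?thesis using n ci(2) by (simp add: algebra_simps)
  qed
  ultimately show ?thesis by blast
qed

section \<open>The tree of components and its finite matchings\<close>

lemma div_power2_mono:
  fixes y y' :: nat
  assumes "y div 2 ^ i = y' div 2 ^ i" "i \<le> j"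
  shows "y div 2 ^ j = y' div 2 ^ j"
proof -
  have "(2::nat) ^ j = 2 ^ i * 2 ^ (j - i)" using assms(2) by (simp flip: power_add)
  then show ?thesis using assms(1) by (simp add: div_mult2_eq)
qed

unbundle bit_operations_syntax

lemma two_minus_inverse_power_pos: "0 < 2 - 1 / (2::real) ^ k"
proof -
  have "1 / (2::real) ^ k \<le> 1" using one_le_power[of "2 :: real" k] by simp
  then show ?thesis by linarith
qed

text \<open>A point has weight 64, a node of height \<open>\<alpha> k\<close> has weight
  \<open>2 ^ \<alpha> k\<close>. By \<open>lower\<close>, one node is at most the fraction
  \<open>1 / 2 ^ (k + 2)\<close> of any component of level \<open>k\<close>, which bounds rounding
  errors; by \<open>upper\<close>, such a component is at most the fraction
  \<open>1 / 2 ^ (k + 6)\<close> of a node of the next height, which bounds bin errors. These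
  fractions are summable over \<open>k\<close>. At level 0, where components are points and nodes
  are leaves, \<open>lower\<close> just says that 4 is at most 64.\<close>

locale level_structure =
  fixes V :: "'a set" and eq :: "nat \<Rightarrow> 'a \<Rightarrow> 'a \<Rightarrow> bool" and \<alpha> :: "nat \<Rightarrow> nat"
  assumes nonempty: "V \<noteq> {}"
    and eq_refl: "\<And>k x. x \<in> V \<Longrightarrow> eq k x x"
    and eq_sym: "\<And>k x y. eq k x y \<Longrightarrow> eq k y x"
    and eq_trans: "\<And>k x y z. eq k x y \<Longrightarrow> eq k y z \<Longrightarrow> eq k x z"
    and eq_Suc: "\<And>k x y. eq k x y \<Longrightarrow> eq (Suc k) x y"
    and eq_zero: "\<And>x y. x \<in> V \<Longrightarrow> y \<in> V \<Longrightarrow> eq 0 x y \<Longrightarrow> x = y"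
    and eq_exists: "\<And>x y. x \<in> V \<Longrightarrow> y \<in> V \<Longrightarrow> \<exists>k. eq k x y"
    and \<alpha>_zero: "\<alpha> 0 = 0" and \<alpha>_Suc: "\<And>k. \<alpha> k < \<alpha> (Suc k)"
    and finite_class: "\<And>k x. x \<in> V \<Longrightarrow> finite {y\<in>V. eq k x y}"
    and lower: "\<And>k x. x \<in> V \<Longrightarrow> 2 ^ \<alpha> k * 2 ^ (k + 2) \<le> 64 * real (card {y\<in>V. eq k x y})"
    and upper: "\<And>k x. x \<in> V \<Longrightarrow> 64 * real (card {y\<in>V. eq k x y}) * 2 ^ (k + 6) \<le> 2 ^ \<alpha> (Suc k)"
begin

definition cls :: "nat \<Rightarrow> 'a \<Rightarrow> 'a set" where
  "cls k x = {y\<in>V. eq k x y}"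

text \<open>Numbers are regarded as leaves of the binary tree; \<open>block k y\<close> is the node of height \<open>\<alpha> k\<close> above \<open>y\<close>.\<close>

definition block :: "nat \<Rightarrow> nat \<Rightarrow> nat" where
  "block k y = y div 2 ^ \<alpha> k"

text \<open>The reverse implication loses one height, since a component of level \<open>j\<close>
  fills several nodes of height \<open>\<alpha> j\<close>. It stops at \<open>j < k\<close>, because
  the top component may be spread over unrelated nodes.\<close>

definition matching :: "nat \<Rightarrow> 'a set \<Rightarrow> nat set \<Rightarrow> (nat \<Rightarrow> 'a) \<Rightarrow> bool" where
  "matching k K Q g \<longleftrightarrow> g ` Q = K \<and>
     (\<forall>y\<in>Q. \<forall>y'\<in>Q. \<forall>j\<le>k. block j y = block j y' \<longrightarrow> eq j (g y) (g y')) \<and>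
     (\<forall>y\<in>Q. \<forall>y'\<in>Q. \<forall>j<k. eq j (g y) (g y') \<longrightarrow> block (Suc j) y = block (Suc j) y')"

lemma matchingD:
  assumes "matching k K Q g"
  shows "g ` Q = K"
    and "y \<in> Q \<Longrightarrow> y' \<in> Q \<Longrightarrow> j \<le> k \<Longrightarrow> block j y = block j y' \<Longrightarrow> eq j (g y) (g y')"
    and "y \<in> Q \<Longrightarrow> y' \<in> Q \<Longrightarrow> j < k \<Longrightarrow> eq j (g y) (g y') \<Longrightarrow> block (Suc j) y = block (Suc j) y'"
proof -
  note m = assms[unfolded matching_def]
  show "g ` Q = K" using m by (rule conjunct1)
  show "y \<in> Q \<Longrightarrow> y' \<in> Q \<Longrightarrow> j \<le> k \<Longrightarrow> block j y = block j y' \<Longrightarrow> eq j (g y) (g y')"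
    by (rule m[THEN conjunct2, THEN conjunct1, rule_format])
  show "y \<in> Q \<Longrightarrow> y' \<in> Q \<Longrightarrow> j < k \<Longrightarrow> eq j (g y) (g y') \<Longrightarrow> block (Suc j) y = block (Suc j) y'"
    by (rule m[THEN conjunct2, THEN conjunct2, rule_format])
qed

lemma \<alpha>_mono: "i \<le> j \<Longrightarrow> \<alpha> i \<le> \<alpha> j"
  by (rule lift_Suc_mono_le[of \<alpha>, OF less_imp_le[OF \<alpha>_Suc]])

lemma \<alpha>_ge: "k \<le> \<alpha> k"
proof (induction k)
  case (Suc k)
  then show ?case using \<alpha>_Suc[of k] by simp
qed simp

lemma eq_mono: "eq j x y \<Longrightarrow> j \<le> k \<Longrightarrow> eq k x y"
  by (induction k) (auto simp: le_Suc_eq intro: eq_Suc)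

lemma block_mono: "block j y = block j y' \<Longrightarrow> j \<le> k \<Longrightarrow> block k y = block k y'"
  unfolding block_def using div_power2_mono \<alpha>_mono by blast

lemma in_cls: "x \<in> V \<Longrightarrow> x \<in> cls k x"
  by (simp add: cls_def eq_refl)

lemma cls_eq: "eq k x y \<Longrightarrow> cls k x = cls k y"
  unfolding cls_def using eq_sym eq_trans by blast

text \<open>The ratio between the weight of the nodes \<open>S\<close> and the weight of the
  component may lie in a window that is close to [2, 3] for large \<open>k\<close> and widens to
  [1, 4] at level 0. Passing from level \<open>Suc k\<close> to level \<open>k\<close> widens it by
  \<open>1 / 2 ^ Suc k\<close> on either side, and this is the margin that \<open>distribute\<close>
  consumes. At level 0 the window still forces \<open>S\<close> to be nonempty.\<close>

lemma matching_exists: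
  assumes "x \<in> V" "finite S" "(2 - 1 / 2 ^ k) * (64 * real (card (cls k x))) \<le> real (card S) * 2 ^ \<alpha> k"
    "real (card S) * 2 ^ \<alpha> k \<le> (3 + 1 / 2 ^ k) * (64 * real (card (cls k x)))"
  shows "\<exists>g. matching k (cls k x) {y. block k y \<in> S} g"
  using assms
proof (induction k arbitrary: x S)
  case 0
  have "cls 0 x = {x}" using eq_zero eq_refl 0(1) by (auto simp: cls_def)
  moreover have "S \<noteq> {}" using 0 calculation \<alpha>_zero by auto
  then obtain s where "s \<in> S" by auto
  then have "{y. block 0 y \<in> S} \<noteq> {}" by (auto simp: block_def \<alpha>_zero)
  ultimately have "matching 0 (cls 0 x) {y. block 0 y \<in> S} (\<lambda>_. x)"
    using eq_refl[OF 0(1)] by (auto simp: matching_def)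
  then show ?case by blast
next
  case (Suc k)
  let ?K = "cls (Suc k) x"
  let ?D = "2 ^ (\<alpha> (Suc k) - \<alpha> k) :: nat"
  define I where "I = cls k ` ?K"
  define c where "c J = 64 * real (card J)" for J :: "'a set"
  define \<eta> :: real where "\<eta> = 1 / 2 ^ Suc k"
  have KV: "?K \<subseteq> V" and finK: "finite ?K" using finite_class[OF Suc.prems(1)] by (auto simp: cls_def)
  have sub: "cls k z \<subseteq> ?K" if "z \<in> ?K" for z
  proof
    fix y assume "y \<in> cls k z"
    then have "y \<in> V" "eq (Suc k) z y" using eq_Suc by (auto simp: cls_def)
    then show "y \<in> ?K" using that eq_trans by (auto simp: cls_def)
  qed
  have UI: "\<Union>I = ?K"
  proof (intro equalityI subsetI)
    fix z assume z: "z \<in> ?K"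
    then have "z \<in> cls k z" using in_cls KV by auto
    then show "z \<in> \<Union>I" using z by (auto simp: I_def)
  qed (use sub in \<open>auto simp: I_def\<close>)
  have disjI: "J = J'" if J: "J \<in> I" "J' \<in> I" "y \<in> J" "y \<in> J'" for J J' y
  proof -
    obtain z z' where z: "J = cls k z" "J' = cls k z'" using J by (auto simp: I_def)
    then have "eq k z y" "eq k z' y" using J(3,4) by (auto simp: cls_def)
    then have "cls k z = cls k y" "cls k z' = cls k y" using cls_eq by auto
    then show ?thesis using z by simp
  qed
  have D: "s * real ?D = 2 ^ \<alpha> (Suc k)" if "s = 2 ^ \<alpha> k" for s
    using that \<alpha>_Suc[of k] by (simp flip: power_add)
  have sumc: "sum c I = 64 * real (card ?K)"
  proof -
    have "card (\<Union>I) = sum card I"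
    proof (rule card_Union_disjoint)
      show "pairwise disjnt I"
      proof (rule pairwiseI)
        fix J J' assume JJ: "J \<in> I" "J' \<in> I" "J \<noteq> J'"
        show "disjnt J J'" unfolding disjnt_iff using disjI[OF JJ(1,2)] JJ(3) by auto
      qed
      show "finite J" if "J \<in> I" for J
      proof (rule finite_subset[OF _ finK])
        show "J \<subseteq> ?K" using that UI by auto
      qed
    qed
    then show ?thesis unfolding UI c_def by (simp add: sum_distrib_left)
  qed
  have "\<exists>T :: 'a set \<Rightarrow> nat set. disjoint_family_on T I \<and> (\<Union>J\<in>I. T J) = {y. y div ?D \<in> S} \<and>
    (\<forall>J\<in>I. \<exists>q\<in>S. T J \<subseteq> {y. y div ?D = q}) \<and>
    (\<forall>J\<in>I. (2 - 1 / 2 ^ k) * c J \<le> real (card (T J)) * 2 ^ \<alpha> k \<and> real (card (T J)) * 2 ^ \<alpha> k \<le> (3 + 1 / 2 ^ k) * c J)"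
  \<comment> \<open>The values of \<open>a\<close> and \<open>N\<close> are the extreme weights
    allowed by \<open>lower\<close> and \<open>upper\<close>; with them both smallness conditions
    hold with equality.\<close>
  proof (rule distribute[where \<eta> = \<eta> and a = "2 ^ \<alpha> k * 2 ^ (k + 2)" and N = "2 ^ \<alpha> (Suc k) / 2 ^ (k + 6)"])
    show "finite I" using finK by (simp add: I_def)
    show "I \<noteq> {}" using in_cls[OF Suc.prems(1)] by (auto simp: I_def)
    show "2 ^ \<alpha> k * 2 ^ (k + 2) \<le> c J \<and> c J \<le> 2 ^ \<alpha> (Suc k) / 2 ^ (k + 6)" if J: "J \<in> I" for J
    proof -
      obtain z where "z \<in> V" "J = {y\<in>V. eq k z y}" using J KV by (auto simp: I_def cls_def)
      then show ?thesis using lower[of z k] upper[of z k] by (simp add: c_def pos_le_divide_eq)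
    qed
    have "0 < card ?K" using in_cls[OF Suc.prems(1)] finK by (auto simp: card_gt_0_iff)
    then have "0 < (2 - 1 / 2 ^ Suc k) * (64 * real (card ?K))"
      by (intro mult_pos_pos two_minus_inverse_power_pos) simp_all
    then have "0 < real (card S) * 2 ^ \<alpha> (Suc k)" using Suc.prems(3) by linarith
    then show "0 < card S" by (simp add: zero_less_mult_iff)
    show "0 \<le> 2 - 1 / (2 ^ k :: real)" "2 - 1 / 2 ^ k + \<eta> \<le> 4" "3 + 1 / (2 ^ k :: real) \<le> 4"
    proof -
      obtain w :: real where w: "w = 1 / 2 ^ k" by simp
      have "w \<le> 1" "0 < w" "\<eta> = w / 2" using one_le_power[of "2 :: real" k] by (simp_all add: w \<eta>_def)
      then show "0 \<le> 2 - 1 / (2 ^ k :: real)" "2 - 1 / 2 ^ k + \<eta> \<le> 4" "3 + 1 / (2 ^ k :: real) \<le> 4"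
        unfolding w[symmetric] by linarith+
    qed
    show "(2 :: real) ^ \<alpha> k \<le> \<eta> / 2 * (2 ^ \<alpha> k * 2 ^ (k + 2))" by (simp add: \<eta>_def)
    show "32 * (2 ^ \<alpha> (Suc k) / 2 ^ (k + 6)) \<le> 2 ^ \<alpha> k * real ?D * \<eta>"
      unfolding D[OF refl] by (simp add: \<eta>_def power_add)
    have A: "2 - 1 / 2 ^ k + \<eta> = 2 - 1 / 2 ^ Suc k" "3 + 1 / 2 ^ k - \<eta> = 3 + 1 / 2 ^ Suc k"
      by (simp_all add: \<eta>_def)
    show "(2 - 1 / 2 ^ k + \<eta>) * sum c I \<le> real (card S) * (2 ^ \<alpha> k * real ?D)"
      "real (card S) * (2 ^ \<alpha> k * real ?D) \<le> (3 + 1 / 2 ^ k - \<eta>) * sum c I"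
      using Suc.prems(3,4) unfolding D[OF refl] A sumc by simp_all
  qed (use Suc.prems in \<open>simp_all add: \<eta>_def\<close>)
  then obtain T :: "'a set \<Rightarrow> nat set" where T: "disjoint_family_on T I" "(\<Union>J\<in>I. T J) = {y. y div ?D \<in> S}"
    "\<forall>J\<in>I. \<exists>q\<in>S. T J \<subseteq> {y. y div ?D = q}"
    "\<forall>J\<in>I. (2 - 1 / 2 ^ k) * c J \<le> real (card (T J)) * 2 ^ \<alpha> k \<and> real (card (T J)) * 2 ^ \<alpha> k \<le> (3 + 1 / 2 ^ k) * c J"
    by (elim exE conjE)
  have blk: "block k y div ?D = block (Suc k) y" for y
  proof -
    have "(2::nat) ^ \<alpha> (Suc k) = 2 ^ \<alpha> k * ?D" using \<alpha>_Suc[of k] by (simp flip: power_add)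
    then show ?thesis by (simp add: block_def div_mult2_eq)
  qed
  have "\<exists>g. matching k J {y. block k y \<in> T J} g" if J: "J \<in> I" for J
  proof -
    obtain z where z: "z \<in> V" "J = cls k z" using J KV by (auto simp: I_def)
    have "0 < card (cls k z)" using in_cls[OF z(1)] finite_class[OF z(1)] by (auto simp: card_gt_0_iff cls_def)
    then have "0 < (2 - 1 / 2 ^ k) * c J"
      unfolding c_def z(2) by (intro mult_pos_pos two_minus_inverse_power_pos) simp_all
    then have "0 < real (card (T J)) * (2::real) ^ \<alpha> k" using T(4) J by fastforce
    then have "finite (T J)" by (auto intro: card_ge_0_finite simp: zero_less_mult_iff)
    then show ?thesis using Suc.IH[OF z(1)] T(4) J unfolding z(2) c_def by auto
  qed
  then obtain G where G: "\<And>J. J \<in> I \<Longrightarrow> matching k J {y. block k y \<in> T J} (G J)" by metis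
  define idx where "idx y = (THE J. J \<in> I \<and> block k y \<in> T J)" for y
  have idx_eq: "idx y = J" if "J \<in> I" "block k y \<in> T J" for y J
    unfolding idx_def using that T(1) by (intro the_equality) (auto simp: disjoint_family_on_def)
  have idx: "idx y \<in> I \<and> block k y \<in> T (idx y)" if "block (Suc k) y \<in> S" for y
  proof -
    have "block k y \<in> (\<Union>J\<in>I. T J)" unfolding T(2) using that blk by simp
    then show ?thesis using idx_eq by auto
  qed
  have Tq: "block (Suc k) y \<in> S" if "J \<in> I" "block k y \<in> T J" for y J
  proof -
    have "block k y \<in> (\<Union>J\<in>I. T J)" using that by auto
    then show ?thesis unfolding T(2) using blk by simp
  qed
  define g where "g y = G (idx y) y" for y
  let ?Q = "{y. block (Suc k) y \<in> S}"
  have Gimg: "G J ` {y. block k y \<in> T J} = J" if "J \<in> I" for J using G[OF that] by (simp add: matching_def)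
  have g_idx: "g y \<in> idx y" if "y \<in> ?Q" for y
  proof -
    have "idx y \<in> I" "block k y \<in> T (idx y)" using idx that by auto
    then have "G (idx y) y \<in> G (idx y) ` {z. block k z \<in> T (idx y)}" by auto
    then show ?thesis unfolding Gimg[OF \<open>idx y \<in> I\<close>] g_def .
  qed
  have "matching (Suc k) ?K ?Q g"
    unfolding matching_def
  proof (intro conjI ballI allI impI)
    show "g ` ?Q = ?K"
    proof (intro equalityI subsetI)
      fix v assume "v \<in> g ` ?Q"
      then obtain y where y: "y \<in> ?Q" "v = g y" by auto
      then have "v \<in> \<Union>I" using g_idx[OF y(1)] idx[of y] by auto
      then show "v \<in> ?K" unfolding UI .
    next
      fix v assume "v \<in> ?K"
      then obtain J where J: "J \<in> I" "v \<in> J" unfolding UI[symmetric] by auto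
      then have "v \<in> G J ` {y. block k y \<in> T J}" using Gimg by simp
      then obtain y where y: "block k y \<in> T J" "v = G J y" by auto
      then have "v = g y" "y \<in> ?Q" using idx_eq[OF J(1) y(1)] Tq[OF J(1) y(1)] by (auto simp: g_def)
      then show "v \<in> g ` ?Q" by auto
    qed
  next
    fix y y' j assume y: "y \<in> ?Q" "y' \<in> ?Q" "j \<le> Suc k" "block j y = block j y'"
    show "eq j (g y) (g y')"
    proof (cases "j = Suc k")
      case True
      have "g y \<in> \<Union>I" "g y' \<in> \<Union>I" using g_idx[OF y(1)] g_idx[OF y(2)] idx y(1,2) by auto
      then have "eq (Suc k) x (g y)" "eq (Suc k) x (g y')" unfolding UI by (auto simp: cls_def)
      then show ?thesis using True eq_sym eq_trans by blast
    next
      case False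
      then have j: "j \<le> k" using y(3) by simp
      \<comment> \<open>Equal nodes of height \<open>\<alpha> k\<close> belong to the same
        subcomponent, so the matching of that subcomponent applies.\<close>
      have "block k y = block k y'" using block_mono[OF y(4) j] .
      then have same: "idx y = idx y'" by (simp add: idx_def)
      have "idx y \<in> I" "block k y \<in> T (idx y)" using idx[of y] y(1) by auto
      moreover have "block k y' \<in> T (idx y)" using idx[of y'] y(2) unfolding same by auto
      ultimately have "eq j (G (idx y) y) (G (idx y) y')" using matchingD(2)[OF G _ _ j y(4)] by simp
      then show ?thesis using same by (simp add: g_def)
    qed
  next
    fix y y' j assume y: "y \<in> ?Q" "y' \<in> ?Q" "j < Suc k" "eq j (g y) (g y')"
    have i: "idx y \<in> I" "block k y \<in> T (idx y)" "idx y' \<in> I" "block k y' \<in> T (idx y')" using idx y(1,2) by auto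
    obtain z where z: "idx y = cls k z" using i(1) by (auto simp: I_def)
    have "eq k (g y) (g y')" using eq_mono[OF y(4)] y(3) by simp
    moreover have "eq k z (g y)" using g_idx[OF y(1)] z by (simp add: cls_def)
    ultimately have "eq k z (g y')" using eq_trans by blast
    moreover have "g y' \<in> \<Union>I" using g_idx[OF y(2)] i(3) by auto
    then have "g y' \<in> V" unfolding UI using KV by auto
    ultimately have "g y' \<in> cls k z" by (simp add: cls_def)
    then have same: "idx y' = idx y" using disjI[OF i(3,1) g_idx[OF y(2)]] z by simp
    show "block (Suc j) y = block (Suc j) y'"
    \<comment> \<open>The case \<open>j = k\<close> is the new information: both leaves lie over one
      subcomponent, whose nodes are all below a single node of \<open>S\<close>.\<close>
    proof (cases "j = k")
      case True
      obtain q where q: "T (idx y) \<subseteq> {y. y div ?D = q}" using bspec[OF T(3) i(1)] by (rule bexE)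
      have "block k y div ?D = q" using subsetD[OF q i(2)] by simp
      moreover have "block k y' div ?D = q" using subsetD[OF q i(4)[unfolded same]] by simp
      ultimately have "block k y div ?D = block k y' div ?D" by simp
      then show ?thesis using True blk by simp
    next
      case False
      then have "j < k" using y(3) by simp
      moreover have "eq j (G (idx y) y) (G (idx y) y')" using y(4) same by (simp add: g_def)
      ultimately show ?thesis using matchingD(3)[OF G[OF i(1)], of y y' j] i(2,4) same by simp
    qed
  qed
  then show ?case by (rule exI[of _ g])
qed

lemma block_xor: "block k (y XOR z) = block k y XOR block k z"
  by (simp add: block_def flip: drop_bit_eq_div)

text \<open>An XOR translation of the leaves moves a leaf over \<open>x\<close> to 0. Then the node
  of 0 is matched as a whole, so the domains of these matchings exhaust the naturals as
  \<open>k\<close> grows.\<close>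

lemma pointed_matching:
  assumes "x \<in> V"
  shows "\<exists>g Q. matching k (cls k x) Q g \<and> {..<2 ^ \<alpha> k} \<subseteq> Q \<and> g 0 = x"
proof -
  define c where "c = 64 * real (card (cls k x))"
  \<comment> \<open>The least number of nodes with ratio at least 2. One node weighs at most
    \<open>c\<close>, so rounding up keeps the ratio at most 3, which is inside the window for every
    \<open>k\<close>.\<close>
  define m where "m = nat \<lceil>2 * c / 2 ^ \<alpha> k\<rceil>"
  have "2 ^ \<alpha> k * 2 ^ (k + 2) \<le> c" unfolding c_def cls_def using lower[OF assms] .
  moreover have "(2::real) ^ \<alpha> k * 1 \<le> 2 ^ \<alpha> k * 2 ^ (k + 2)" by (intro mult_left_mono one_le_power) auto
  ultimately have c: "2 ^ \<alpha> k \<le> c" by linarith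
  then have c0: "0 < c" by (rule less_le_trans[rotated]) simp
  have "real m = of_int \<lceil>2 * c / 2 ^ \<alpha> k\<rceil>" using c0 by (simp add: m_def)
  then have "2 * c / 2 ^ \<alpha> k \<le> real m" "real m \<le> 2 * c / 2 ^ \<alpha> k + 1" by linarith+
  then have m: "2 * c \<le> real m * 2 ^ \<alpha> k" "real m * 2 ^ \<alpha> k \<le> 2 * c + 2 ^ \<alpha> k"
    by (simp_all add: field_simps)
  have "(2 - 1 / 2 ^ k) * c \<le> 2 * c" "3 * c \<le> (3 + 1 / 2 ^ k) * c" using c0 by (simp_all add: mult_right_mono)
  then have "(2 - 1 / 2 ^ k) * c \<le> real (card {..<m}) * 2 ^ \<alpha> k" "real (card {..<m}) * 2 ^ \<alpha> k \<le> (3 + 1 / 2 ^ k) * c"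
    using m c by simp_all
  then obtain g where g: "matching k (cls k x) {y. block k y \<in> {..<m}} g"
    using matching_exists[OF assms, of "{..<m}" k] unfolding c_def by auto
  let ?Q = "{y. block k y \<in> {..<m}}"
  have "x \<in> g ` ?Q" using g in_cls[OF assms] by (simp add: matching_def)
  then obtain z where z: "z \<in> ?Q" "g z = x" by auto
  \<comment> \<open>XOR acts on each binary digit separately and so permutes the nodes of every
    height; addition would not, because of carries.\<close>
  define h where "h y = g (y XOR z)" for y
  define R where "R = {y. y XOR z \<in> ?Q}"
  have xx: "(y XOR z) XOR z = y" for y by (simp add: xor.assoc)
  have "matching k (cls k x) R h"
    unfolding matching_def
  proof (intro conjI ballI allI impI)
    have "h ` R = g ` ?Q"
    proof (intro equalityI subsetI)
      fix v assume "v \<in> g ` ?Q"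
      then obtain y where y: "y \<in> ?Q" "v = g y" by auto
      then have "y XOR z \<in> R" "h (y XOR z) = v" by (simp_all add: R_def h_def xx)
      then show "v \<in> h ` R" by blast
    qed (auto simp: h_def R_def)
    then show "h ` R = cls k x" using g by (simp add: matching_def)
  next
    fix y y' j assume "y \<in> R" "y' \<in> R" "j \<le> k" "block j y = block j y'"
    then show "eq j (h y) (h y')" using matchingD(2)[OF g] unfolding h_def R_def by (simp add: block_xor)
  next
    fix y y' j assume y: "y \<in> R" "y' \<in> R" "j < k" "eq j (h y) (h y')"
    then have "block (Suc j) (y XOR z) = block (Suc j) (y' XOR z)"
      using matchingD(3)[OF g, of "y XOR z" "y' XOR z" j] unfolding h_def R_def by simp
    then have "block (Suc j) ((y XOR z) XOR z) = block (Suc j) ((y' XOR z) XOR z)" by (simp only: block_xor)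
    then show "block (Suc j) y = block (Suc j) y'" unfolding xx .
  qed
  moreover have "{..<2 ^ \<alpha> k} \<subseteq> R"
  proof
    fix y :: nat assume "y \<in> {..<2 ^ \<alpha> k}"
    then have "block k y = 0" by (simp add: block_def)
    then have "block k (y XOR z) = block k z" by (simp add: block_xor)
    then show "y \<in> R" using z(1) by (simp add: R_def)
  qed
  moreover have "h 0 = x" using z(2) by (simp add: h_def)
  ultimately show ?thesis by blast
qed

text \<open>The matchings of ever larger classes converge along a free ultrafilter.\<close>

lemma global_matching:
  "\<exists>g. range g = V \<and> (\<forall>j y y'. block j y = block j y' \<longrightarrow> eq j (g y) (g y')) \<and>
    (\<forall>j y y'. eq j (g y) (g y') \<longrightarrow> block (Suc j) y = block (Suc j) y')"
proof -
  obtain a where a: "a \<in> V" using nonempty by auto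
  obtain h Q where h: "\<And>n. matching n (cls n a) (Q n) (h n)" "\<And>n. {..<2 ^ \<alpha> n} \<subseteq> Q n" "\<And>n. h n 0 = a"
    using pointed_matching[OF a] by metis
  have h1: "h n ` Q n = cls n a" for n using h(1) by (simp add: matching_def)
  have h2: "eq j (h n y) (h n y')" if "y \<in> Q n" "y' \<in> Q n" "j \<le> n" "block j y = block j y'" for n j y y'
    using matchingD[OF h(1)[of n]] that by blast
  have h3: "block (Suc j) y = block (Suc j) y'" if "y \<in> Q n" "y' \<in> Q n" "j < n" "eq j (h n y) (h n y')" for n j y y'
    using matchingD[OF h(1)[of n]] that by blast
  have dom: "y \<in> Q n" if "y \<le> n" for y n
  proof -
    have "y < 2 ^ y" by (rule less_exp)
    also have "(2::nat) ^ y \<le> 2 ^ \<alpha> n" using that \<alpha>_ge[of n] by (intro power_increasing) auto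
    finally show ?thesis using h(2) by auto
  qed
  obtain p where p: "free_ultrafilter p" using free_ultrafilter_extend[of UNIV] by auto
  then have u: "ultrafilter_on UNIV p" by (simp add: free_ultrafilter_def)
  have tail: "{n0..} \<in> p" for n0
  proof -
    have "UNIV - {n0..} = {..<n0}" by auto
    then have "finite (UNIV - {n0..})" by simp
    then show ?thesis using free_ultrafilter_cofinite[OF p ultrafilter_onD(2)[OF u]] by blast
  qed
  \<comment> \<open>The leaves 0 and \<open>y\<close> share their node of height
    \<open>\<alpha> y\<close>, so from stage \<open>y\<close> on the image of \<open>y\<close> stays
    in the finite class \<open>cls y a\<close>, and the ultrafilter selects one value.\<close>
  have conv: "\<exists>v. {n. h n y = v} \<in> p" for y
  proof -
    have "(\<Union>v\<in>cls y a. {n. h n y = v}) \<in> p"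
    proof (rule ultrafilter_onD(5)[OF u tail[of y]])
      show "{y..} \<subseteq> (\<Union>v\<in>cls y a. {n. h n y = v})"
      proof
        fix n assume "n \<in> {y..}"
        then have n: "y \<le> n" by simp
        have "y < 2 ^ y" by (rule less_exp)
        also have "(2::nat) ^ y \<le> 2 ^ \<alpha> y" using \<alpha>_ge[of y] by (intro power_increasing) auto
        finally have "block y 0 = block y y" by (simp add: block_def)
        then have "eq y (h n 0) (h n y)" using h2[OF dom dom n] n by simp
        moreover have "h n y \<in> V" using h1[of n] dom[OF n] by (auto simp: cls_def)
        ultimately show "n \<in> (\<Union>v\<in>cls y a. {n. h n y = v})" using h(3) by (simp add: cls_def)
      qed
    qed simp
    then have "\<exists>v\<in>cls y a. {n. h n y = v} \<in> p"
      using ultrafilter_on_UN[OF u, of "cls y a" "\<lambda>v. {n. h n y = v}"] finite_class[OF a] by (simp add: cls_def)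
    then show ?thesis by blast
  qed
  define g where "g y = (SOME v. {n. h n y = v} \<in> p)" for y
  have g: "{n. h n y = g y} \<in> p" for y unfolding g_def by (rule someI_ex[OF conv])
  have pick: "\<exists>n\<ge>n0. h n y = g y \<and> h n y' = g y'" for n0 y y'
  proof -
    have "{n0..} \<inter> ({n. h n y = g y} \<inter> {n. h n y' = g y'}) \<in> p"
      by (intro ultrafilter_onD(4)[OF u] tail g)
    then have "{n0..} \<inter> ({n. h n y = g y} \<inter> {n. h n y' = g y'}) \<noteq> {}" using ultrafilter_onD(3)[OF u] by metis
    then show ?thesis by auto
  qed
  have "eq j (g y) (g y')" if b: "block j y = block j y'" for j y y'
  proof -
    obtain n where n: "max j (max y y') \<le> n" "h n y = g y" "h n y' = g y'" using pick by metis
    then show ?thesis using h2[OF dom dom _ b, of n] by simp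
  qed
  moreover have "block (Suc j) y = block (Suc j) y'" if e: "eq j (g y) (g y')" for j y y'
  proof -
    obtain n where n: "max (Suc j) (max y y') \<le> n" "h n y = g y" "h n y' = g y'" using pick by metis
    then show ?thesis using h3[of y n y' j] dom e by simp
  qed
  moreover have "range g = V"
  proof (intro equalityI subsetI)
    fix v assume "v \<in> range g"
    then obtain y where y: "v = g y" by auto
    obtain n where n: "y \<le> n" "h n y = g y" using pick by metis
    have "h n y \<in> cls n a" using imageI[OF dom[OF n(1)], of "h n"] unfolding h1 .
    then have "g y \<in> cls n a" unfolding n(2) .
    then show "v \<in> V" using y by (simp add: cls_def)
  next
    fix v assume v: "v \<in> V"
    obtain j where j: "eq j a v" using eq_exists[OF a v] by auto
    \<comment> \<open>At every late stage \<open>v\<close> has a preimage, and it shares the node of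
      height \<open>\<alpha> (Suc j)\<close> with 0 because \<open>v\<close> and \<open>a\<close>
      are equivalent at level \<open>j\<close>. So only finitely many leaves compete, and one of
      them is chosen for almost all stages.\<close>
    have "(\<Union>y\<in>{..<2 ^ \<alpha> (Suc j)}. {n. h n y = v}) \<in> p"
    proof (rule ultrafilter_onD(5)[OF u tail[of "Suc j"]])
      show "{Suc j..} \<subseteq> (\<Union>y\<in>{..<2 ^ \<alpha> (Suc j)}. {n. h n y = v})"
      proof
        fix n assume "n \<in> {Suc j..}"
        then have n: "j < n" by simp
        have "v \<in> h n ` Q n" unfolding h1 using v eq_mono[OF j] n by (simp add: cls_def)
        then obtain y where y: "y \<in> Q n" "h n y = v" by auto
        have "eq j (h n y) (h n 0)" using j y(2) h(3) eq_sym by simp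
        then have "block (Suc j) y = block (Suc j) 0" using h3[OF y(1) dom n] by simp
        then have "y < 2 ^ \<alpha> (Suc j)" by (simp add: block_def div_eq_0_iff)
        then show "n \<in> (\<Union>y\<in>{..<2 ^ \<alpha> (Suc j)}. {n. h n y = v})" using y(2) by auto
      qed
    qed simp
    then have "\<exists>y\<in>{..<2 ^ \<alpha> (Suc j)}. {n. h n y = v} \<in> p"
      by (intro ultrafilter_on_UN[OF u]) auto
    then obtain y where "{n. h n y = v} \<in> p" by blast
    then have "{n. h n y = v} \<inter> {n. h n y = g y} \<in> p" by (rule ultrafilter_onD(4)[OF u _ g])
    then have "{n. h n y = v} \<inter> {n. h n y = g y} \<noteq> {}" using ultrafilter_onD(3)[OF u] by metis
    then have "v = g y" by auto
    then show "v \<in> range g" by simp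
  qed
  ultimately show ?thesis by (intro exI[of _ g] conjI allI impI)
qed

end

section \<open>Recognizing the macro-cube\<close>

text \<open>Identifies the leaves with the points of the macro-cube; the leaves below a node of
  height \<open>k\<close> then form a ball of radius \<open>2 ^ k\<close>.\<close>

definition binary_point :: "nat \<Rightarrow> nat \<Rightarrow> nat" where
  "binary_point y i = of_bool (bit y i)"

lemma binary_point_in: "binary_point y \<in> macro_cube_carrier"
proof -
  have "binary_point y m = 0" if "y \<le> m" for m
  proof -
    have "y < 2 ^ m" using that less_exp[of m] by linarith
    then show ?thesis by (simp add: binary_point_def bit_iff_odd)
  qed
  then show ?thesis by (auto simp: macro_cube_carrier_def binary_point_def)
qed

lemma tail_eq_binary_point: "tail_eq k (binary_point y) (binary_point y') \<longleftrightarrow> y div 2 ^ k = y' div 2 ^ k"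
proof -
  have "y div 2 ^ k = y' div 2 ^ k \<longleftrightarrow> (\<forall>i. bit y (k + i) = bit y' (k + i))"
    unfolding drop_bit_eq_div[symmetric] bit_eq_iff by (simp add: bit_drop_bit_eq)
  also have "\<dots> \<longleftrightarrow> (\<forall>m\<ge>k. bit y m = bit y' m)" by (metis le_add1 le_iff_add)
  finally show ?thesis by (auto simp: tail_eq_def binary_point_def of_bool_eq_iff)
qed

lemma binary_point_surj:
  assumes "z \<in> macro_cube_carrier"
  shows "\<exists>y. binary_point y = z"
proof -
  obtain n where n: "\<And>m. n \<le> m \<Longrightarrow> z m = 0" and z: "\<And>m. z m \<in> {0, 1}"
    using assms by (auto simp: macro_cube_carrier_def)
  let ?y = "horner_sum of_bool 2 (map (\<lambda>i. z i = 1) [0..<n]) :: nat"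
  have "binary_point ?y i = z i" for i
  proof (cases "i < n")
    case True
    then have "bit ?y i \<longleftrightarrow> z i = 1" by (simp add: bit_horner_sum_bit_iff)
    then show ?thesis using z[of i] by (auto simp: binary_point_def)
  next
    case False
    then show ?thesis using n[of i] by (simp add: binary_point_def bit_horner_sum_bit_iff)
  qed
  then show ?thesis by blast
qed

section \<open>Components at growing scales and the coarse equivalence\<close>

context unbounded_space
begin

text \<open>The condition \<open>x \<in> M\<close> removes the reflexive pairs outside the
  space.\<close>

definition con :: "real \<Rightarrow> 'a \<Rightarrow> 'a \<Rightarrow> bool" where
  "con r x y \<longleftrightarrow> x \<in> M \<and> (x, y) \<in> (scale_graph r)\<^sup>*"

lemma con_in: "con r x y \<Longrightarrow> x \<in> M \<and> y \<in> M"
proof -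
  have "y \<in> M" if "(x, y) \<in> (scale_graph r)\<^sup>*" "x \<in> M"
    using that by (induction rule: rtrancl_induct) (auto simp: scale_graph_def)
  then show "con r x y \<Longrightarrow> x \<in> M \<and> y \<in> M" by (auto simp: con_def)
qed

lemma con_refl: "x \<in> M \<Longrightarrow> con r x x"
  by (simp add: con_def)

lemma con_sym: "con r x y \<Longrightarrow> con r y x"
proof -
  assume xy: "con r x y"
  have "sym (scale_graph r)" by (auto simp: sym_def scale_graph_def commute)
  then have "(y, x) \<in> (scale_graph r)\<^sup>*" using xy sym_rtrancl[of "scale_graph r"] by (auto simp: con_def dest: symD)
  then show ?thesis using con_in[OF xy] by (simp add: con_def)
qed

lemma con_trans: "con r x y \<Longrightarrow> con r y z \<Longrightarrow> con r x z"
  by (auto simp: con_def)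

lemma con_mono:
  assumes "con r x y" "r \<le> r'"
  shows "con r' x y"
proof -
  have "scale_graph r \<subseteq> scale_graph r'" using assms(2) by (auto simp: scale_graph_def)
  then show ?thesis using assms(1) rtrancl_mono unfolding con_def by blast
qed

lemma con_dist: "x \<in> M \<Longrightarrow> y \<in> M \<Longrightarrow> d x y \<le> r \<Longrightarrow> con r x y"
  by (auto simp: con_def scale_graph_def)

text \<open>The space is replaced by a net \<open>V\<close> with one point in each
  \<open>r0\<close>-component. Bounded geometry bounds the number of net points in a component of
  any scale from above, and the absence of isolated balls makes it grow uniformly; so scales and
  heights can be chosen to form a level structure. Its global matching, read through binary digits,
  and a section of it are the two coarse maps.\<close>

lemma coarsely_equivalent_macro_cube:
  assumes zero_dim: asymp_zero_dim and bg: "bounded_geometry X"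
    and noniso: "\<And>e. \<exists>\<delta>. \<forall>x\<in>M. \<exists>y\<in>M. e < d x y \<and> d x y \<le> \<delta>"
  shows "coarsely_equivalent X cantor_macro_cube"
proof -
  have "\<exists>D. \<forall>x y. con r x y \<longrightarrow> d x y \<le> D" for r
    using zero_dim unfolding asymp_zero_dim_def con_def by metis
  then obtain D where D: "\<And>r x y. con r x y \<Longrightarrow> d x y \<le> D r" by metis
  obtain e0 where e0: "\<And>\<delta>. \<exists>N. \<forall>x\<in>M. \<exists>C\<subseteq>M. finite C \<and> card C \<le> N \<and> mcball x \<delta> \<subseteq> (\<Union>c\<in>C. mcball c e0)"
    using bg unfolding bounded_geometry_def mcball_of_def by auto
  \<comment> \<open>Net points in a common ball of radius \<open>e0\<close> are at most
    \<open>2 * e0\<close> apart, hence in one \<open>r0\<close>-component and equal. So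
    \<open>e0\<close>-balls covering a component bound the number of its net points. The maximum
    with 0 starts the estimate \<open>real k \<le> r k\<close>.\<close>
  define r0 where "r0 = max (2 * e0) 0"
  define rep where "rep x = (SOME z. con r0 x z)" for x
  have rep: "con r0 x (rep x)" if "x \<in> M" for x unfolding rep_def by (rule someI[of _ x]) (rule con_refl[OF that])
  have rep_eq: "rep x = rep y" if "con r0 x y" for x y
  proof -
    have "con r0 x = con r0 y" using that con_trans con_sym by blast
    then show ?thesis by (simp add: rep_def)
  qed
  define V where "V = rep ` M"
  have VM: "V \<subseteq> M" using rep con_in by (auto simp: V_def)
  have repV: "rep x \<in> V" if "x \<in> M" for x using that by (simp add: V_def)
  have rep_id: "rep v = v" if "v \<in> V" for v
    using that rep_eq[OF rep] by (auto simp: V_def)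
  have Veq: "v = w" if "v \<in> V" "w \<in> V" "con r0 v w" for v w using rep_eq[OF that(3)] rep_id that by simp
  define K where "K r x = {v\<in>V. con r x v}" for r x
  have K_bound: "\<exists>N. \<forall>x\<in>M. finite (K r x) \<and> card (K r x) \<le> N" for r
  proof -
    obtain N where N: "\<And>x. x \<in> M \<Longrightarrow> \<exists>C\<subseteq>M. finite C \<and> card C \<le> N \<and> mcball x (D r) \<subseteq> (\<Union>c\<in>C. mcball c e0)"
      using e0[of "D r"] by auto
    have "finite (K r x) \<and> card (K r x) \<le> N" if x: "x \<in> M" for x
    proof -
      obtain C where C: "C \<subseteq> M" "finite C" "card C \<le> N" "mcball x (D r) \<subseteq> (\<Union>c\<in>C. mcball c e0)"
        using N[OF x] by (elim exE conjE)
      have "\<exists>c\<in>C. v \<in> mcball c e0" if "v \<in> K r x" for v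
      proof -
        have "v \<in> mcball x (D r)" using that D[of r x v] VM x by (auto simp: K_def in_mcball)
        then show ?thesis using C(4) by blast
      qed
      then obtain h where h: "\<And>v. v \<in> K r x \<Longrightarrow> h v \<in> C \<and> v \<in> mcball (h v) e0" by metis
      have "inj_on h (K r x)"
      proof (rule inj_onI)
        fix v w assume vw: "v \<in> K r x" "w \<in> K r x" "h v = h w"
        have m: "d (h v) v \<le> e0" "d (h v) w \<le> e0" "h v \<in> M" "v \<in> M" "w \<in> M"
          using h[OF vw(1)] h[OF vw(2)] vw(3) by (auto simp: in_mcball)
        then have "d v w \<le> r0" using triangle[of v "h v" w] commute[of v "h v"] unfolding r0_def by linarith
        then show "v = w" using Veq con_dist m vw by (auto simp: K_def)
      qed
      moreover have "h ` K r x \<subseteq> C" using h by auto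
      ultimately have "finite (K r x)" "card (K r x) \<le> card C"
        using C(2) inj_on_finite card_inj_on_le by blast+
      then show ?thesis using C(3) by simp
    qed
    then show ?thesis by blast
  qed
  have K_self: "rep x \<in> K r x" if "x \<in> M" "r0 \<le> r" for x r
    using con_mono[OF rep[OF that(1)] that(2)] repV[OF that(1)] by (simp add: K_def)
  have K_pos: "0 < card (K r x)" if "x \<in> M" "r0 \<le> r" for x r
    using K_self[OF that] K_bound[of r] that(1) by (auto simp: card_gt_0_iff)
  \<comment> \<open>A neighbour at distance more than \<open>D s\<close> lies in another
    \<open>s\<close>-component; enlarging the scale until it is included adds at least one net point
    to every component.\<close>
  have growth: "\<exists>r'\<ge>r. \<forall>x\<in>M. n \<le> card (K r' x)" if "r0 \<le> r" for r n
  proof (induction n)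
    case (Suc n)
    obtain s where s: "r \<le> s" "\<And>x. x \<in> M \<Longrightarrow> n \<le> card (K s x)" using Suc by auto
    obtain \<delta> where \<delta>: "\<And>x. x \<in> M \<Longrightarrow> \<exists>y\<in>M. D s < d x y \<and> d x y \<le> \<delta>" using noniso by metis
    let ?s = "max s \<delta>"
    have "Suc n \<le> card (K ?s x)" if x: "x \<in> M" for x
    proof -
      obtain y where y: "y \<in> M" "D s < d x y" "d x y \<le> \<delta>" using \<delta>[OF x] by auto
      have xy: "con ?s x y" using con_dist x y by simp
      have "\<not> con s x y" using D[of s x y] y(2) by auto
      moreover have "r0 \<le> s" using \<open>r0 \<le> r\<close> s(1) by linarith
      then have "con s y (rep y)" using con_mono[OF rep[OF y(1)]] by simp
      ultimately have "rep y \<notin> K s x" using con_trans con_sym unfolding K_def by blast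
      moreover have "rep y \<in> K ?s x"
      proof -
        have "con ?s y (rep y)" using \<open>con s y (rep y)\<close> con_mono by simp
        then show ?thesis using con_trans[OF xy] repV[OF y(1)] by (simp add: K_def)
      qed
      moreover have "K s x \<subseteq> K ?s x" using con_mono by (auto simp: K_def)
      ultimately have "K s x \<subset> K ?s x" by blast
      then have "card (K s x) < card (K ?s x)" using K_bound[of ?s] x by (metis psubset_card_mono)
      then show ?thesis using s(2)[OF x] by simp
    qed
    then show ?case using s(1) by (intro exI[of _ ?s]) auto
  qed auto
  \<comment> \<open>A pair consists of a scale and a height. \<open>good\<close> carries the lower
    bound of the level structure and fixes the start, \<open>nxt\<close> carries the upper
    bound.\<close>
  define good where "good k s \<longleftrightarrow> r0 \<le> fst s \<and> (k = 0 \<longrightarrow> s = (r0, 0)) \<and>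
    (\<forall>x\<in>M. 2 ^ snd s * 2 ^ (k + 2) \<le> 64 * real (card (K (fst s) x)))" for k and s :: "real \<times> nat"
  define nxt where "nxt k s s' \<longleftrightarrow> fst s + 1 \<le> fst s' \<and> snd s < snd s' \<and>
    (\<forall>x\<in>M. 64 * real (card (K (fst s) x)) * 2 ^ (k + 6) \<le> 2 ^ snd s')" for k and s s' :: "real \<times> nat"
  have "\<exists>s. \<forall>k. good k (s k) \<and> nxt k (s k) (s (Suc k))"
  proof (rule dependent_nat_choice)
    have "(4::real) \<le> 64 * real (card (K r0 x))" if "x \<in> M" for x
      using K_pos[OF that, of r0] by linarith
    then show "\<exists>s. good 0 s" by (intro exI[of _ "(r0, 0)"]) (simp add: good_def)
  next
    fix s k assume s: "good k s"
    obtain N where N: "\<And>x. x \<in> M \<Longrightarrow> card (K (fst s) x) \<le> N" using K_bound[of "fst s"] by auto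
    obtain j where j: "64 * real N * 2 ^ (k + 6) \<le> 2 ^ j" using real_le_two_power by auto
    \<comment> \<open>The height is chosen against the component sizes at the old scale; only then
      is the new scale taken large enough for this height.\<close>
    define \<alpha>' where "\<alpha>' = max j (Suc (snd s))"
    have "r0 \<le> fst s + 1" using s by (simp add: good_def)
    then obtain r' where r': "fst s + 1 \<le> r'" "\<And>x. x \<in> M \<Longrightarrow> 2 ^ \<alpha>' * 2 ^ (Suc k + 2) \<le> card (K r' x)"
      using growth[of "fst s + 1" "2 ^ \<alpha>' * 2 ^ (Suc k + 2)"] by auto
    have "2 ^ \<alpha>' * 2 ^ (Suc k + 2) \<le> 64 * real (card (K r' x))" if "x \<in> M" for x
    proof -
      have "real (2 ^ \<alpha>' * 2 ^ (Suc k + 2)) \<le> real (card (K r' x))" using r'(2)[OF that] by (rule of_nat_mono)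
      then show ?thesis by simp
    qed
    then have "good (Suc k) (r', \<alpha>')" using r'(1) \<open>r0 \<le> fst s + 1\<close> by (simp add: good_def)
    moreover have "64 * real (card (K (fst s) x)) * 2 ^ (k + 6) \<le> 2 ^ \<alpha>'" if "x \<in> M" for x
    proof -
      have "64 * real (card (K (fst s) x)) * 2 ^ (k + 6) \<le> 64 * real N * 2 ^ (k + 6)"
        using N[OF that] by (intro mult_right_mono mult_left_mono) auto
      also have "\<dots> \<le> 2 ^ j" by (rule j)
      also have "(2::real) ^ j \<le> 2 ^ \<alpha>'" by (intro power_increasing) (auto simp: \<alpha>'_def)
      finally show ?thesis .
    qed
    then have "nxt k s (r', \<alpha>')" using r'(1) by (simp add: nxt_def \<alpha>'_def)
    ultimately show "\<exists>s'. good (Suc k) s' \<and> nxt k s s'" by blast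
  qed
  then obtain s where s: "\<And>k. good k (s k)" "\<And>k. nxt k (s k) (s (Suc k))" by auto
  define r where "r k = fst (s k)" for k
  define \<alpha> where "\<alpha> k = snd (s k)" for k
  have r_Suc: "r k + 1 \<le> r (Suc k)" and \<alpha>_Suc: "\<alpha> k < \<alpha> (Suc k)" for k
    using s(2)[of k] by (simp_all add: nxt_def r_def \<alpha>_def)
  have r_ge: "r0 \<le> r k" for k using s(1)[of k] by (simp add: good_def r_def)
  have zero: "r 0 = r0" "\<alpha> 0 = 0" using s(1)[of 0] by (simp_all add: good_def r_def \<alpha>_def)
  have r_large: "real k \<le> r k" for k
  proof (induction k)
    case 0
    then show ?case using zero by (simp add: r0_def)
  next
    case (Suc k)
    then show ?case using r_Suc[of k] by simp
  qed
  interpret level_structure V "\<lambda>k. con (r k)" \<alpha>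
  proof
    show "V \<noteq> {}" using base by (auto simp: V_def)
    show "con (r k) x x" if "x \<in> V" for k x using con_refl VM that by blast
    show "con (r k) x y \<Longrightarrow> con (r k) y x" for k x y by (rule con_sym)
    show "con (r k) x y \<Longrightarrow> con (r k) y z \<Longrightarrow> con (r k) x z" for k x y z by (rule con_trans)
    show "con (r k) x y \<Longrightarrow> con (r (Suc k)) x y" for k x y using con_mono r_Suc[of k] by simp
    show "x \<in> V \<Longrightarrow> y \<in> V \<Longrightarrow> con (r 0) x y \<Longrightarrow> x = y" for x y using Veq zero by simp
    show "\<exists>k. con (r k) x y" if "x \<in> V" "y \<in> V" for x y
    proof -
      have "d x y \<le> r (nat \<lceil>d x y\<rceil>)" using r_large[of "nat \<lceil>d x y\<rceil>"] by linarith
      then show ?thesis using con_dist VM that by blast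
    qed
    show "\<alpha> 0 = 0" by (rule zero)
    show "\<alpha> k < \<alpha> (Suc k)" for k by (rule \<alpha>_Suc)
    fix k x assume "x \<in> V"
    then have x: "x \<in> M" using VM by auto
    show "finite {y\<in>V. con (r k) x y}" using K_bound[of "r k"] x by (auto simp: K_def)
    show "2 ^ \<alpha> k * 2 ^ (k + 2) \<le> 64 * real (card {y\<in>V. con (r k) x y})"
      using s(1)[of k] x by (simp add: good_def K_def r_def \<alpha>_def)
    show "64 * real (card {y\<in>V. con (r k) x y}) * 2 ^ (k + 6) \<le> 2 ^ \<alpha> (Suc k)"
      using s(2)[of k] x by (simp add: nxt_def K_def r_def \<alpha>_def)
  qed
  obtain g where g: "range g = V" "\<And>j y y'. block j y = block j y' \<Longrightarrow> con (r j) (g y) (g y')"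
    "\<And>j y y'. con (r j) (g y) (g y') \<Longrightarrow> block (Suc j) y = block (Suc j) y'"
    using global_matching by (elim exE conjE) blast
  define f where "f v = (SOME y. g y = v)" for v
  have f: "g (f v) = v" if "v \<in> V" for v
    unfolding f_def by (rule someI_ex) (use that g(1) in auto)
  have gV: "g y \<in> V" for y using g(1) by auto
  define dec where "dec z = (SOME y. binary_point y = z)" for z
  have dec: "binary_point (dec z) = z" if "z \<in> macro_cube_carrier" for z
    unfolding dec_def by (rule someI_ex[OF binary_point_surj[OF that]])
  have close: "macro_cube_dist (binary_point y) (binary_point y') \<le> 2 ^ \<alpha> k \<longleftrightarrow> block k y = block k y'" for k y y'
    using macro_cube_dist_le_power_iff[OF binary_point_in binary_point_in] tail_eq_binary_point by (simp add: block_def)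
  define F where "F x = binary_point (f (rep x))" for x
  define G where "G z = g (dec z)" for z
  have "coarse_map X cantor_macro_cube F"
    unfolding coarse_map_def
  proof (intro conjI allI)
    show "F \<in> M \<rightarrow> mspace cantor_macro_cube" using binary_point_in by (simp add: F_def)
    fix \<delta> :: real
    define k where "k = nat \<lceil>\<delta>\<rceil>"
    have k: "\<delta> \<le> r k" using r_large[of k] unfolding k_def by linarith
    \<comment> \<open>The height with index \<open>Suc k\<close> in place of \<open>k\<close> is the
      level lost by the matching.\<close>
    have "macro_cube_dist (F x) (F x') \<le> 2 ^ \<alpha> (Suc k)" if x: "x \<in> M" "x' \<in> M" "d x x' \<le> \<delta>" for x x'
    proof -
      have "con (r k) x x'" using con_dist x k by simp
      moreover have "con (r k) x (rep x)" "con (r k) x' (rep x')" using con_mono[OF rep r_ge] x by auto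
      ultimately have "con (r k) (rep x) (rep x')" using con_trans con_sym by blast
      then have "con (r k) (g (f (rep x))) (g (f (rep x')))" using f repV x by simp
      then show ?thesis unfolding F_def close by (rule g(3))
    qed
    then show "\<exists>\<epsilon>. \<forall>x\<in>M. \<forall>x'\<in>M. d x x' \<le> \<delta> \<longrightarrow> mdist cantor_macro_cube (F x) (F x') \<le> \<epsilon>" by auto
  qed
  moreover have "coarse_map cantor_macro_cube X G"
    unfolding coarse_map_def
  proof (intro conjI allI)
    show "G \<in> mspace cantor_macro_cube \<rightarrow> M" using gV VM by (auto simp: G_def)
    fix \<delta> :: real
    obtain k where "\<delta> \<le> 2 ^ k" using real_le_two_power by auto
    also have "(2::real) ^ k \<le> 2 ^ \<alpha> k" using \<alpha>_ge by (intro power_increasing) auto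
    finally have k: "\<delta> \<le> 2 ^ \<alpha> k" .
    have "d (G z) (G z') \<le> D (r k)"
      if z: "z \<in> macro_cube_carrier" "z' \<in> macro_cube_carrier" "macro_cube_dist z z' \<le> \<delta>" for z z'
    proof -
      have "macro_cube_dist (binary_point (dec z)) (binary_point (dec z')) \<le> 2 ^ \<alpha> k" using dec z k by simp
      then have "block k (dec z) = block k (dec z')" unfolding close .
      then show ?thesis unfolding G_def by (intro D g(2))
    qed
    then show "\<exists>\<epsilon>. \<forall>z\<in>mspace cantor_macro_cube. \<forall>z'\<in>mspace cantor_macro_cube.
        mdist cantor_macro_cube z z' \<le> \<delta> \<longrightarrow> d (G z) (G z') \<le> \<epsilon>" by auto
  qed
  moreover have "macro_cube_dist (F (G z)) z \<le> 2 ^ \<alpha> 1" if z: "z \<in> macro_cube_carrier" for z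
  proof -
    let ?y = "dec z"
    have "con (r 0) (g (f (g ?y))) (g ?y)" 
      unfolding f[OF gV] by (rule con_refl[OF subsetD[OF VM gV]])
    then have "block (Suc 0) (f (g ?y)) = block (Suc 0) ?y" by (rule g(3))
    then have "macro_cube_dist (binary_point (f (g ?y))) (binary_point ?y) \<le> 2 ^ \<alpha> 1" unfolding close by simp
    then show ?thesis using dec[OF z] rep_id[OF gV] by (simp add: F_def G_def)
  qed
  moreover have "d (G (F x)) x \<le> D r0" if x: "x \<in> M" for x
  proof -
    have "macro_cube_dist (binary_point (dec (F x))) (binary_point (f (rep x))) \<le> 2 ^ \<alpha> 0"
      using dec[of "F x"] binary_point_in macro_cube_dist_le_power_iff[of "F x" "F x" "\<alpha> 0"] by (simp add: F_def)
    then have "con (r 0) (g (dec (F x))) (g (f (rep x)))" unfolding close by (rule g(2))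
    then have "con r0 (G (F x)) (rep x)" using f[OF repV[OF x]] zero by (simp add: G_def)
    then have "con r0 (G (F x)) x" using con_trans con_sym[OF rep[OF x]] by blast
    then show ?thesis by (rule D)
  qed
  ultimately show ?thesis
    unfolding coarsely_equivalent_def
    by (intro exI[of _ F] exI[of _ G] conjI exI[of _ "max (2 ^ \<alpha> 1) (D r0)"]) (auto simp: le_max_iff_disj)
qed

end

theorem theorem1p3:
  fixes X :: "'a metric"
  assumes "ultrafilter_number <o dominating_number"
    and "unbounded_metric X"
    and "bounded_geometry X"
  shows "(coarsely_equivalent X cantor_macro_cube \<longleftrightarrow>
            corona X homeomorphic_space corona cantor_macro_cube) \<and>
         (corona X homeomorphic_space corona cantor_macro_cube \<longleftrightarrow>
            covering_dim (corona X) = 0 \<and> min_character (corona X) =o dominating_number)"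
proof -
  let ?C = "corona cantor_macro_cube"
  obtain a where "unbounded_space X a" using unbounded_metric_imp_locale[OF assms(2)] by auto
  then interpret unbounded_space X a .
  have ne: "topspace (corona X) \<noteq> {}" "topspace ?C \<noteq> {}"
    using topspace_corona_nonempty macro_cube.topspace_corona_nonempty by simp_all
  have ud: "ultrafilter_number \<le>o dominating_number" using assms(1) ordLess_imp_ordLeq by blast
  have 12: "corona X homeomorphic_space ?C" if "coarsely_equivalent X cantor_macro_cube"
    by (rule coarsely_equivalent_corona[OF unbounded_space_axioms macro_cube.unbounded_space_axioms that])
  have 23: "covering_dim (corona X) = 0 \<and> min_character (corona X) =o dominating_number"
    if hom: "corona X homeomorphic_space ?C"
  proof
    have hom': "?C homeomorphic_space corona X" using hom homeomorphic_space_sym by blast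
    show "covering_dim (corona X) = 0"
      unfolding covering_dim_eq_0_iff[OF ne(1)]
      by (rule homeomorphic_covering_dim_le[OF hom' covering_dim_le_macro_cube])
    have "min_character (corona X) =o min_character ?C"
      using homeomorphic_min_character_le[OF hom ne(1)] homeomorphic_min_character_le[OF hom' ne(2)]
      by (simp add: ordIso_iff_ordLeq)
    then show "min_character (corona X) =o dominating_number"
      using macro_cube_min_character[OF ud] by (rule ordIso_transitive)
  qed
  have 31: "coarsely_equivalent X cantor_macro_cube"
    if dim: "covering_dim (corona X) = 0" and char: "min_character (corona X) =o dominating_number"
  proof (rule coarsely_equivalent_macro_cube[OF _ assms(3)])
    show asymp_zero_dim
      using asymp_zero_dim_if_covering_dim dim unfolding covering_dim_eq_0_iff[OF ne(1)] .
    show "\<exists>\<delta>. \<forall>x\<in>M. \<exists>y\<in>M. e < d x y \<and> d x y \<le> \<delta>" for e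
    proof (rule ccontr)
      assume "\<not> ?thesis"
      then have "\<exists>x\<in>M. \<forall>y\<in>M. d x y \<le> \<delta> \<longrightarrow> d x y \<le> e" for \<delta> by (meson not_le)
      then have "min_character (corona X) \<le>o ultrafilter_number" by (rule min_character_isolated_balls)
      \<comment> \<open>Here the inequality of the cardinals has to be strict.\<close>
      then have "min_character (corona X) <o dominating_number" using assms(1) by (rule ordLeq_ordLess_trans)
      then show False using char not_ordLess_ordIso by blast
    qed
  qed
  show ?thesis using 12 23 31 by blast
qed

end
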